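(* Let $u\in\mathrm{BMOA}(\mathbb T)$ and let $s>0$ be a singular value of $H_u$, i.e. $E_H(s):=\operatorname{Ker}(H_u^2-s^2I)\neq\{0\}$. Then there exist an inner function $\theta$ and an isometric multiplier $p\in\mathcal H^2(\mathbb T)$ on $\operatorname{Ran}H_\theta$ such that $$E_H(s)=p\operatorname{Ran}H_\theta .$$ Moreover $p$ and $\theta$ can be chosen such that $H_u(p)=s\theta p$, and in this case $$H_uT_p=sT_pH_\theta\quad\text{on }\operatorname{Ran}H_\theta,$$ i.e. $H_u(pf)=s\,p\,\theta\overline f$ for every $f\in\operatorname{Ran}H_\theta$.
   Context: $\mathcal H^2=\mathcal H^2(\mathbb T)\subset L^2(\mathbb T)$ is the Hardy space (identified with holomorphic functions on the unit disk $\mathbb D$), $P:L^2(\mathbb T)\to\mathcal H^2$ the orthogonal (Szegő) projection. For $u\in\mathrm{BMOA}(\mathbb T)$ the anti-linear Hankel operator is $H_uf=P(u\overline f)$, $f\in\mathcal H^2$; it is bounded. For an inner function $\theta$, $H_\theta^2$ is the orthogonal projection onto $\operatorname{Ran}H_\theta=\mathcal K_{z\theta}:=\mathcal H^2\ominus z\theta\mathcal H^2=\{f\in\mathcal H^2:\theta\overline f\in\mathcal H^2\}$, and $H_\theta f=\theta\overline f$ for $f\in\operatorname{Ran}H_\theta$. If $F\subset\mathcal H^2$ is a closed subspace, a holomorphic function $p$ on $\mathbb D$ is an isometric multiplier on $F$ if $pf\in\mathcal H^2$ and $\|pf\|=\|f\|$ for all $f\in F$; then $pF:=\{pf:f\in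 F\}$. $T_a$ denotes the Toeplitz operator $T_af=P(af)$; for an isometric multiplier $p$ on $F$, $T_pf=pf$ for $f\in F$. *)

theory Defs
  imports "HOL-Analysis.Analysis"
begin

text \<open>Functions on the unit circle T are represented as functions complex => complex,
  of which only the values at cis t (t in [0, 2 pi]) matter.  Elements of L^2(T) are
  identified up to equality almost everywhere; all notions below are invariant
  under a.e. equality.\<close>

definition circ :: "real measure" where
  "circ = lebesgue_on {0..2*pi}"

definition ae_eq_circ :: "(complex \<Rightarrow> complex) \<Rightarrow> (complex \<Rightarrow> complex) \<Rightarrow> bool" where
  "ae_eq_circ f g \<longleftrightarrow> (AE t in circ. f (cis t) = g (cis t))"

definition L1c :: "(complex \<Rightarrow> complex) set" where
  "L1c = {f. integrable circ (\<lambda>t. f (cis t))}"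

definition L2c :: "(complex \<Rightarrow> complex) set" where
  "L2c = {f. (\<lambda>t. f (cis t)) \<in> borel_measurable circ \<and>
             integrable circ (\<lambda>t. (cmod (f (cis t)))\<^sup>2)}"

definition sqnorm_circ :: "(complex \<Rightarrow> complex) \<Rightarrow> real" where
  "sqnorm_circ f = integral\<^sup>L circ (\<lambda>t. (cmod (f (cis t)))\<^sup>2) / (2*pi)"

definition fcoeff :: "(complex \<Rightarrow> complex) \<Rightarrow> int \<Rightarrow> complex" where
  "fcoeff f n = integral\<^sup>L circ (\<lambda>t. f (cis t) * cis (- (of_int n * t))) / of_real (2*pi)"

definition H2 :: "(complex \<Rightarrow> complex) set" where
  "H2 = {f \<in> L2c. \<forall>n<0. fcoeff f n = 0}"

definition arc_avg :: "(complex \<Rightarrow> complex) \<Rightarrow> real \<Rightarrow> real \<Rightarrow> complex" where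
  "arc_avg u a l = integral\<^sup>L (lebesgue_on {a..a+l}) (\<lambda>t. u (cis t)) / of_real l"

definition BMOA :: "(complex \<Rightarrow> complex) set" where
  "BMOA = {u \<in> H2. \<exists>C. \<forall>a l. 0 < l \<and> l \<le> 2*pi \<longrightarrow>
     integral\<^sup>L (lebesgue_on {a..a+l}) (\<lambda>t. cmod (u (cis t) - arc_avg u a l)) / l \<le> C}"

text \<open>Anti-linear Hankel operator, stated relationally: hankel u f g means g = H_u f = P(u conj f),
  i.e. g is in H^2 and its nonnegative Fourier coefficients are those of u conj f.\<close>
definition hankel :: "(complex \<Rightarrow> complex) \<Rightarrow> (complex \<Rightarrow> complex) \<Rightarrow> (complex \<Rightarrow> complex) \<Rightarrow> bool" where
  "hankel u f g \<longleftrightarrow> g \<in> H2 \<and> (\<forall>n\<ge>0. fcoeff g n = fcoeff (\<lambda>z. u z * cnj (f z)) n)"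

definition ran_hankel :: "(complex \<Rightarrow> complex) \<Rightarrow> (complex \<Rightarrow> complex) set" where
  "ran_hankel u = {g. \<exists>f\<in>H2. hankel u f g}"

definition EH :: "(complex \<Rightarrow> complex) \<Rightarrow> real \<Rightarrow> (complex \<Rightarrow> complex) set" where
  "EH u s = {f \<in> H2. \<exists>g. hankel u f g \<and> hankel u g (\<lambda>z. of_real (s\<^sup>2) * f z)}"

definition inner_fun :: "(complex \<Rightarrow> complex) \<Rightarrow> bool" where
  "inner_fun \<theta> \<longleftrightarrow> \<theta> \<in> H2 \<and> (AE t in circ. cmod (\<theta> (cis t)) = 1)"

definition isometric_multiplier :: "(complex \<Rightarrow> complex) \<Rightarrow> (complex \<Rightarrow> complex) set \<Rightarrow> bool" where
  "isometric_multiplier p F \<longleftrightarrow>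
     (\<forall>f\<in>F. (\<lambda>z. p z * f z) \<in> H2 \<and> sqnorm_circ (\<lambda>z. p z * f z) = sqnorm_circ f)"

definition eq_mult_space :: "(complex \<Rightarrow> complex) set \<Rightarrow> (complex \<Rightarrow> complex) \<Rightarrow> (complex \<Rightarrow> complex) set \<Rightarrow> bool" where
  "eq_mult_space E p F \<longleftrightarrow>
     (\<forall>f\<in>E. \<exists>g\<in>F. ae_eq_circ f (\<lambda>z. p z * g z)) \<and> (\<forall>g\<in>F. (\<lambda>z. p z * g z) \<in> E)"

end

theory Submission
  imports Defs
begin

text \<open>Let \<open>E\<close> be the Schmidt subspace and \<open>J f = H f / s\<close> for \<open>f\<close> in \<open>E\<close>, so that \<open>J\<close> is an involution of \<open>E\<close>.
  For \<open>f\<close> and \<open>h\<close> in \<open>E\<close> the functions \<open>s J h - u cnj h\<close> and \<open>s J f - u cnj f\<close> are integrable and have only negative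
  frequencies. Multiplying them by \<open>cnj f\<close> and \<open>cnj h\<close> and subtracting eliminates \<open>u\<close>, and a Smirnov type argument shows
  that \<open>J h cnj f - J f cnj h\<close> has no nonnegative frequencies; by symmetry it vanishes. Hence \<open>J f = \<phi> cnj f\<close> on \<open>E\<close>
  with a single unimodular function \<open>\<phi>\<close>.

  If \<open>N\<close> is the least order of vanishing at the origin of the elements of \<open>E\<close>, then \<open>f / z\<close> lies in \<open>E\<close> whenever
  \<open>f\<close> in \<open>E\<close> vanishes to order larger than \<open>N\<close>. Hitt's algorithm, run with the normalized extremal function \<open>p\<close> for
  the coefficient of order \<open>N\<close>, therefore writes every \<open>h\<close> in \<open>E\<close> as \<open>p a\<close> with \<open>a\<close> in the Hardy space and
  \<open>norm a \<le> norm h\<close>. In particular \<open>J p = p \<theta>\<close>, where \<open>\<theta>\<close> is inner because \<open>\<bar>J p\<bar> = \<bar>p\<bar>\<close>. The quadratic form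
  \<open>norm (p a)^2 - norm a^2\<close> is nonnegative and vanishes at all backward shifts of \<open>\<theta>\<close>, which span the model space
  of \<open>z \<theta>\<close>; so \<open>p\<close> is isometric on this space and maps it onto \<open>E\<close>.\<close>

subsection \<open>Measurability on the circle\<close>

text \<open>The obstacle is integrability. For square integrable \<open>u\<close> and
  \<open>h\<close> the product \<open>u cnj h\<close> is only integrable, so the remainder
  \<open>s J h - u cnj h\<close> times \<open>cnj f\<close> need not have Fourier coefficients at
  all. Only the difference of two such products is known to be integrable, after \<open>u\<close>
  has cancelled; the outer multipliers exist to compute its coefficients term by term. All analysis
  stays on the circle: vanishing negative coefficients replace holomorphy, \<open>fcoeff a 0\<close>
  replaces the value at the origin, and \<open>cnj z\<close> replaces division by \<open>z\<close>.
  The isometry starts from a single function: \<open>J p = p \<theta>\<close> has the norm of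
  \<open>p\<close>, which is 1, and the inner function \<open>\<theta>\<close> has norm 1 too. It
  propagates because a Hitt step on \<open>p a\<close> is \<open>p\<close> times the backward shift
  of \<open>a\<close>, and both remove exactly \<open>|a(0)|^2\<close> from the squared norm.
  Passing to the closed span is a step of its own, as \<open>p\<close> may be unbounded.\<close>

definition meas_circ :: "(complex \<Rightarrow> complex) \<Rightarrow> bool" where
  "meas_circ f \<longleftrightarrow> (\<lambda>t. f (cis t)) \<in> borel_measurable circ"

definition cint :: "(complex \<Rightarrow> complex) \<Rightarrow> complex" where
  "cint f = integral\<^sup>L circ (\<lambda>t. f (cis t)) / of_real (2*pi)"

lemma meas_circD [measurable_dest]: "meas_circ f \<Longrightarrow> (\<lambda>t. f (cis t)) \<in> borel_measurable circ"
  by (simp add: meas_circ_def)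

lemma finite_measure_circ: "finite_measure circ"
proof -
  have "emeasure lebesgue {0..2*pi} \<noteq> \<infinity>" by simp
  then show ?thesis
    unfolding circ_def by (intro finite_measureI) (simp add: emeasure_restrict_space)
qed

interpretation circ: finite_measure circ
  by (rule finite_measure_circ)

lemma space_circ: "space circ = {0..2*pi}"
  by (simp add: circ_def)

lemma measure_circ: "measure circ (space circ) = 2*pi"
  unfolding space_circ by (simp add: circ_def measure_restrict_space)

lemma meas_circ_id: "meas_circ (\<lambda>z. z)"
proof -
  have "cis \<in> borel_measurable borel"
    by (intro borel_measurable_continuous_onI continuous_intros)
  then have "cis \<in> borel_measurable lebesgue"
    by (simp add: measurable_completion)
  then show ?thesis
    unfolding meas_circ_def circ_def by (rule measurable_restrict_space1)
qed

lemma cis_measurable [measurable]: "cis \<in> borel_measurable circ"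
  using meas_circ_id unfolding meas_circ_def .

lemma meas_circ_continuous: "continuous_on UNIV g \<Longrightarrow> meas_circ g"
  unfolding meas_circ_def
  by (rule measurable_compose[OF cis_measurable]) (simp add: borel_measurable_continuous_onI)

lemma L1cD: "f \<in> L1c \<Longrightarrow> integrable circ (\<lambda>t. f (cis t))"
  by (simp add: L1c_def)

lemma L1c_meas_circ: "f \<in> L1c \<Longrightarrow> meas_circ f"
  by (simp add: L1c_def meas_circ_def)

lemma L2c_meas_circ: "f \<in> L2c \<Longrightarrow> meas_circ f"
  by (simp add: L2c_def meas_circ_def)

lemma L2cD: "f \<in> L2c \<Longrightarrow> integrable circ (\<lambda>t. (cmod (f (cis t)))\<^sup>2)"
  by (simp add: L2c_def)

lemma L2cI: "meas_circ f \<Longrightarrow> integrable circ (\<lambda>t. (cmod (f (cis t)))\<^sup>2) \<Longrightarrow> f \<in> L2c"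
  by (simp add: L2c_def meas_circ_def)

lemma meas_circ_add: "meas_circ f \<Longrightarrow> meas_circ g \<Longrightarrow> meas_circ (\<lambda>z. f z + g z)"
  and meas_circ_diff: "meas_circ f \<Longrightarrow> meas_circ g \<Longrightarrow> meas_circ (\<lambda>z. f z - g z)"
  and meas_circ_mult: "meas_circ f \<Longrightarrow> meas_circ g \<Longrightarrow> meas_circ (\<lambda>z. f z * g z)"
  and meas_circ_const: "meas_circ (\<lambda>z. c)"
  by (simp_all add: meas_circ_def)

lemma meas_circ_cnj: "meas_circ f \<Longrightarrow> meas_circ (\<lambda>z. cnj (f z))"
proof -
  assume "meas_circ f"
  then have [measurable]: "(\<lambda>t. f (cis t)) \<in> borel_measurable circ" by (simp add: meas_circ_def)
  have "cnj \<in> borel_measurable borel"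
    by (intro borel_measurable_continuous_onI continuous_intros)
  then show ?thesis unfolding meas_circ_def
    by (rule measurable_compose[rotated]) simp
qed

lemma meas_circ_power: "meas_circ f \<Longrightarrow> meas_circ (\<lambda>z. f z ^ n)"
  by (simp add: meas_circ_def)

lemma meas_circ_sum: "(\<And>i. i \<in> I \<Longrightarrow> meas_circ (f i)) \<Longrightarrow> meas_circ (\<lambda>z. \<Sum>i\<in>I. f i z)"
  by (simp add: meas_circ_def)

lemma meas_circ_of_real: "(\<lambda>t. f (cis t)) \<in> borel_measurable circ \<Longrightarrow> meas_circ (\<lambda>z. of_real (f z))"
  unfolding meas_circ_def by measurable

lemma meas_circ_cnj_id: "meas_circ cnj"
  using meas_circ_cnj[OF meas_circ_id] by simp

lemma meas_circ_powi: "meas_circ (\<lambda>z. z powi n)"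
proof -
  \<comment> \<open>On the circle \<open>inverse z\<close> equals \<open>cnj z\<close>, which turns
    negative powers into powers of a continuous function. The two functions differ off the circle,
    where \<open>meas_circ\<close> does not look.\<close>
  have "meas_circ (\<lambda>z. if n \<ge> 0 then z ^ nat n else cnj z ^ nat (-n))"
    by (cases "n \<ge> 0") (simp_all add: meas_circ_power meas_circ_id meas_circ_cnj_id)
  moreover have "cis t powi n = (if n \<ge> 0 then cis t ^ nat n else cnj (cis t) ^ nat (-n))" for t
    by (simp add: power_int_def cis_inverse cis_cnj)
  ultimately show ?thesis by (simp add: meas_circ_def cong: if_cong)
qed

lemma meas_circ_exp: "meas_circ f \<Longrightarrow> meas_circ (\<lambda>z. exp (f z))"
  unfolding meas_circ_def by measurable

lemmas meas_circ_intros = meas_circ_add meas_circ_diff meas_circ_mult meas_circ_const meas_circ_cnj meas_circ_power meas_circ_sum meas_circ_id meas_circ_cnj_id meas_circ_powi meas_circ_exp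

subsection \<open>Integrable and square integrable functions\<close>

lemma L1c_add: "f \<in> L1c \<Longrightarrow> g \<in> L1c \<Longrightarrow> (\<lambda>z. f z + g z) \<in> L1c"
  and L1c_diff: "f \<in> L1c \<Longrightarrow> g \<in> L1c \<Longrightarrow> (\<lambda>z. f z - g z) \<in> L1c"
  and L1c_scale: "f \<in> L1c \<Longrightarrow> (\<lambda>z. c * f z) \<in> L1c"
  and L1c_cnj: "f \<in> L1c \<Longrightarrow> (\<lambda>z. cnj (f z)) \<in> L1c"
  and L1c_sum: "(\<And>i. i \<in> I \<Longrightarrow> F i \<in> L1c) \<Longrightarrow> (\<lambda>z. \<Sum>i\<in>I. F i z) \<in> L1c"
  by (simp_all add: L1c_def)

lemma L1c_bound:
  assumes "f \<in> L1c" "meas_circ g" "AE t in circ. cmod (g (cis t)) \<le> cmod (f (cis t))"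
  shows "g \<in> L1c"
  using assms unfolding L1c_def meas_circ_def by (auto intro: Bochner_Integration.integrable_bound)

lemma L1c_mult_bounded:
  assumes "f \<in> L1c" "meas_circ g" "AE t in circ. cmod (g (cis t)) \<le> C"
  shows "(\<lambda>z. f z * g z) \<in> L1c"
proof (rule L1c_bound)
  show "(\<lambda>z. of_real C * f z) \<in> L1c" by (rule L1c_scale[OF assms(1)])
  show "meas_circ (\<lambda>z. f z * g z)" by (intro meas_circ_mult L1c_meas_circ assms)
  show "AE t in circ. cmod (f (cis t) * g (cis t)) \<le> cmod (of_real C * f (cis t))"
    using assms(3)
  proof (rule AE_mp, intro AE_I2 impI)
    fix t assume h: "cmod (g (cis t)) \<le> C"
    then have "0 \<le> C" using norm_ge_zero order_trans by blast
    then show "cmod (f (cis t) * g (cis t)) \<le> cmod (of_real C * f (cis t))"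
      using h by (metis mult.commute mult_left_mono norm_ge_zero norm_mult norm_of_real abs_of_nonneg)
  qed
qed

lemma L1c_const: "(\<lambda>z. c) \<in> L1c"
  by (simp add: L1c_def)

lemma L2_mult_L1:
  assumes "f \<in> L2c" "g \<in> L2c" shows "(\<lambda>z. f z * g z) \<in> L1c"
proof -
  have "integrable circ (\<lambda>t. (cmod (f (cis t)))\<^sup>2 + (cmod (g (cis t)))\<^sup>2)"
    by (intro Bochner_Integration.integrable_add L2cD assms)
  moreover have "(\<lambda>t. f (cis t) * g (cis t)) \<in> borel_measurable circ"
    using assms by (auto simp: meas_circ_def dest!: L2c_meas_circ)
  moreover have "norm (f (cis t) * g (cis t)) \<le> norm ((cmod (f (cis t)))\<^sup>2 + (cmod (g (cis t)))\<^sup>2)" for t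
  proof -
    have "2 * (cmod (f (cis t)) * cmod (g (cis t))) \<le> (cmod (f (cis t)))\<^sup>2 + (cmod (g (cis t)))\<^sup>2"
      using sum_squares_bound[of "cmod (f (cis t))" "cmod (g (cis t))"] by simp
    moreover have "0 \<le> cmod (f (cis t)) * cmod (g (cis t))" by simp
    ultimately have "cmod (f (cis t)) * cmod (g (cis t)) \<le> (cmod (f (cis t)))\<^sup>2 + (cmod (g (cis t)))\<^sup>2"
      by linarith
    then show ?thesis by (simp add: norm_mult)
  qed
  ultimately show ?thesis unfolding L1c_def
    by (auto intro: Bochner_Integration.integrable_bound)
qed

lemma L2c_const: "(\<lambda>z. c) \<in> L2c"
  by (simp add: L2c_def)

lemma L2_L1: "f \<in> L2c \<Longrightarrow> f \<in> L1c"
  using L2_mult_L1[of f "\<lambda>z. 1"] by (simp add: L2c_const)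

lemma L2c_bound:
  assumes "f \<in> L2c" "meas_circ g" "AE t in circ. cmod (g (cis t)) \<le> cmod (f (cis t))"
  shows "g \<in> L2c"
proof (rule L2cI[OF assms(2)])
  have [measurable]: "(\<lambda>t. g (cis t)) \<in> borel_measurable circ" using assms(2) by (simp add: meas_circ_def)
  show "integrable circ (\<lambda>t. (cmod (g (cis t)))\<^sup>2)"
  proof (rule Bochner_Integration.integrable_bound[OF L2cD[OF assms(1)]])
    show "AE t in circ. norm ((cmod (g (cis t)))\<^sup>2) \<le> norm ((cmod (f (cis t)))\<^sup>2)"
      using assms(3) by eventually_elim (simp add: power_mono)
  qed measurable
qed

lemma L2c_scale: "f \<in> L2c \<Longrightarrow> (\<lambda>z. c * f z) \<in> L2c"
  using L2cD[of f] meas_circ_mult[OF meas_circ_const L2c_meas_circ, of f]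
  by (intro L2cI) (simp_all add: norm_mult power_mult_distrib)

lemma L2c_cnj: "f \<in> L2c \<Longrightarrow> (\<lambda>z. cnj (f z)) \<in> L2c"
  using L2cD[of f] meas_circ_cnj[OF L2c_meas_circ, of f] by (intro L2cI) simp_all

lemma L2c_mult_bounded:
  assumes "f \<in> L2c" "meas_circ g" "AE t in circ. cmod (g (cis t)) \<le> C"
  shows "(\<lambda>z. f z * g z) \<in> L2c"
proof (rule L2c_bound)
  show "(\<lambda>z. of_real C * f z) \<in> L2c" by (rule L2c_scale[OF assms(1)])
  show "meas_circ (\<lambda>z. f z * g z)" by (intro meas_circ_mult L2c_meas_circ assms)
  show "AE t in circ. cmod (f (cis t) * g (cis t)) \<le> cmod (of_real C * f (cis t))"
    using assms(3)
  proof (rule AE_mp, intro AE_I2 impI)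
    fix t assume h: "cmod (g (cis t)) \<le> C"
    then have "0 \<le> C" using norm_ge_zero order_trans by blast
    then show "cmod (f (cis t) * g (cis t)) \<le> cmod (of_real C * f (cis t))"
      using h by (metis mult.commute mult_left_mono norm_ge_zero norm_mult norm_of_real abs_of_nonneg)
  qed
qed

lemma L2c_add:
  assumes "f \<in> L2c" "g \<in> L2c" shows "(\<lambda>z. f z + g z) \<in> L2c"
proof (rule L2cI)
  show "meas_circ (\<lambda>z. f z + g z)" by (intro meas_circ_intros L2c_meas_circ assms)
  then have [measurable]: "(\<lambda>t. f (cis t) + g (cis t)) \<in> borel_measurable circ" by (simp add: meas_circ_def)
  have "integrable circ (\<lambda>t. 2 * (cmod (f (cis t)))\<^sup>2 + 2 * (cmod (g (cis t)))\<^sup>2)"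
    by (intro Bochner_Integration.integrable_add integrable_mult_right L2cD assms)
  then show "integrable circ (\<lambda>t. (cmod (f (cis t) + g (cis t)))\<^sup>2)"
  proof (rule Bochner_Integration.integrable_bound)
    show "AE t in circ. norm ((cmod (f (cis t) + g (cis t)))\<^sup>2)
       \<le> norm (2 * (cmod (f (cis t)))\<^sup>2 + 2 * (cmod (g (cis t)))\<^sup>2)"
    proof (intro AE_I2)
      fix t
      have "(cmod (f (cis t) + g (cis t)))\<^sup>2 \<le> (cmod (f (cis t)) + cmod (g (cis t)))\<^sup>2"
        by (intro power_mono norm_triangle_ineq) simp
      also have "\<dots> \<le> 2 * (cmod (f (cis t)))\<^sup>2 + 2 * (cmod (g (cis t)))\<^sup>2"
        using sum_squares_bound[of "cmod (f (cis t))" "cmod (g (cis t))"]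
        by (simp add: power2_sum)
      finally show "norm ((cmod (f (cis t) + g (cis t)))\<^sup>2)
       \<le> norm (2 * (cmod (f (cis t)))\<^sup>2 + 2 * (cmod (g (cis t)))\<^sup>2)" by simp
    qed
  qed measurable
qed

lemma L2c_diff: "f \<in> L2c \<Longrightarrow> g \<in> L2c \<Longrightarrow> (\<lambda>z. f z - g z) \<in> L2c"
  using L2c_add[of f "\<lambda>z. (-1) * g z"] L2c_scale[of g "-1"] by simp

lemma L2c_sum: "(\<And>i. i \<in> I \<Longrightarrow> F i \<in> L2c) \<Longrightarrow> (\<lambda>z. \<Sum>i\<in>I. F i z) \<in> L2c"
  by (induction I rule: infinite_finite_induct) (auto intro: L2c_const L2c_add)

lemma norm_cis_powi [simp]: "cmod (cis t powi n) = 1"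
  by (simp add: norm_power_int)

lemma L2c_powi: "(\<lambda>z. z powi n) \<in> L2c"
  by (intro L2cI meas_circ_powi) simp

lemma L2c_powi_mult: "f \<in> L2c \<Longrightarrow> (\<lambda>z. z powi n * f z) \<in> L2c"
  using L2c_mult_bounded[of f "\<lambda>z. z powi n" 1] by (simp add: meas_circ_powi mult.commute)

lemma L1c_powi_mult: "f \<in> L1c \<Longrightarrow> (\<lambda>z. z powi n * f z) \<in> L1c"
  using L1c_mult_bounded[of f "\<lambda>z. z powi n" 1] by (simp add: meas_circ_powi mult.commute)


subsection \<open>The normalised integral\<close>

lemma cint_cong: "(\<And>t. f (cis t) = g (cis t)) \<Longrightarrow> cint f = cint g"
  by (simp add: cint_def)

lemma cint_cong_AE:
  assumes "meas_circ f" "meas_circ g" "ae_eq_circ f g" shows "cint f = cint g"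
  using assms integral_cong_AE[of "\<lambda>t. f (cis t)" circ "\<lambda>t. g (cis t)"]
  unfolding cint_def meas_circ_def ae_eq_circ_def by simp

lemma cint_add: "f \<in> L1c \<Longrightarrow> g \<in> L1c \<Longrightarrow> cint (\<lambda>z. f z + g z) = cint f + cint g"
  by (simp add: cint_def L1c_def add_divide_distrib)

lemma cint_diff: "f \<in> L1c \<Longrightarrow> g \<in> L1c \<Longrightarrow> cint (\<lambda>z. f z - g z) = cint f - cint g"
  by (simp add: cint_def L1c_def diff_divide_distrib)

lemma cint_scale: "cint (\<lambda>z. c * f z) = c * cint f"
  by (simp add: cint_def)

lemma cint_cnj: "cint (\<lambda>z. cnj (f z)) = cnj (cint f)"
  by (simp add: cint_def)

lemma cint_const: "cint (\<lambda>z. c) = c"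
  by (simp add: cint_def measure_circ scaleR_conv_of_real)

lemma cint_sum: "(\<And>i. i \<in> I \<Longrightarrow> F i \<in> L1c) \<Longrightarrow> cint (\<lambda>z. \<Sum>i\<in>I. F i z) = (\<Sum>i\<in>I. cint (F i))"
  by (simp add: cint_def L1c_def sum_divide_distrib)

lemma norm_cint_le: "cmod (cint f) \<le> integral\<^sup>L circ (\<lambda>t. cmod (f (cis t))) / (2*pi)"
proof -
  have "cmod (cint f) = cmod (integral\<^sup>L circ (\<lambda>t. f (cis t))) / (2*pi)"
    by (simp add: cint_def norm_divide norm_mult)
  also have "\<dots> \<le> integral\<^sup>L circ (\<lambda>t. cmod (f (cis t))) / (2*pi)"
    by (intro divide_right_mono integral_norm_bound) simp
  finally show ?thesis .
qed

lemma cint_dominated: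
  assumes "\<And>k::nat. meas_circ (F k)" "meas_circ f" "w \<in> L1c"
    and "\<And>k. AE t in circ. cmod (F k (cis t)) \<le> cmod (w (cis t))"
    and "AE t in circ. (\<lambda>k. F k (cis t)) \<longlonglongrightarrow> f (cis t)"
  shows "(\<lambda>k. cint (F k)) \<longlonglongrightarrow> cint f"
proof -
  have "(\<lambda>k. integral\<^sup>L circ (\<lambda>t. F k (cis t))) \<longlonglongrightarrow> integral\<^sup>L circ (\<lambda>t. f (cis t))"
    using assms by (intro integral_dominated_convergence[where w="\<lambda>t. cmod (w (cis t))"])
      (auto simp: meas_circ_def L1c_def)
  then show ?thesis unfolding cint_def by (intro tendsto_intros) auto
qed

lemma fcoeff_cint: "fcoeff f n = cint (\<lambda>z. z powi (-n) * f z)"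
proof -
  have "cis (- (of_int n * t)) = cis t powi (-n)" for t
    by (simp add: cis_power_int)
  then show ?thesis by (simp add: fcoeff_def cint_def mult.commute)
qed

subsection \<open>Convergence in the square mean\<close>

definition l2norm :: "(complex \<Rightarrow> complex) \<Rightarrow> real" where
  "l2norm f = sqrt (sqnorm_circ f)"

definition l2conv :: "(nat \<Rightarrow> complex \<Rightarrow> complex) \<Rightarrow> (complex \<Rightarrow> complex) \<Rightarrow> bool" where
  "l2conv F f \<longleftrightarrow> (\<lambda>k. l2norm (\<lambda>z. F k z - f z)) \<longlonglongrightarrow> 0"

lemma sqnorm_nonneg: "0 \<le> sqnorm_circ f"
  by (simp add: sqnorm_circ_def)

lemma l2norm_nonneg: "0 \<le> l2norm f"
  by (simp add: l2norm_def sqnorm_nonneg)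

lemma l2norm_sq: "(l2norm f)\<^sup>2 = sqnorm_circ f"
  by (simp add: l2norm_def sqnorm_nonneg)

lemma sqnorm_cong: "(\<And>t. cmod (f (cis t)) = cmod (g (cis t))) \<Longrightarrow> sqnorm_circ f = sqnorm_circ g"
  by (simp add: sqnorm_circ_def)

lemma l2norm_cong: "(\<And>t. cmod (f (cis t)) = cmod (g (cis t))) \<Longrightarrow> l2norm f = l2norm g"
  unfolding l2norm_def by (simp add: sqnorm_cong[of f g])

lemma sqnorm_cong_AE:
  assumes "meas_circ f" "meas_circ g" "AE t in circ. cmod (f (cis t)) = cmod (g (cis t))"
  shows "sqnorm_circ f = sqnorm_circ g"
proof -
  have [measurable]: "(\<lambda>t. f (cis t)) \<in> borel_measurable circ" "(\<lambda>t. g (cis t)) \<in> borel_measurable circ"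
    using assms by (simp_all add: meas_circ_def)
  have "integral\<^sup>L circ (\<lambda>t. (cmod (f (cis t)))\<^sup>2) = integral\<^sup>L circ (\<lambda>t. (cmod (g (cis t)))\<^sup>2)"
    using assms(3) by (intro integral_cong_AE) auto
  then show ?thesis by (simp add: sqnorm_circ_def)
qed

lemma sqnorm_scale: "sqnorm_circ (\<lambda>z. c * f z) = (cmod c)\<^sup>2 * sqnorm_circ f"
  by (simp add: sqnorm_circ_def norm_mult power_mult_distrib)

lemma l2norm_scale: "l2norm (\<lambda>z. c * f z) = cmod c * l2norm f"
  by (simp add: l2norm_def sqnorm_scale real_sqrt_mult)

lemma l2norm_minus_commute: "l2norm (\<lambda>z. f z - g z) = l2norm (\<lambda>z. g z - f z)"
  by (rule l2norm_cong) (simp add: norm_minus_commute)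

lemma sqnorm_cint: "f \<in> L2c \<Longrightarrow> of_real (sqnorm_circ f) = cint (\<lambda>z. f z * cnj (f z))"
proof -
  have "f (cis t) * cnj (f (cis t)) = of_real ((cmod (f (cis t)))\<^sup>2)" for t
    by (rule complex_norm_square[symmetric])
  then have "cint (\<lambda>z. f z * cnj (f z)) = integral\<^sup>L circ (\<lambda>t. complex_of_real ((cmod (f (cis t)))\<^sup>2)) / of_real (2*pi)"
    unfolding cint_def by presburger
  also have "\<dots> = of_real (sqnorm_circ f)"
    unfolding integral_complex_of_real sqnorm_circ_def of_real_divide ..
  finally show ?thesis by simp
qed

lemma sqnorm_add:
  assumes "f \<in> L2c" "g \<in> L2c"
  shows "sqnorm_circ (\<lambda>z. f z + g z) = sqnorm_circ f + sqnorm_circ g + 2 * Re (cint (\<lambda>z. f z * cnj (g z)))"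
proof -
  have L: "(\<lambda>z. f z * cnj (f z)) \<in> L1c" "(\<lambda>z. f z * cnj (g z)) \<in> L1c"
      "(\<lambda>z. g z * cnj (f z)) \<in> L1c" "(\<lambda>z. g z * cnj (g z)) \<in> L1c"
    using assms by (auto intro: L2_mult_L1 L2c_cnj)
  have "of_real (sqnorm_circ (\<lambda>z. f z + g z)) = cint (\<lambda>z. (f z + g z) * cnj (f z + g z))"
    by (rule sqnorm_cint) (intro L2c_add assms)
  also have "\<dots> = cint (\<lambda>z. (f z * cnj (f z) + f z * cnj (g z)) + (g z * cnj (f z) + g z * cnj (g z)))"
    by (rule cint_cong) (simp add: algebra_simps)
  also have "\<dots> = (cint (\<lambda>z. f z * cnj (f z)) + cint (\<lambda>z. f z * cnj (g z)))
      + (cint (\<lambda>z. g z * cnj (f z)) + cint (\<lambda>z. g z * cnj (g z)))"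
    using L by (simp add: cint_add L1c_add)
  also have "cint (\<lambda>z. g z * cnj (f z)) = cnj (cint (\<lambda>z. f z * cnj (g z)))"
    unfolding cint_cnj[symmetric] by (rule cint_cong) simp
  also have "cint (\<lambda>z. f z * cnj (f z)) = of_real (sqnorm_circ f)" using sqnorm_cint[OF assms(1)] by simp
  also have "cint (\<lambda>z. g z * cnj (g z)) = of_real (sqnorm_circ g)" using sqnorm_cint[OF assms(2)] by simp
  finally show ?thesis
    by (simp add: complex_eq_iff)
qed

lemma sqnorm_diff:
  assumes "f \<in> L2c" "g \<in> L2c"
  shows "sqnorm_circ (\<lambda>z. f z - g z) = sqnorm_circ f + sqnorm_circ g - 2 * Re (cint (\<lambda>z. f z * cnj (g z)))"
proof -
  have "sqnorm_circ (\<lambda>z. f z + (-1) * g z) = sqnorm_circ f + sqnorm_circ (\<lambda>z. (-1) * g z)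
      + 2 * Re (cint (\<lambda>z. f z * cnj ((-1) * g z)))"
    by (rule sqnorm_add) (intro assms L2c_scale)+
  also have "cint (\<lambda>z. f z * cnj ((-1) * g z)) = cint (\<lambda>z. (-1) * (f z * cnj (g z)))"
    by (rule cint_cong) simp
  finally show ?thesis unfolding sqnorm_scale cint_scale by simp
qed

text \<open>The integral of \<open>(x * cmod f - cmod g)^2\<close> is a nonnegative quadratic
  polynomial in \<open>x\<close>. Keeping the moduli under the integral also yields the L^1 bound
  \<open>L1_le_l2norm\<close>.\<close>

lemma cauchy_schwarz_abs:
  assumes "f \<in> L2c" "g \<in> L2c"
  shows "integral\<^sup>L circ (\<lambda>t. cmod (f (cis t)) * cmod (g (cis t))) / (2*pi) \<le> l2norm f * l2norm g"
proof -
  define C where "C = integral\<^sup>L circ (\<lambda>t. cmod (f (cis t)) * cmod (g (cis t))) / (2*pi)"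
  have C0: "0 \<le> C" by (simp add: C_def)
  have Lfg: "integrable circ (\<lambda>t. cmod (f (cis t)) * cmod (g (cis t)))"
    using integrable_norm[OF L1cD[OF L2_mult_L1[OF assms]]] by (simp add: norm_mult)
  have pos: "0 \<le> sqnorm_circ f * x\<^sup>2 - 2 * C * x + sqnorm_circ g" for x :: real
  proof -
    have "0 \<le> integral\<^sup>L circ (\<lambda>t. (x * cmod (f (cis t)) - cmod (g (cis t)))\<^sup>2)" by simp
    also have "\<dots> = integral\<^sup>L circ (\<lambda>t. x\<^sup>2 * (cmod (f (cis t)))\<^sup>2
        - 2 * x * (cmod (f (cis t)) * cmod (g (cis t))) + (cmod (g (cis t)))\<^sup>2)"
      by (rule arg_cong[where f="integral\<^sup>L circ"]) (simp add: fun_eq_iff power2_diff power_mult_distrib)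
    also have "\<dots> = x\<^sup>2 * integral\<^sup>L circ (\<lambda>t. (cmod (f (cis t)))\<^sup>2)
        - 2 * x * integral\<^sup>L circ (\<lambda>t. cmod (f (cis t)) * cmod (g (cis t)))
        + integral\<^sup>L circ (\<lambda>t. (cmod (g (cis t)))\<^sup>2)"
      using L2cD[OF assms(1)] L2cD[OF assms(2)] Lfg by simp
    finally have "0 \<le> (x\<^sup>2 * integral\<^sup>L circ (\<lambda>t. (cmod (f (cis t)))\<^sup>2)
        - 2 * x * integral\<^sup>L circ (\<lambda>t. cmod (f (cis t)) * cmod (g (cis t)))
        + integral\<^sup>L circ (\<lambda>t. (cmod (g (cis t)))\<^sup>2)) / (2*pi)" by simp
    then show ?thesis unfolding C_def sqnorm_circ_def
      by (simp add: add_divide_distrib diff_divide_distrib mult_ac)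
  qed
  have "C\<^sup>2 \<le> sqnorm_circ f * sqnorm_circ g"
  proof (cases "sqnorm_circ f = 0")
    case True
    have "C = 0"
    proof (rule ccontr)
      assume "C \<noteq> 0"
      then have "C > 0" using C0 by simp
      \<comment> \<open>With vanishing leading coefficient the polynomial is affine with negative
        slope; this argument makes its value -1.\<close>
      have "0 \<le> - 2 * C * ((sqnorm_circ g + 1) / (2*C)) + sqnorm_circ g"
        using pos[of "(sqnorm_circ g + 1) / (2*C)"] True by simp
      also have "\<dots> = - 1" using \<open>C > 0\<close> by (simp add: field_simps)
      finally show False by simp
    qed
    then show ?thesis using True by simp
  next
    case False
    then have a: "sqnorm_circ f > 0" using sqnorm_nonneg[of f] by simp
    \<comment> \<open>The polynomial is evaluated at the vertex of the parabola.\<close>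
    have "0 \<le> sqnorm_circ f * (C / sqnorm_circ f)\<^sup>2 - 2 * C * (C / sqnorm_circ f) + sqnorm_circ g"
      by (rule pos)
    also have "\<dots> = sqnorm_circ g - C\<^sup>2 / sqnorm_circ f"
      using a by (simp add: field_simps power2_eq_square)
    finally show ?thesis using a by (simp add: field_simps)
  qed
  then have "C\<^sup>2 \<le> (l2norm f * l2norm g)\<^sup>2" by (simp add: power_mult_distrib l2norm_sq)
  then show ?thesis unfolding C_def[symmetric]
    by (rule power2_le_imp_le) (simp add: l2norm_nonneg)
qed

lemma cauchy_schwarz:
  assumes "f \<in> L2c" "g \<in> L2c"
  shows "cmod (cint (\<lambda>z. f z * g z)) \<le> l2norm f * l2norm g"
  using norm_cint_le[of "\<lambda>z. f z * g z"] cauchy_schwarz_abs[OF assms]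
  by (simp add: norm_mult)

lemma l2norm_triangle:
  assumes "f \<in> L2c" "g \<in> L2c"
  shows "l2norm (\<lambda>z. f z + g z) \<le> l2norm f + l2norm g"
proof -
  have "Re (cint (\<lambda>z. f z * cnj (g z))) \<le> l2norm f * l2norm (\<lambda>z. cnj (g z))"
    using cauchy_schwarz[OF assms(1) L2c_cnj[OF assms(2)]] complex_Re_le_cmod order_trans by blast
  also have "l2norm (\<lambda>z. cnj (g z)) = l2norm g" by (rule l2norm_cong) simp
  finally have "(l2norm (\<lambda>z. f z + g z))\<^sup>2 \<le> (l2norm f + l2norm g)\<^sup>2"
    using sqnorm_add[OF assms] by (simp add: power2_sum l2norm_sq)
  then show ?thesis by (rule power2_le_imp_le) (simp add: l2norm_nonneg)
qed

lemma l2norm_triangle_diff: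
  assumes "f \<in> L2c" "g \<in> L2c" "h \<in> L2c"
  shows "l2norm (\<lambda>z. f z - h z) \<le> l2norm (\<lambda>z. f z - g z) + l2norm (\<lambda>z. g z - h z)"
  using l2norm_triangle[OF L2c_diff[OF assms(1,2)] L2c_diff[OF assms(2,3)]] by simp

lemma l2norm_diff_le:
  assumes "f \<in> L2c" "g \<in> L2c"
  shows "\<bar>l2norm f - l2norm g\<bar> \<le> l2norm (\<lambda>z. f z - g z)"
  using l2norm_triangle[OF L2c_diff[OF assms] assms(2)] l2norm_triangle[OF L2c_diff[OF assms(2,1)] assms(1)]
    l2norm_minus_commute[of f g] by simp

lemma sqnorm_zero_iff:
  assumes "f \<in> L2c"
  shows "sqnorm_circ f = 0 \<longleftrightarrow> ae_eq_circ f (\<lambda>_. 0)"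
  using integral_nonneg_eq_0_iff_AE[OF L2cD[OF assms]]
  by (simp add: sqnorm_circ_def ae_eq_circ_def)

text \<open>Converts square mean estimates into L^1 estimates, from which almost everywhere
  convergence is extracted.\<close>

lemma L1_le_l2norm:
  assumes "f \<in> L2c"
  shows "integral\<^sup>L circ (\<lambda>t. cmod (f (cis t))) \<le> 2 * pi * l2norm f"
proof -
  have "l2norm (\<lambda>z. 1) = 1" by (simp add: l2norm_def sqnorm_circ_def measure_circ)
  then show ?thesis using cauchy_schwarz_abs[OF assms L2c_const[of 1]] by (simp add: field_simps)
qed

lemma l2conv_cint:
  assumes "\<And>k. F k \<in> L2c" "f \<in> L2c" "g \<in> L2c" "l2conv F f"
  shows "(\<lambda>k. cint (\<lambda>z. F k z * g z)) \<longlonglongrightarrow> cint (\<lambda>z. f z * g z)"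
proof (rule LIM_zero_cancel, rule tendsto_norm_zero_cancel, rule tendsto_sandwich[where f="\<lambda>_. 0"])
  show "(\<lambda>k. l2norm (\<lambda>z. F k z - f z) * l2norm g) \<longlonglongrightarrow> 0"
    using assms(4) unfolding l2conv_def by (rule tendsto_mult_left_zero)
  have "cmod (cint (\<lambda>z. F k z * g z) - cint (\<lambda>z. f z * g z)) \<le> l2norm (\<lambda>z. F k z - f z) * l2norm g" for k
  proof -
    have "cint (\<lambda>z. F k z * g z) - cint (\<lambda>z. f z * g z) = cint (\<lambda>z. F k z * g z - f z * g z)"
      using assms by (simp add: cint_diff L2_mult_L1)
    also have "\<dots> = cint (\<lambda>z. (F k z - f z) * g z)" by (rule cint_cong) (simp add: algebra_simps)
    finally show ?thesis using cauchy_schwarz[OF L2c_diff[OF assms(1,2)] assms(3)] by simp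
  qed
  then show "\<forall>\<^sub>F k in sequentially. cmod (cint (\<lambda>z. F k z * g z) - cint (\<lambda>z. f z * g z)) \<le> l2norm (\<lambda>z. F k z - f z) * l2norm g"
    by simp
qed auto

lemma l2conv_l2norm:
  assumes "\<And>k. F k \<in> L2c" "f \<in> L2c" "l2conv F f"
  shows "(\<lambda>k. l2norm (F k)) \<longlonglongrightarrow> l2norm f"
proof (rule LIM_zero_cancel, rule tendsto_rabs_zero_cancel, rule tendsto_sandwich[where f="\<lambda>_. 0"])
  show "(\<lambda>k. l2norm (\<lambda>z. F k z - f z)) \<longlonglongrightarrow> 0" using assms(3) unfolding l2conv_def .
  show "\<forall>\<^sub>F k in sequentially. \<bar>l2norm (F k) - l2norm f\<bar> \<le> l2norm (\<lambda>z. F k z - f z)"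
    using l2norm_diff_le assms by simp
qed auto

lemma l2conv_sqnorm:
  assumes "\<And>k. F k \<in> L2c" "f \<in> L2c" "l2conv F f"
  shows "(\<lambda>k. sqnorm_circ (F k)) \<longlonglongrightarrow> sqnorm_circ f"
  unfolding l2norm_sq[symmetric] by (intro tendsto_power l2conv_l2norm assms)

lemma l2conv_AE_subseq:
  assumes "\<And>k. F k \<in> L2c" "f \<in> L2c" "l2conv F f"
  obtains r :: "nat \<Rightarrow> nat" where "strict_mono r" "AE t in circ. (\<lambda>k. F (r k) (cis t)) \<longlonglongrightarrow> f (cis t)"
proof -
  have i: "integrable circ (\<lambda>t. F k (cis t) - f (cis t))" for k
    using L1cD[OF L2_L1[OF L2c_diff[OF assms(1)[of k] assms(2)]]] .
  have "(\<lambda>k. integral\<^sup>L circ (\<lambda>t. cmod (F k (cis t) - f (cis t)))) \<longlonglongrightarrow> 0"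
  proof (rule tendsto_sandwich[where f="\<lambda>_. 0"])
    show "(\<lambda>k. 2 * pi * l2norm (\<lambda>z. F k z - f z)) \<longlonglongrightarrow> 0"
      using assms(3) unfolding l2conv_def by (rule tendsto_mult_right_zero)
    show "\<forall>\<^sub>F k in sequentially. integral\<^sup>L circ (\<lambda>t. cmod (F k (cis t) - f (cis t))) \<le> 2 * pi * l2norm (\<lambda>z. F k z - f z)"
      using L1_le_l2norm[OF L2c_diff[OF assms(1) assms(2)]] by simp
  qed auto
  from tendsto_L1_AE_subseq[OF i this] obtain r :: "nat \<Rightarrow> nat"
    where "strict_mono r" "AE t in circ. (\<lambda>k. F (r k) (cis t) - f (cis t)) \<longlonglongrightarrow> 0" by blast
  then show ?thesis using that by (auto simp: LIM_zero_iff)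
qed

text \<open>A subsequence with summable increments converges almost everywhere, because the sum of
  the increments has finite integral. Fatou's lemma then carries the Cauchy estimate over to the
  pointwise limit.\<close>

lemma L2_complete:
  assumes "\<And>k. F k \<in> L2c"
    and C: "\<And>e. e > 0 \<Longrightarrow> \<exists>N. \<forall>m\<ge>N. \<forall>n\<ge>N. l2norm (\<lambda>z. F m z - F n z) < e"
  obtains f where "f \<in> L2c" "l2conv F f"
proof -
  have "\<exists>r. \<forall>k. \<forall>m\<ge>r k. \<forall>n\<ge>r k. l2norm (\<lambda>z. F m z - F n z) < (1/2)^k"
    using C by (intro choice) simp
  then obtain r0 where r0: "\<And>k m n. m \<ge> r0 k \<Longrightarrow> n \<ge> r0 k \<Longrightarrow> l2norm (\<lambda>z. F m z - F n z) < (1/2)^k"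
    by blast
  \<comment> \<open>Summing all thresholds up to \<open>k\<close> makes \<open>r\<close> monotone
    and at least \<open>r0 k\<close>; the extra \<open>k\<close> makes it at least
    \<open>k\<close>.\<close>
  define r where "r k = k + (\<Sum>i\<le>k. r0 i)" for k
  have r_ge: "r k \<ge> r0 k" for k unfolding r_def by (simp add: sum.atMost_Suc atMost_atLeast0 sum.last_plus)
  have r_mono: "r k \<le> r (Suc k)" for k by (simp add: r_def)
  have r_id: "k \<le> r k" for k by (simp add: r_def)
  have [measurable]: "(\<lambda>t. F k (cis t)) \<in> borel_measurable circ" for k
    using L2c_meas_circ[OF assms(1)] by (simp add: meas_circ_def)
  define d where "d k t = cmod (F (r (Suc k)) (cis t) - F (r k) (cis t))" for k t
  have [measurable]: "d k \<in> borel_measurable circ" for k unfolding d_def by measurable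
  have dint: "integrable circ (d k)" for k
    unfolding d_def using L1cD[OF L2_L1[OF L2c_diff[OF assms(1) assms(1)]]] by (rule integrable_norm)
  have dle: "integral\<^sup>L circ (d k) \<le> 2 * pi * (1/2)^k" for k
  proof -
    have "integral\<^sup>L circ (d k) \<le> 2 * pi * l2norm (\<lambda>z. F (r (Suc k)) z - F (r k) z)"
      unfolding d_def by (rule L1_le_l2norm[OF L2c_diff[OF assms(1) assms(1)]])
    also have "\<dots> \<le> 2 * pi * (1/2)^k"
      using r0[of k "r (Suc k)" "r k"] r_ge[of k] r_mono[of k] by simp
    finally show ?thesis .
  qed
  have "(\<integral>\<^sup>+ t. (\<Sum>k. ennreal (d k t)) \<partial>circ) = (\<Sum>k. \<integral>\<^sup>+ t. ennreal (d k t) \<partial>circ)"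
    by (rule nn_integral_suminf) measurable
  also have "\<dots> = (\<Sum>k. ennreal (integral\<^sup>L circ (d k)))"
    by (subst nn_integral_eq_integral[OF dint]) (simp_all add: d_def)
  also have "\<dots> \<le> (\<Sum>k. ennreal (2 * pi * (1/2)^k))"
    using dle by (intro suminf_le ennreal_leI) auto
  also have "\<dots> = ennreal (\<Sum>k. 2 * pi * (1/2)^k)"
    by (intro suminf_ennreal2) (auto intro!: summable_mult summable_geometric)
  finally have "(\<integral>\<^sup>+ t. (\<Sum>k. ennreal (d k t)) \<partial>circ) \<noteq> \<infinity>"
    by (auto simp: top_unique)
  then have "AE t in circ. (\<Sum>k. ennreal (d k t)) \<noteq> \<infinity>"
    by (intro nn_integral_PInf_AE) auto
  then have conv: "AE t in circ. convergent (\<lambda>k. F (r k) (cis t))"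
  proof eventually_elim
    case (elim t)
    then have "summable (\<lambda>k. d k t)"
      by (intro summable_suminf_not_top) (auto simp: d_def)
    then have "summable (\<lambda>k. F (r (Suc k)) (cis t) - F (r k) (cis t))"
      unfolding d_def by (rule summable_norm_cancel)
    then have "convergent (\<lambda>n. \<Sum>k<n. F (r (Suc k)) (cis t) - F (r k) (cis t))"
      by (simp add: summable_iff_convergent)
    then have "convergent (\<lambda>n. F (r n) (cis t) - F (r 0) (cis t))"
      using sum_lessThan_telescope[of "\<lambda>k. F (r k) (cis t)"] by simp
    then have "convergent (\<lambda>n. (F (r n) (cis t) - F (r 0) (cis t)) + F (r 0) (cis t))"
      by (intro convergent_add convergent_const)
    then show ?case by simp
  qed
  define f where "f z = lim (\<lambda>k. F (r k) z)" for z
  have fm: "meas_circ f" unfolding meas_circ_def f_def by (rule borel_measurable_lim_metric) measurable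
  then have [measurable]: "(\<lambda>t. f (cis t)) \<in> borel_measurable circ" by (simp add: meas_circ_def)
  have lim: "AE t in circ. (\<lambda>k. F (r k) (cis t)) \<longlonglongrightarrow> f (cis t)"
    using conv unfolding f_def by eventually_elim (simp add: convergent_LIMSEQ_iff)
  \<comment> \<open>Fatou along \<open>F (r k)\<close> with \<open>n\<close> fixed. The estimate is
    kept as an \<open>ennreal\<close> integral since \<open>f\<close> is not yet known to be square
    integrable.\<close>
  have key: "(\<integral>\<^sup>+ t. ennreal ((cmod (F n (cis t) - f (cis t)))\<^sup>2) \<partial>circ) \<le> ennreal (2 * pi * e\<^sup>2)"
    if e: "e > 0" and N: "\<forall>m\<ge>N. \<forall>n\<ge>N. l2norm (\<lambda>z. F m z - F n z) < e" and n: "n \<ge> N" for e N n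
  proof -
    have "(\<integral>\<^sup>+ t. ennreal ((cmod (F n (cis t) - f (cis t)))\<^sup>2) \<partial>circ)
      = (\<integral>\<^sup>+ t. liminf (\<lambda>k. ennreal ((cmod (F n (cis t) - F (r k) (cis t)))\<^sup>2)) \<partial>circ)"
    proof (rule nn_integral_cong_AE)
      show "AE t in circ. ennreal ((cmod (F n (cis t) - f (cis t)))\<^sup>2)
          = liminf (\<lambda>k. ennreal ((cmod (F n (cis t) - F (r k) (cis t)))\<^sup>2))"
        using lim
      proof eventually_elim
        case (elim t)
        have "(\<lambda>k. ennreal ((cmod (F n (cis t) - F (r k) (cis t)))\<^sup>2)) \<longlonglongrightarrow> ennreal ((cmod (F n (cis t) - f (cis t)))\<^sup>2)"
          by (intro tendsto_ennrealI tendsto_intros elim)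
        then show ?case by (rule lim_imp_Liminf[OF trivial_limit_sequentially, symmetric])
      qed
    qed
    also have "\<dots> \<le> liminf (\<lambda>k. \<integral>\<^sup>+ t. ennreal ((cmod (F n (cis t) - F (r k) (cis t)))\<^sup>2) \<partial>circ)"
      by (rule nn_integral_liminf) measurable
    also have "\<dots> \<le> liminf (\<lambda>k::nat. ennreal (2 * pi * e\<^sup>2))"
    proof (rule Liminf_mono, rule eventually_sequentiallyI[of N])
      fix k assume "N \<le> k"
      then have "N \<le> r k" using r_id[of k] by simp
      have "(\<integral>\<^sup>+ t. ennreal ((cmod (F n (cis t) - F (r k) (cis t)))\<^sup>2) \<partial>circ)
        = ennreal (integral\<^sup>L circ (\<lambda>t. (cmod (F n (cis t) - F (r k) (cis t)))\<^sup>2))"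
        using L2cD[OF L2c_diff[OF assms(1) assms(1)], of n "r k"] by (intro nn_integral_eq_integral) auto
      also have "\<dots> = ennreal (2 * pi * (l2norm (\<lambda>z. F n z - F (r k) z))\<^sup>2)"
        by (simp add: l2norm_sq sqnorm_circ_def)
      also have "\<dots> \<le> ennreal (2 * pi * e\<^sup>2)"
        using N n \<open>N \<le> r k\<close> by (intro ennreal_leI mult_left_mono power_mono) (auto simp: l2norm_nonneg less_imp_le)
      finally show "(\<integral>\<^sup>+ t. ennreal ((cmod (F n (cis t) - F (r k) (cis t)))\<^sup>2) \<partial>circ) \<le> ennreal (2 * pi * e\<^sup>2)" .
    qed
    also have "\<dots> = ennreal (2 * pi * e\<^sup>2)" by (simp add: Liminf_const)
    finally show ?thesis .
  qed
  have diffL2: "(\<lambda>z. F n z - f z) \<in> L2c" if "e > 0" "\<forall>m\<ge>N. \<forall>n\<ge>N. l2norm (\<lambda>z. F m z - F n z) < e" "n \<ge> N" for e N n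
  proof (rule L2cI)
    show "meas_circ (\<lambda>z. F n z - f z)" by (intro meas_circ_diff fm L2c_meas_circ[OF assms(1)])
    show "integrable circ (\<lambda>t. (cmod (F n (cis t) - f (cis t)))\<^sup>2)"
      using key[OF that] by (intro integrableI_nonneg) (auto simp: top_unique less_top[symmetric])
  qed
  have fL2: "f \<in> L2c"
  proof -
    obtain N where N: "\<forall>m\<ge>N. \<forall>n\<ge>N. l2norm (\<lambda>z. F m z - F n z) < 1" using C[of 1] by auto
    have "(\<lambda>z. F N z - (F N z - f z)) \<in> L2c"
      by (intro L2c_diff assms(1) diffL2[OF _ N]) auto
    then show ?thesis by simp
  qed
  have "l2conv F f" unfolding l2conv_def
  proof (rule LIMSEQ_I)
    fix e :: real assume "e > 0"
    then have e2: "e / 2 > 0" by simp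
    obtain N where N: "\<forall>m\<ge>N. \<forall>n\<ge>N. l2norm (\<lambda>z. F m z - F n z) < e / 2" using C[OF e2] by auto
    have "l2norm (\<lambda>z. F n z - f z) < e" if n: "n \<ge> N" for n
    proof -
      have L: "(\<lambda>z. F n z - f z) \<in> L2c" by (rule diffL2[OF e2 N n])
      have "ennreal (integral\<^sup>L circ (\<lambda>t. (cmod (F n (cis t) - f (cis t)))\<^sup>2))
        = (\<integral>\<^sup>+ t. ennreal ((cmod (F n (cis t) - f (cis t)))\<^sup>2) \<partial>circ)"
        using L2cD[OF L] by (intro nn_integral_eq_integral[symmetric]) auto
      also have "\<dots> \<le> ennreal (2 * pi * (e/2)\<^sup>2)" by (rule key[OF e2 N n])
      finally have "integral\<^sup>L circ (\<lambda>t. (cmod (F n (cis t) - f (cis t)))\<^sup>2) \<le> 2 * pi * (e/2)\<^sup>2"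
        by (simp add: ennreal_le_iff)
      then have "(l2norm (\<lambda>z. F n z - f z))\<^sup>2 \<le> (e/2)\<^sup>2"
        by (simp add: l2norm_sq sqnorm_circ_def field_simps)
      then have "l2norm (\<lambda>z. F n z - f z) \<le> e / 2" using e2 by (rule power2_le_imp_le[OF _ less_imp_le])
      then show ?thesis using \<open>e > 0\<close> by simp
    qed
    then show "\<exists>N. \<forall>n\<ge>N. norm (l2norm (\<lambda>z. F n z - f z) - 0) < e"
      by (auto simp: l2norm_nonneg)
  qed
  with fL2 show ?thesis using that by blast
qed

subsection \<open>Fourier coefficients\<close>

lemma fcoeff_cong: "(\<And>t. f (cis t) = g (cis t)) \<Longrightarrow> fcoeff f n = fcoeff g n"
  by (simp add: fcoeff_def)

lemma fcoeff_cong_AE: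
  assumes "meas_circ f" "meas_circ g" "ae_eq_circ f g" shows "fcoeff f n = fcoeff g n"
  unfolding fcoeff_cint using assms
  by (intro cint_cong_AE meas_circ_mult meas_circ_powi) (auto simp: ae_eq_circ_def)

lemma fcoeff_add: "f \<in> L1c \<Longrightarrow> g \<in> L1c \<Longrightarrow> fcoeff (\<lambda>z. f z + g z) n = fcoeff f n + fcoeff g n"
  unfolding fcoeff_cint by (simp add: distrib_left cint_add L1c_powi_mult)

lemma fcoeff_diff: "f \<in> L1c \<Longrightarrow> g \<in> L1c \<Longrightarrow> fcoeff (\<lambda>z. f z - g z) n = fcoeff f n - fcoeff g n"
  unfolding fcoeff_cint by (simp add: right_diff_distrib cint_diff L1c_powi_mult)

lemma fcoeff_scale: "fcoeff (\<lambda>z. c * f z) n = c * fcoeff f n"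
  unfolding fcoeff_cint by (simp add: cint_scale[symmetric] mult_ac)

lemma fcoeff_sum: "(\<And>i. i \<in> I \<Longrightarrow> F i \<in> L1c) \<Longrightarrow> fcoeff (\<lambda>z. \<Sum>i\<in>I. F i z) n = (\<Sum>i\<in>I. fcoeff (F i) n)"
  unfolding fcoeff_cint by (simp add: cint_sum[symmetric] L1c_powi_mult sum_distrib_left)

lemma cnj_cis_powi: "cnj (cis t powi n) = cis t powi (-n)"
  by (simp add: cis_power_int cis_cnj)

lemma cnj_powi_cis: "cnj (cis t) powi n = cis t powi (-n)"
  by (simp add: cis_power_int cis_cnj)

lemma cis_powi_add: "cis t powi m * cis t powi n = cis t powi (m + n)"
  by (simp add: power_int_add)

lemma cis_cnj_mult [simp]: "cis t * cnj (cis t) = 1" "cnj (cis t) * cis t = 1"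
  by (simp_all add: cis_cnj cis_mult)

lemma fcoeff_cnj: "fcoeff (\<lambda>z. cnj (f z)) n = cnj (fcoeff f (-n))"
  unfolding fcoeff_cint cint_cnj[symmetric] by (rule cint_cong) (simp add: cnj_powi_cis)

lemma fcoeff_powi_mult: "fcoeff (\<lambda>z. z powi m * f z) n = fcoeff f (n - m)"
  unfolding fcoeff_cint
  by (rule cint_cong) (simp add: mult.assoc[symmetric] cis_powi_add)

lemma fcoeff_mult_id: "fcoeff (\<lambda>z. z * f z) n = fcoeff f (n - 1)"
  using fcoeff_powi_mult[of 1 f n] by simp

lemma fcoeff_mult_cnj_id: "fcoeff (\<lambda>z. cnj z * f z) n = fcoeff f (n + 1)"
proof -
  have "fcoeff (\<lambda>z. cnj z * f z) n = fcoeff (\<lambda>z. z powi (-1) * f z) n"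
    by (rule fcoeff_cong) (simp add: cis_inverse cis_cnj)
  then show ?thesis unfolding fcoeff_powi_mult by simp
qed

lemma fcoeff_const: "fcoeff (\<lambda>z. c) n = (if n = 0 then c else 0)"
proof (cases "n = 0")
  case True then show ?thesis by (simp add: fcoeff_cint cint_const)
next
  case False
  define m where "m = - real_of_int n"
  have m: "m \<noteq> 0" using False by (simp add: m_def)
  have int0: "((\<lambda>t. cis (m * t)) has_integral 0) {0..2*pi}"
  proof -
    have "((\<lambda>t. cis (m * t)) has_integral
        (cis (m * (2*pi)) / (\<i> * of_real m) - cis (m * 0) / (\<i> * of_real m))) {0..2*pi}"
    proof (rule fundamental_theorem_of_calculus)
      fix t :: real
      have "((\<lambda>z. exp (\<i> * (of_real m * z)) / (\<i> * of_real m)) has_field_derivative exp (\<i> * (of_real m * of_real t)))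
          (at (of_real t))"
        using m by (auto intro!: derivative_eq_intros simp: mult_ac)
      from has_vector_derivative_real_field[OF this]
      show "((\<lambda>t. cis (m * t) / (\<i> * of_real m)) has_vector_derivative cis (m * t)) (at t within {0..2*pi})"
        by (simp add: cis_conv_exp)
    qed simp
    moreover have "cis (m * (2*pi)) = 1"
      unfolding m_def using cis_multiple_2pi[of "- real_of_int n"] by (simp add: mult.commute)
    ultimately show ?thesis by simp
  qed
  have ig: "integrable circ (\<lambda>t. cis (m * t))"
  proof -
    have "(\<lambda>z. z powi (-n) * 1) \<in> L1c" by (rule L1c_powi_mult[OF L1c_const])
    then show ?thesis by (simp add: L1c_def m_def cis_power_int)
  qed
  have "integral\<^sup>L circ (\<lambda>t. cis (m * t)) = integral {0..2*pi} (\<lambda>t. cis (m * t))"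
    using ig unfolding circ_def by (rule lebesgue_integral_eq_integral) simp
  also have "\<dots> = 0" using int0 by (rule integral_unique)
  finally have "fcoeff (\<lambda>z. 1) n = 0" by (simp add: fcoeff_def m_def)
  then show ?thesis using False fcoeff_scale[of c "\<lambda>_. 1" n] by simp
qed

lemma fcoeff_powi: "fcoeff (\<lambda>z. z powi m) n = (if n = m then 1 else 0)"
  using fcoeff_powi_mult[of m "\<lambda>z. 1" n] fcoeff_const[of 1 "n - m"] by simp

subsection \<open>Uniqueness of Fourier coefficients\<close>

definition nullc :: "(complex \<Rightarrow> complex) \<Rightarrow> bool" where
  "nullc f \<longleftrightarrow> f \<in> L1c \<and> (\<forall>n. fcoeff f n = 0)"

lemma L1c_mult_id: "f \<in> L1c \<Longrightarrow> (\<lambda>z. z * f z) \<in> L1c"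
  using L1c_powi_mult[of f 1] by simp

lemma L1c_mult_cnj_id: "f \<in> L1c \<Longrightarrow> (\<lambda>z. cnj z * f z) \<in> L1c"
  using L1c_mult_bounded[of f cnj 1] by (simp add: meas_circ_cnj_id mult.commute)

text \<open>A real linear functional on the plane is a combination of \<open>z\<close> and
  \<open>cnj z\<close>, and multiplying by either only shifts the Fourier coefficients. This is the
  base case for polynomials.\<close>

lemma nullc_linear:
  assumes P: "bounded_linear P" and f: "nullc f"
  shows "nullc (\<lambda>z. f z * complex_of_real (P z))"
proof -
  interpret P: bounded_linear P by (rule P)
  define a b where "a = (of_real (P 1) - \<i> * of_real (P \<i>)) / 2" and "b = (of_real (P 1) + \<i> * of_real (P \<i>)) / (2::complex)"
  have Pz: "complex_of_real (P z) = a * z + b * cnj z" for z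
  proof -
    have "P z = P (Re z *\<^sub>R 1 + Im z *\<^sub>R \<i>)"
      by (rule arg_cong[where f=P]) (simp add: complex_eq_iff)
    also have "\<dots> = Re z * P 1 + Im z * P \<i>" by (simp add: P.add P.scaleR)
    finally show ?thesis by (simp add: a_def b_def complex_eq_iff field_simps)
  qed
  have e: "(\<lambda>z. f z * complex_of_real (P z)) = (\<lambda>z. a * (z * f z) + b * (cnj z * f z))"
    unfolding Pz by (simp add: fun_eq_iff algebra_simps)
  have L: "(\<lambda>z. a * (z * f z)) \<in> L1c" "(\<lambda>z. b * (cnj z * f z)) \<in> L1c"
    using f by (auto simp: nullc_def intro!: L1c_scale L1c_mult_id L1c_mult_cnj_id)
  then show ?thesis unfolding e nullc_def
    using f by (simp add: L1c_add fcoeff_add fcoeff_scale fcoeff_mult_id fcoeff_mult_cnj_id nullc_def)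
qed

text \<open>\<open>f\<close> is generalised because the product case applies the hypothesis for
  \<open>P\<close> to \<open>f\<close> and then the one for \<open>Q\<close> to
  \<open>f * P\<close>.\<close>

lemma nullc_poly:
  "real_polynomial_function P \<Longrightarrow> nullc f \<Longrightarrow> nullc (\<lambda>z. f z * complex_of_real (P z))"
proof (induction arbitrary: f rule: real_polynomial_function.induct)
  case (linear P)
  then show ?case by (rule nullc_linear)
next
  case (const c)
  have "(\<lambda>z. f z * complex_of_real c) = (\<lambda>z. of_real c * f z)" by (simp add: mult.commute)
  then show ?case using const by (simp add: nullc_def L1c_scale fcoeff_scale)
next
  case (add P Q)
  have "(\<lambda>z. f z * complex_of_real (P z + Q z)) = (\<lambda>z. f z * of_real (P z) + f z * of_real (Q z))"
    by (simp add: algebra_simps)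
  then show ?case using add.IH[OF add.prems] by (simp add: nullc_def L1c_add fcoeff_add)
next
  case (mult P Q)
  have "(\<lambda>z. f z * complex_of_real (P z * Q z)) = (\<lambda>z. (f z * of_real (P z)) * of_real (Q z))"
    by (simp add: algebra_simps)
  then show ?case using mult.IH(2)[OF mult.IH(1)[OF mult.prems]] by simp
qed

text \<open>By Stone-Weierstrass, \<open>g\<close> is a uniform limit on the circle of real
  polynomials in the coordinates, against which \<open>f\<close> integrates to zero.\<close>

lemma nullc_continuous:
  assumes g: "continuous_on UNIV g" and f: "nullc f"
  shows "cint (\<lambda>z. f z * complex_of_real (g z)) = 0"
proof -
  have fL: "f \<in> L1c" using f by (simp add: nullc_def)
  have gm: "meas_circ (\<lambda>z. complex_of_real (g z))"
    by (intro meas_circ_continuous continuous_intros g)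
  have "\<exists>P. real_polynomial_function P \<and> (\<forall>z\<in>sphere 0 1. \<bar>g z - P z\<bar> < 1 / real (Suc k))" for k
    using Stone_Weierstrass_real_polynomial_function[of "sphere (0::complex) 1" g "1 / real (Suc k)"]
      continuous_on_subset[OF g] compact_sphere by (metis of_nat_0_less_iff subset_UNIV zero_less_Suc zero_less_divide_1_iff)
  then obtain P where P: "\<And>k. real_polynomial_function (P k)"
      and PP: "\<And>k z. z \<in> sphere 0 1 \<Longrightarrow> \<bar>g z - P k z\<bar> < 1 / real (Suc k)"
    by metis
  have gP: "\<bar>g (cis t) - P k (cis t)\<bar> < 1 / real (Suc k)" for k t
    using PP by simp
  have gP1: "\<bar>g (cis t) - P k (cis t)\<bar> \<le> 1" for k t
  proof -
    have "1 / real (Suc k) \<le> 1" by simp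
    with gP[of t k] show ?thesis by linarith
  qed
  have Pm: "meas_circ (\<lambda>z. complex_of_real (P k z))" for k
    by (intro meas_circ_continuous continuous_intros continuous_on_polymonial_function)
       (use P real_polynomial_function_eq in blast)
  have conv: "(\<lambda>k. P k (cis t)) \<longlonglongrightarrow> g (cis t)" for t
  proof (rule LIM_zero_cancel, rule tendsto_rabs_zero_cancel, rule tendsto_sandwich[where f="\<lambda>_. 0"])
    show "(\<lambda>k. 1 / real (Suc k)) \<longlonglongrightarrow> 0" by (rule LIMSEQ_Suc) (rule lim_1_over_n)
    show "\<forall>\<^sub>F k in sequentially. \<bar>P k (cis t) - g (cis t)\<bar> \<le> 1 / real (Suc k)"
      using gP[of t] by (auto simp: abs_minus_commute intro!: always_eventually less_imp_le)
  qed auto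
  obtain B where B: "\<And>t. \<bar>g (cis t)\<bar> \<le> B"
  proof -
    have "compact (g ` sphere 0 1)" by (intro compact_continuous_image continuous_on_subset[OF g]) auto
    then obtain B where "\<forall>x\<in>g ` sphere 0 1. norm x \<le> B" using compact_imp_bounded bounded_iff by metis
    then show ?thesis using that[of B] by auto
  qed
  have "(\<lambda>k. cint (\<lambda>z. f z * complex_of_real (P k z))) \<longlonglongrightarrow> cint (\<lambda>z. f z * complex_of_real (g z))"
  \<comment> \<open>\<open>B\<close> bounds \<open>g\<close> on the circle and every approximant is
    within 1 of \<open>g\<close>.\<close>
  proof (rule cint_dominated[where w="\<lambda>z. of_real (B + 1) * f z"])
    show "meas_circ (\<lambda>z. f z * complex_of_real (P k z))" for k by (intro meas_circ_mult Pm L1c_meas_circ fL)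
    show "meas_circ (\<lambda>z. f z * complex_of_real (g z))" by (intro meas_circ_mult gm L1c_meas_circ fL)
    show "(\<lambda>z. of_real (B + 1) * f z) \<in> L1c" by (intro L1c_scale fL)
    show "AE t in circ. cmod (f (cis t) * complex_of_real (P k (cis t))) \<le> cmod (of_real (B + 1) * f (cis t))" for k
    proof (intro AE_I2)
      fix t
      have "\<bar>P k (cis t)\<bar> \<le> B + 1" using gP1[of t k] B[of t] by linarith
      then have "\<bar>P k (cis t)\<bar> * cmod (f (cis t)) \<le> \<bar>B + 1\<bar> * cmod (f (cis t))"
        by (intro mult_right_mono) auto
      then show "cmod (f (cis t) * complex_of_real (P k (cis t))) \<le> cmod (of_real (B + 1) * f (cis t))"
        unfolding norm_mult norm_of_real by (simp add: mult.commute)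
    qed
    show "AE t in circ. (\<lambda>k. f (cis t) * complex_of_real (P k (cis t))) \<longlonglongrightarrow> f (cis t) * complex_of_real (g (cis t))"
      by (intro AE_I2 tendsto_intros conv)
  qed
  moreover have "cint (\<lambda>z. f z * complex_of_real (P k z)) = 0" for k
  proof -
    have "fcoeff (\<lambda>z. f z * complex_of_real (P k z)) 0 = 0"
      using nullc_poly[OF P f] by (simp add: nullc_def)
    then show ?thesis by (simp add: fcoeff_cint)
  qed
  ultimately show ?thesis by (simp add: LIMSEQ_const_iff)
qed

lemma AE_circ_interior: "AE t in circ. 0 < t \<and> t < 2*pi"
proof -
  have "AE t in lebesgue. t \<noteq> 0" "AE t in lebesgue. t \<noteq> 2*pi"
    by (auto intro!: AE_completion AE_lborel_singleton)
  then have "AE t in lebesgue. t \<in> {0..2*pi} \<longrightarrow> 0 < t \<and> t < 2*pi"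
    by eventually_elim auto
  then show ?thesis unfolding circ_def
    by (subst AE_restrict_space_iff) (auto simp del: atLeastAtMost_iff)
qed

text \<open>It suffices that one parameter is interior: the only ambiguity of \<open>cis\<close> on
  the closed period is the pair of endpoints.\<close>

lemma cis_eq_interior:
  assumes "cis s = cis t" "0 < t" "t < 2*pi" "0 \<le> s" "s \<le> 2*pi"
  shows "s = t"
proof -
  have "exp (\<i> * of_real s) = exp (\<i> * of_real t)" using assms(1) by (simp add: cis_conv_exp)
  then obtain n :: int where "\<i> * of_real s = \<i> * of_real t + (of_int (2 * n) * pi) * \<i>"
    unfolding exp_eq by blast
  then have "Im (\<i> * of_real s) = Im (\<i> * of_real t + (of_int (2 * n) * pi) * \<i>)" by simp
  then have e: "s = t + of_int n * (2 * pi)" by simp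
  have "n = 0"
  proof (rule ccontr)
    assume "n \<noteq> 0"
    then consider "n \<ge> 1" | "n \<le> -1" by linarith
    then show False
    proof cases
      case 1
      then have "1 * (2*pi) \<le> of_int n * (2 * pi)" by (intro mult_right_mono) auto
      then show ?thesis using e assms by linarith
    next
      case 2
      then have "of_int n \<le> (-1::real)" by linarith
      then have "of_int n * (2 * pi) \<le> (-1) * (2*pi)" by (intro mult_right_mono) auto
      then show ?thesis using e assms by linarith
    qed
  qed
  then show ?thesis using e by simp
qed

lemma borel_sets_circ: "A \<in> sets borel \<Longrightarrow> {0..2*pi} \<inter> A \<in> sets circ"
  unfolding circ_def by (auto simp: sets_restrict_space)

lemma borel_ind_measurable: "A \<in> sets borel \<Longrightarrow> (indicator A :: real \<Rightarrow> real) \<in> borel_measurable circ"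
proof -
  assume "A \<in> sets borel"
  then have "(indicator A :: real \<Rightarrow> real) \<in> borel_measurable lebesgue"
    by (intro measurable_completion) simp
  then show ?thesis unfolding circ_def by (rule measurable_restrict_space1)
qed

text \<open>The indicator of the closed arc \<open>C\<close> is the pointwise limit of tent
  functions of the distance to \<open>C\<close>. Pulled back by \<open>cis\<close> it agrees with
  the indicator of the interval only almost everywhere, since both endpoints of the period are sent
  to the same point.\<close>

lemma nullc_interval:
  assumes f: "nullc f"
  shows "integral\<^sup>L circ (\<lambda>t. indicator {a..b} t *\<^sub>R f (cis t)) = 0"
proof -
  define C where "C = cis ` ({0..2*pi} \<inter> {a..b})"
  have fL: "f \<in> L1c" using f by (simp add: nullc_def)
  show ?thesis
  \<comment> \<open>\<open>infdist\<close> to the empty set is 0, so for an empty arc the tents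
    would be constantly 1 instead of tending to the indicator.\<close>
  proof (cases "C = {}")
    case True
    then have "integral\<^sup>L circ (\<lambda>t. indicator {a..b} t *\<^sub>R f (cis t)) = integral\<^sup>L circ (\<lambda>t. 0)"
      by (intro Bochner_Integration.integral_cong) (auto simp: C_def space_circ indicator_def disjoint_iff)
    then show ?thesis by simp
  next
    case False
    have "compact C" unfolding C_def
      by (intro compact_continuous_image continuous_intros compact_Int_closed) auto
    then have cl: "closed C" by (rule compact_imp_closed)
    define g where "g k z = max 0 (1 - real k * infdist z C)" for k :: nat and z
    have gc: "continuous_on UNIV (g k)" for k unfolding g_def by (intro continuous_intros)
    have glim: "(\<lambda>k. g k z) \<longlonglongrightarrow> indicator C z" for z
    proof (cases "z \<in> C")
      case True then show ?thesis by (simp add: g_def infdist_zero)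
    next
      case zC: False
      then have d: "infdist z C > 0" using cl False infdist_pos_not_in_closed by blast
      obtain N :: nat where N: "1 / infdist z C < real N" using reals_Archimedean2 by blast
      have "g k z = 0" if "k \<ge> N" for k
      proof -
        have "1 / infdist z C \<le> real k" using N that by linarith
        then have "1 \<le> real k * infdist z C" using d by (simp add: field_simps)
        then show ?thesis by (simp add: g_def)
      qed
      then have "\<forall>\<^sub>F k in sequentially. g k z = indicator C z"
        using zC by (intro eventually_sequentiallyI[of N]) simp
      then show ?thesis by (rule tendsto_eventually)
    qed
    have gm: "meas_circ (\<lambda>z. complex_of_real (g k z))" for k by (intro meas_circ_continuous continuous_intros gc)
    have "meas_circ (\<lambda>z. complex_of_real (indicator C z))"
      unfolding meas_circ_def
      by (rule borel_measurable_LIMSEQ_metric[where f="\<lambda>k t. complex_of_real (g k (cis t))"])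
        (use gm in \<open>simp add: meas_circ_def\<close>, intro tendsto_of_real glim)
    then have im: "meas_circ (\<lambda>z. f z * complex_of_real (indicator C z))" by (rule meas_circ_mult[OF L1c_meas_circ[OF fL]])
    have "(\<lambda>k. cint (\<lambda>z. f z * complex_of_real (g k z))) \<longlonglongrightarrow> cint (\<lambda>z. f z * complex_of_real (indicator C z))"
    proof (rule cint_dominated[where w=f])
      show "AE t in circ. cmod (f (cis t) * complex_of_real (g k (cis t))) \<le> cmod (f (cis t))" for k
      proof (intro AE_I2)
        fix t
        have "\<bar>g k (cis t)\<bar> \<le> 1" by (simp add: g_def infdist_nonneg)
        then show "cmod (f (cis t) * complex_of_real (g k (cis t))) \<le> cmod (f (cis t))"
          unfolding norm_mult norm_of_real by (simp add: mult_left_le)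
      qed
      show "AE t in circ. (\<lambda>k. f (cis t) * complex_of_real (g k (cis t))) \<longlonglongrightarrow> f (cis t) * complex_of_real (indicator C (cis t))"
        by (intro AE_I2 tendsto_intros glim)
    qed (rule meas_circ_mult[OF L1c_meas_circ[OF fL] gm] im fL)+
    then have "cint (\<lambda>z. f z * complex_of_real (indicator C z)) = 0"
      using nullc_continuous[OF gc f] by (simp add: LIMSEQ_const_iff)
    then have "0 = integral\<^sup>L circ (\<lambda>t. f (cis t) * complex_of_real (indicator C (cis t)))"
      by (simp add: cint_def)
    also have "\<dots> = integral\<^sup>L circ (\<lambda>t. indicator {a..b} t *\<^sub>R f (cis t))"
    proof (rule integral_cong_AE)
      show "AE t in circ. f (cis t) * complex_of_real (indicator C (cis t)) = indicator {a..b} t *\<^sub>R f (cis t)"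
        using AE_circ_interior
      proof eventually_elim
        case (elim t)
        have "t \<in> {a..b}" if "cis t \<in> C"
        proof -
          from that obtain s where s: "s \<in> {0..2*pi} \<inter> {a..b}" "cis t = cis s" unfolding C_def by blast
          then have "s = t" using elim by (intro cis_eq_interior) simp_all
          then show ?thesis using s by simp
        qed
        moreover have "cis t \<in> C" if "t \<in> {a..b}"
          unfolding C_def using that elim by (intro imageI) simp
        ultimately have "cis t \<in> C \<longleftrightarrow> t \<in> {a..b}" by blast
        then show ?case by (simp add: indicator_def)
      qed
      show "(\<lambda>t. indicator {a..b} t *\<^sub>R f (cis t)) \<in> borel_measurable circ"
        using L1c_meas_circ[OF fL] borel_ind_measurable[of "{a..b}"] by (simp add: meas_circ_def)
    qed (use im in \<open>simp add: meas_circ_def\<close>)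
    finally show ?thesis by simp
  qed
qed

text \<open>Vanishing integrals over intervals propagate to Borel sets by
  \<open>borel_set_induct\<close>, and an integrable function with zero integral over every
  measurable set is zero almost everywhere.\<close>

theorem fcoeff_unique_zero:
  assumes fL: "f \<in> L1c" and f0: "\<And>n. fcoeff f n = 0"
  shows "ae_eq_circ f (\<lambda>_. 0)"
proof -
  have f: "nullc f" using assms by (simp add: nullc_def)
  have [measurable]: "(\<lambda>t. f (cis t)) \<in> borel_measurable circ" using L1c_meas_circ[OF fL] by (simp add: meas_circ_def)
  have int: "integrable circ (\<lambda>t. indicator A t *\<^sub>R f (cis t))" if "A \<in> sets borel" for A
  proof (rule Bochner_Integration.integrable_bound[OF L1cD[OF fL]])
    show "(\<lambda>t. indicator A t *\<^sub>R f (cis t)) \<in> borel_measurable circ"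
      using borel_ind_measurable[OF that] by measurable
  qed (simp add: indicator_def)
  have B: "integral\<^sup>L circ (\<lambda>t. indicator A t *\<^sub>R f (cis t)) = 0" if "A \<in> sets borel" for A
    using that
  proof (induction rule: borel_set_induct)
    case empty show ?case by simp
  next
    case (interval a b) show ?case by (rule nullc_interval[OF f])
  next
    case (compl A)
    have "integral\<^sup>L circ (\<lambda>t. indicator (-A) t *\<^sub>R f (cis t))
      = integral\<^sup>L circ (\<lambda>t. f (cis t) - indicator A t *\<^sub>R f (cis t))"
      by (intro Bochner_Integration.integral_cong) (auto simp: indicator_def)
    also have "\<dots> = integral\<^sup>L circ (\<lambda>t. f (cis t)) - 0"
      using L1cD[OF fL] int[OF compl(1)] compl(2) by simp
    also have "\<dots> = 0" using f0[of 0] by (simp add: fcoeff_def)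
    finally show ?case .
  next
    case (union A)
    have sp: "{0..2*pi} \<inter> A i \<in> sets circ" for i using borel_sets_circ union(2) by blast
    have e: "set_lebesgue_integral circ ({0..2*pi} \<inter> A) (\<lambda>t. f (cis t))
        = integral\<^sup>L circ (\<lambda>t. indicator A t *\<^sub>R f (cis t))" for A
      unfolding set_lebesgue_integral_def
      by (intro Bochner_Integration.integral_cong) (auto simp: indicator_def space_circ)
    have "set_lebesgue_integral circ (\<Union>i. {0..2*pi} \<inter> A i) (\<lambda>t. f (cis t))
        = (\<Sum>i. set_lebesgue_integral circ ({0..2*pi} \<inter> A i) (\<lambda>t. f (cis t)))"
    proof (rule lebesgue_integral_countable_add)
      show "i \<noteq> j \<Longrightarrow> {0..2 * pi} \<inter> A i \<inter> ({0..2 * pi} \<inter> A j) = {}" for i j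
        using union(1) by (auto simp: disjoint_family_on_def)
      show "set_integrable circ (\<Union>i. {0..2 * pi} \<inter> A i) (\<lambda>t. f (cis t))"
        unfolding set_integrable_def
        by (rule integrable_mult_indicator[OF _ L1cD[OF fL]]) (intro sets.countable_UN', use sp in auto)
    qed (rule sp)
    then show ?case using union(3) e e[of "\<Union>i. A i"] by simp
  qed
  have "AE t in circ. f (cis t) = 0"
  proof (rule sigma_finite_measure.density_zero[OF _ L1cD[OF fL]])
    show "sigma_finite_measure circ" by (rule circ.sigma_finite_measure_axioms)
    fix A assume "A \<in> sets circ"
    then obtain A' where A': "A' \<in> sets lebesgue" "A = {0..2*pi} \<inter> A'"
      unfolding circ_def by (auto simp: sets_restrict_space)
    \<comment> \<open>The measurable sets of \<open>circ\<close> come from Lebesgue sets; each is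
      replaced by its F-sigma part, which is Borel, at the cost of a null set.\<close>
    obtain C T where CT: "fsigma C" "T \<in> null_sets lebesgue" "C \<union> T = A'" "disjnt C T"
      using lebesgue_set_almost_fsigma[OF A'(1)] .
    have Cb: "C \<in> sets borel" using CT(1)
    proof cases
      case (1 F)
      then show ?thesis by (auto intro!: sets.countable_UN borel_closed)
    qed
    have "AE t in circ. t \<notin> T" unfolding circ_def
      using AE_not_in[OF CT(2)] by (subst AE_restrict_space_iff) auto
    then have "AE t in circ. indicator A t *\<^sub>R f (cis t) = indicator C t *\<^sub>R f (cis t)"
      using AE_space[of circ]
    proof eventually_elim
      case (elim t) then show ?case using CT A'(2) by (auto simp: indicator_def space_circ)
    qed
    then have "integral\<^sup>L circ (\<lambda>t. indicator A t *\<^sub>R f (cis t)) = integral\<^sup>L circ (\<lambda>t. indicator C t *\<^sub>R f (cis t))"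
      using \<open>A \<in> sets circ\<close> borel_ind_measurable[OF Cb] by (intro integral_cong_AE) auto
    also have "\<dots> = 0" by (rule B[OF Cb])
    finally show "set_lebesgue_integral circ A (\<lambda>t. f (cis t)) = 0"
      by (simp add: set_lebesgue_integral_def)
  qed
  then show ?thesis by (simp add: ae_eq_circ_def)
qed

corollary fcoeff_unique:
  assumes "f \<in> L1c" "g \<in> L1c" "\<And>n. fcoeff f n = fcoeff g n"
  shows "ae_eq_circ f g"
  using fcoeff_unique_zero[OF L1c_diff[OF assms(1,2)]] assms
  by (simp add: fcoeff_diff ae_eq_circ_def)

subsection \<open>Fourier series in the square mean\<close>

definition trigp :: "(int \<Rightarrow> complex) \<Rightarrow> int set \<Rightarrow> complex \<Rightarrow> complex" where
  "trigp c I z = (\<Sum>n\<in>I. c n * z powi n)"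

lemma trigp_L2c: "trigp c I \<in> L2c"
proof -
  have "(\<lambda>z. \<Sum>n\<in>I. c n * z powi n) \<in> L2c"
    by (rule L2c_sum, rule L2c_scale, rule L2c_powi)
  then show ?thesis by (simp add: trigp_def[abs_def])
qed

lemma fcoeff_trigp:
  assumes "finite I"
  shows "fcoeff (trigp c I) n = (if n \<in> I then c n else 0)"
proof -
  have "fcoeff (trigp c I) n = (\<Sum>m\<in>I. fcoeff (\<lambda>z. c m * z powi m) n)"
    unfolding trigp_def[abs_def] by (rule fcoeff_sum) (rule L2_L1, rule L2c_scale, rule L2c_powi)
  also have "\<dots> = (\<Sum>m\<in>I. if n = m then c m else 0)"
    by (rule sum.cong) (simp_all add: fcoeff_scale fcoeff_powi)
  also have "\<dots> = (if n \<in> I then c n else 0)" using assms by (simp add: sum.delta)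
  finally show ?thesis .
qed

lemma cint_trigp:
  assumes "g \<in> L2c"
  shows "cint (\<lambda>z. trigp c I z * cnj (g z)) = (\<Sum>n\<in>I. c n * cnj (fcoeff g n))"
proof -
  have "cint (\<lambda>z. trigp c I z * cnj (g z)) = cint (\<lambda>z. \<Sum>n\<in>I. c n * (z powi n * cnj (g z)))"
    by (rule cint_cong) (simp add: trigp_def sum_distrib_right mult.assoc)
  also have "\<dots> = (\<Sum>n\<in>I. cint (\<lambda>z. c n * (z powi n * cnj (g z))))"
    by (rule cint_sum) (intro L1c_scale L1c_powi_mult L1c_cnj L2_L1 assms)
  also have "\<dots> = (\<Sum>n\<in>I. c n * cnj (fcoeff g n))"
  proof (rule sum.cong)
    fix n
    have "cint (\<lambda>z. z powi n * cnj (g z)) = cnj (fcoeff g n)"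
      using fcoeff_cnj[of g "-n"] by (simp add: fcoeff_cint)
    then show "cint (\<lambda>z. c n * (z powi n * cnj (g z))) = c n * cnj (fcoeff g n)"
      by (simp add: cint_scale)
  qed simp
  finally show ?thesis .
qed

lemma sqnorm_trigp:
  assumes "finite I"
  shows "sqnorm_circ (trigp c I) = (\<Sum>n\<in>I. (cmod (c n))\<^sup>2)"
proof -
  have "complex_of_real (sqnorm_circ (trigp c I)) = (\<Sum>n\<in>I. c n * cnj (fcoeff (trigp c I) n))"
    using cint_trigp[OF trigp_L2c] sqnorm_cint[OF trigp_L2c] by simp
  also have "\<dots> = (\<Sum>n\<in>I. of_real ((cmod (c n))\<^sup>2))"
    using assms by (intro sum.cong) (simp_all only: fcoeff_trigp complex_norm_square if_True)
  finally show ?thesis by (simp only: of_real_sum[symmetric] of_real_eq_iff)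
qed

lemma bessel:
  assumes "f \<in> L2c" "finite I"
  shows "(\<Sum>n\<in>I. (cmod (fcoeff f n))\<^sup>2) \<le> sqnorm_circ f"
proof -
  let ?T = "trigp (fcoeff f) I"
  have "cint (\<lambda>z. ?T z * cnj (f z)) = (\<Sum>n\<in>I. of_real ((cmod (fcoeff f n))\<^sup>2))"
    unfolding cint_trigp[OF assms(1)] by (simp only: complex_norm_square)
  then have "Re (cint (\<lambda>z. ?T z * cnj (f z))) = sqnorm_circ ?T"
    unfolding sqnorm_trigp[OF assms(2)] by (simp only: of_real_sum[symmetric] Re_complex_of_real)
  then have "sqnorm_circ (\<lambda>z. ?T z - f z) = sqnorm_circ f - sqnorm_circ ?T"
    using sqnorm_diff[OF trigp_L2c assms(1)] by simp
  then show ?thesis using sqnorm_nonneg[of "\<lambda>z. ?T z - f z"] sqnorm_trigp[OF assms(2)] by simp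
qed

lemma l2conv_fcoeff:
  assumes "\<And>k. F k \<in> L2c" "f \<in> L2c" "l2conv F f"
  shows "(\<lambda>k. fcoeff (F k) n) \<longlonglongrightarrow> fcoeff f n"
  using l2conv_cint[OF assms(1,2) L2c_powi assms(3), of "-n"]
  unfolding fcoeff_cint by (simp add: mult.commute)

text \<open>The squared distance of two partial sums is a difference of terms of the bounded
  increasing sequence \<open>S\<close>, hence the Cauchy property. That \<open>B\<close> survives in
  the limit is what gives the norm inequality in \<open>factorization\<close>.\<close>

lemma riesz_fischer:
  assumes B: "\<And>N::nat. (\<Sum>n\<in>{- int N..int N}. (cmod (c n))\<^sup>2) \<le> B"
  obtains g where "g \<in> L2c" "\<And>n. fcoeff g n = c n" "sqnorm_circ g \<le> B"
    "l2conv (\<lambda>N. trigp c {- int N..int N}) g"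
proof -
  define T where "T N = trigp c {- int N..int N}" for N :: nat
  define S where "S N = (\<Sum>n\<in>{- int N..int N}. (cmod (c n))\<^sup>2)" for N :: nat
  have T2: "T N \<in> L2c" for N by (simp add: T_def trigp_L2c)
  have diff: "sqnorm_circ (\<lambda>z. T N z - T M z) = S N - S M" if "M \<le> N" for M N
  proof -
    have sub: "{- int M..int M} \<subseteq> {- int N..int N}" using that by auto
    have "(\<lambda>z. T N z - T M z) = trigp c ({- int N..int N} - {- int M..int M})"
      using sub by (simp add: T_def trigp_def fun_eq_iff sum_diff)
    then show ?thesis using sub by (simp add: sqnorm_trigp S_def sum_diff)
  qed
  have "incseq S" unfolding S_def by (intro incseq_SucI sum_mono2) auto
  then obtain L where "S \<longlonglongrightarrow> L"
    using incseq_convergent[of S B] B unfolding S_def[symmetric] by blast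
  then have Cau: "Cauchy S" by (rule LIMSEQ_imp_Cauchy)
  have "\<exists>f\<in>L2c. l2conv T f"
  proof (rule L2_complete[of T])
    fix e :: real assume "e > 0"
    then have "e\<^sup>2 > 0" by simp
    then obtain K where K: "\<And>m n. m \<ge> K \<Longrightarrow> n \<ge> K \<Longrightarrow> \<bar>S m - S n\<bar> < e\<^sup>2"
      using Cau unfolding Cauchy_def dist_real_def by blast
    have "l2norm (\<lambda>z. T m z - T n z) < e" if "m \<ge> K" "n \<ge> K" for m n
    proof -
      have "sqnorm_circ (\<lambda>z. T m z - T n z) = \<bar>S m - S n\<bar>"
      proof (cases "n \<le> m")
        case True then show ?thesis using diff[OF True] sqnorm_nonneg[of "\<lambda>z. T m z - T n z"] by simp
      next
        case False
        then have le: "m \<le> n" by simp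
        have "sqnorm_circ (\<lambda>z. T m z - T n z) = sqnorm_circ (\<lambda>z. T n z - T m z)"
          by (rule sqnorm_cong) (simp add: norm_minus_commute)
        then show ?thesis using diff[OF le] sqnorm_nonneg[of "\<lambda>z. T n z - T m z"] by simp
      qed
      then have "(l2norm (\<lambda>z. T m z - T n z))\<^sup>2 < e\<^sup>2" using K[OF that] by (simp add: l2norm_sq)
      then show ?thesis using \<open>e > 0\<close> by (intro power2_less_imp_less[of _ e]) auto
    qed
    then show "\<exists>N. \<forall>m\<ge>N. \<forall>n\<ge>N. l2norm (\<lambda>z. T m z - T n z) < e" by blast
  qed (use T2 in auto)
  then obtain g where g: "g \<in> L2c" "l2conv T g" by blast
  have "fcoeff g n = c n" for n
  proof -
    have "\<forall>\<^sub>F N in sequentially. fcoeff (T N) n = c n"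
      unfolding T_def by (intro eventually_sequentiallyI[of "nat \<bar>n\<bar>"]) (auto simp: fcoeff_trigp)
    then have "(\<lambda>N. fcoeff (T N) n) \<longlonglongrightarrow> c n" by (rule tendsto_eventually)
    with l2conv_fcoeff[OF T2 g, of n] show ?thesis by (rule LIMSEQ_unique)
  qed
  moreover have "sqnorm_circ g \<le> B"
    using l2conv_sqnorm[OF T2 g] B by (intro LIMSEQ_le_const2) (auto simp: T_def sqnorm_trigp)
  ultimately show ?thesis using that g unfolding T_def by blast
qed

text \<open>Completeness of the exponentials comes from the uniqueness theorem: the square mean
  limit of the partial sums has the coefficients of \<open>f\<close>.\<close>

lemma fourier_l2conv:
  assumes f: "f \<in> L2c"
  shows "l2conv (\<lambda>N. trigp (fcoeff f) {- int N..int N}) f"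
proof -
  obtain g where g: "g \<in> L2c" "\<And>n. fcoeff g n = fcoeff f n" "l2conv (\<lambda>N. trigp (fcoeff f) {- int N..int N}) g"
    using riesz_fischer[OF bessel[OF f finite_atLeastAtMost_int]] by blast
  have "ae_eq_circ g f" using fcoeff_unique[OF L2_L1[OF g(1)] L2_L1[OF f]] g(2) by simp
  then have "l2norm (\<lambda>z. trigp (fcoeff f) I z - g z) = l2norm (\<lambda>z. trigp (fcoeff f) I z - f z)" for I
    unfolding l2norm_def ae_eq_circ_def
    by (subst sqnorm_cong_AE[of _ "\<lambda>z. trigp (fcoeff f) I z - f z"])
       (auto intro!: meas_circ_diff L2c_meas_circ[OF f] L2c_meas_circ[OF g(1)] L2c_meas_circ[OF trigp_L2c])
  then show ?thesis using g(3) by (simp add: l2conv_def)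
qed

lemma cint_orthogonal:
  assumes "f \<in> L2c" "g \<in> L2c" "\<And>n. fcoeff f n = 0 \<or> fcoeff g n = 0"
  shows "cint (\<lambda>z. f z * cnj (g z)) = 0"
proof -
  have "(\<lambda>N. cint (\<lambda>z. trigp (fcoeff f) {- int N..int N} z * cnj (g z))) \<longlonglongrightarrow> cint (\<lambda>z. f z * cnj (g z))"
    by (intro l2conv_cint trigp_L2c assms L2c_cnj fourier_l2conv)
  moreover have "cint (\<lambda>z. trigp (fcoeff f) {- int N..int N} z * cnj (g z)) = 0" for N
    unfolding cint_trigp[OF assms(2)] using assms(3) by (intro sum.neutral) force
  ultimately show ?thesis by (simp add: LIMSEQ_const_iff)
qed

text \<open>The case of the convolution formula in which every term vanishes; it reduces to
  orthogonality of \<open>f\<close> and \<open>z powi n * cnj g\<close>, without summing a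
  series.\<close>

lemma fcoeff_mult_zero:
  assumes "f \<in> L2c" "g \<in> L2c" "\<And>k. fcoeff f k = 0 \<or> fcoeff g (n - k) = 0"
  shows "fcoeff (\<lambda>z. f z * g z) n = 0"
proof -
  have "fcoeff (\<lambda>z. f z * g z) n = cint (\<lambda>z. f z * cnj (z powi n * cnj (g z)))"
    unfolding fcoeff_cint by (rule cint_cong) (simp add: cnj_powi_cis)
  also have "\<dots> = 0"
  proof (rule cint_orthogonal)
    show "fcoeff f k = 0 \<or> fcoeff (\<lambda>z. z powi n * cnj (g z)) k = 0" for k
      using assms(3)[of k] by (simp add: fcoeff_powi_mult fcoeff_cnj)
  qed (intro assms L2c_powi_mult L2c_cnj)+
  finally show ?thesis .
qed

text \<open>Parallelogram law: the midpoint of two near-minimisers lies in \<open>S\<close>, so its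
  norm is not too small, which forces the two to be close. It serves both the hyperplane in
  \<open>extremal_function\<close> and the translated subspace in
  \<open>model_space_isometric_space\<close>.\<close>

lemma min_norm_exists:
  assumes S: "S \<subseteq> L2c" "S \<noteq> {}"
    and mid: "\<And>f g. f \<in> S \<Longrightarrow> g \<in> S \<Longrightarrow> (\<lambda>z. (1/2) * (f z + g z)) \<in> S"
    and cl: "\<And>F f. (\<And>k. F k \<in> S) \<Longrightarrow> f \<in> L2c \<Longrightarrow> l2conv F f \<Longrightarrow> f \<in> S"
  obtains q where "q \<in> S" "\<And>h. h \<in> S \<Longrightarrow> sqnorm_circ q \<le> sqnorm_circ h"
proof -
  define d where "d = Inf (sqnorm_circ ` S)"
  have bdd: "bdd_below (sqnorm_circ ` S)" by (auto intro!: bdd_belowI[of _ 0] simp: sqnorm_nonneg)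
  have d_le: "d \<le> sqnorm_circ h" if "h \<in> S" for h
    unfolding d_def using that bdd by (intro cInf_lower) auto
  have "\<exists>f\<in>S. sqnorm_circ f < d + 1 / real (Suc k)" for k
    using cInf_lessD[of "sqnorm_circ ` S" "d + 1 / real (Suc k)"] S(2) unfolding d_def by auto
  then obtain F where F: "\<And>k. F k \<in> S" "\<And>k. sqnorm_circ (F k) < d + 1 / real (Suc k)" by metis
  have F2: "F k \<in> L2c" for k using F(1) S(1) by blast
  have par: "sqnorm_circ (\<lambda>z. F m z - F n z) < 2 / real (Suc m) + 2 / real (Suc n)" for m n
  proof -
    have "sqnorm_circ (\<lambda>z. (1/2) * (F m z + F n z)) = (1/4) * sqnorm_circ (\<lambda>z. F m z + F n z)"
      using sqnorm_scale[of "1/2" "\<lambda>z. F m z + F n z"] by (simp add: power2_eq_square norm_divide)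
    then have "4 * d \<le> sqnorm_circ (\<lambda>z. F m z + F n z)"
      using d_le[OF mid[OF F(1)[of m] F(1)[of n]]] by simp
    then show ?thesis using sqnorm_add[OF F2[of m] F2[of n]] sqnorm_diff[OF F2[of m] F2[of n]] F(2)[of m] F(2)[of n]
      by simp
  qed
  have "\<exists>f\<in>L2c. l2conv F f"
  proof (rule L2_complete[of F])
    fix e :: real assume "e > 0"
    \<comment> \<open>Past \<open>N\<close> the two terms of \<open>par\<close> add up to at most
      \<open>4 / N\<close>, which is below \<open>e^2\<close>.\<close>
    then obtain N :: nat where N: "4 / e\<^sup>2 < real N" using reals_Archimedean2 by blast
    have "l2norm (\<lambda>z. F m z - F n z) < e" if "m \<ge> N" "n \<ge> N" for m n
    proof -
      have N0: "0 < 4 / e\<^sup>2" using \<open>e > 0\<close> by simp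
      then have N1: "real N > 0" using N by linarith
      have "2 / real (Suc m) \<le> 2 / real N" "2 / real (Suc n) \<le> 2 / real N"
        using that N1 by (auto intro!: divide_left_mono)
      moreover have "4 / real N < e\<^sup>2" using N N1 \<open>e > 0\<close> by (simp add: field_simps)
      ultimately have "(l2norm (\<lambda>z. F m z - F n z))\<^sup>2 < e\<^sup>2" using par[of m n] by (simp add: l2norm_sq)
      then show ?thesis using \<open>e > 0\<close> by (intro power2_less_imp_less[of _ e]) auto
    qed
    then show "\<exists>N. \<forall>m\<ge>N. \<forall>n\<ge>N. l2norm (\<lambda>z. F m z - F n z) < e" by blast
  qed (use F2 in auto)
  then obtain q where q: "q \<in> L2c" "l2conv F q" by blast
  have qS: "q \<in> S" using cl[OF F(1) q] .
  have "sqnorm_circ q \<le> d"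
  proof (rule LIMSEQ_le[OF l2conv_sqnorm[OF F2 q]])
    have "(\<lambda>k. d + 1 / real (Suc k)) \<longlonglongrightarrow> d + 0"
      by (intro tendsto_add tendsto_const LIMSEQ_Suc lim_1_over_n)
    then show "(\<lambda>k. d + 1 / real (Suc k)) \<longlonglongrightarrow> d" by simp
    show "\<exists>N. \<forall>k\<ge>N. sqnorm_circ (F k) \<le> d + 1 / real (Suc k)" using F(2) less_imp_le by blast
  qed
  then show ?thesis using that[OF qS] d_le by (meson order_trans)
qed

lemma minimal_orthogonal:
  assumes q: "q \<in> L2c" and v: "v \<in> L2c"
    and min: "\<And>c. sqnorm_circ q \<le> sqnorm_circ (\<lambda>z. q z - c * v z)"
  shows "cint (\<lambda>z. q z * cnj (v z)) = 0"
proof -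
  define i where "i = cint (\<lambda>z. q z * cnj (v z))"
  \<comment> \<open>The \<open>+ 1\<close> keeps the quotient meaningful when \<open>v\<close> has
    norm zero and gives \<open>t * sqnorm_circ v < 2\<close>; subtracting \<open>t * i\<close> times
    \<open>v\<close> then lowers the norm unless \<open>i = 0\<close>.\<close>
  define t where "t = 1 / (sqnorm_circ v + 1)"
  have t: "t > 0" using sqnorm_nonneg[of v] by (simp add: t_def)
  have t2: "t * sqnorm_circ v < 2"
    using sqnorm_nonneg[of v] by (simp add: t_def field_simps)
  let ?c = "of_real t * i"
  have "cint (\<lambda>z. q z * cnj (?c * v z)) = cint (\<lambda>z. cnj ?c * (q z * cnj (v z)))"
    by (rule cint_cong) simp
  also have "\<dots> = of_real t * (i * cnj i)" by (simp only: cint_scale i_def[symmetric]) simp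
  also have "\<dots> = of_real (t * (cmod i)\<^sup>2)" by (simp only: complex_norm_square of_real_mult)
  finally have "Re (cint (\<lambda>z. q z * cnj (?c * v z))) = t * (cmod i)\<^sup>2" by (simp only: Re_complex_of_real)
  then have "0 \<le> (cmod ?c)\<^sup>2 * sqnorm_circ v - 2 * (t * (cmod i)\<^sup>2)"
    using min[of ?c] sqnorm_diff[OF q L2c_scale[OF v], of ?c] by (simp only: sqnorm_scale)
  also have "\<dots> = (t * (cmod i)\<^sup>2) * (t * sqnorm_circ v - 2)"
    by (simp add: norm_mult power_mult_distrib algebra_simps power2_eq_square)
  finally have "t * (cmod i)\<^sup>2 \<le> 0" using t2 by (simp add: zero_le_mult_iff)
  then have "(cmod i)\<^sup>2 \<le> 0" using t by (simp add: mult_le_0_iff)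
  then show ?thesis by (simp add: i_def)
qed

subsection \<open>Bounded analytic functions\<close>

text \<open>The number \<open>a\<close> plays the role of the value of \<open>G\<close> at the origin. Stating analyticity through the
  action of \<open>cnj G\<close> on all integrable functions without positive frequencies makes closure under products and
  bounded pointwise limits immediate.\<close>

definition bounded_analytic :: "(complex \<Rightarrow> complex) \<Rightarrow> complex \<Rightarrow> bool" where
  "bounded_analytic G a \<longleftrightarrow> meas_circ G \<and> (\<exists>C. AE t in circ. cmod (G (cis t)) \<le> C) \<and>
     (\<forall>Y\<in>L1c. (\<forall>n>0. fcoeff Y n = 0) \<longrightarrow>
        (\<forall>n>0. fcoeff (\<lambda>z. Y z * cnj (G z)) n = 0) \<and>
        fcoeff (\<lambda>z. Y z * cnj (G z)) 0 = fcoeff Y 0 * cnj a)"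

lemma bounded_analytic_meas_circ: "bounded_analytic G a \<Longrightarrow> meas_circ G"
  by (simp add: bounded_analytic_def)

lemma bounded_analytic_L1c:
  assumes "bounded_analytic G a" "Y \<in> L1c"
  shows "(\<lambda>z. Y z * cnj (G z)) \<in> L1c"
proof -
  obtain C where "AE t in circ. cmod (G (cis t)) \<le> C" using assms(1) by (auto simp: bounded_analytic_def)
  then show ?thesis using assms by (intro L1c_mult_bounded[of _ _ C] meas_circ_cnj bounded_analytic_meas_circ) auto
qed

lemma bounded_analytic_coeff:
  assumes "bounded_analytic G a" "Y \<in> L1c" "\<And>n. n > 0 \<Longrightarrow> fcoeff Y n = 0"
  shows "n > 0 \<Longrightarrow> fcoeff (\<lambda>z. Y z * cnj (G z)) n = 0"
    and "fcoeff (\<lambda>z. Y z * cnj (G z)) 0 = fcoeff Y 0 * cnj a"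
  using assms by (auto simp: bounded_analytic_def)

lemma bounded_analytic_const: "bounded_analytic (\<lambda>z. c) c"
proof -
  have "fcoeff (\<lambda>z. Y z * cnj c) n = fcoeff Y n * cnj c" for Y n
    using fcoeff_scale[of "cnj c" Y n] by (simp add: mult.commute)
  then show ?thesis by (auto simp: bounded_analytic_def meas_circ_const)
qed

lemma bounded_analytic_id: "bounded_analytic (\<lambda>z. z) 0"
proof -
  have "fcoeff (\<lambda>z. Y z * cnj z) n = fcoeff Y (n + 1)" for Y n
    using fcoeff_mult_cnj_id[of Y n] by (simp add: mult.commute)
  then show ?thesis by (auto simp: bounded_analytic_def meas_circ_id intro!: exI[of _ 1])
qed

lemma bounded_analytic_add:
  assumes "bounded_analytic F a" "bounded_analytic G b" shows "bounded_analytic (\<lambda>z. F z + G z) (a + b)"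
proof -
  obtain C D where C: "AE t in circ. cmod (F (cis t)) \<le> C" and D: "AE t in circ. cmod (G (cis t)) \<le> D"
    using assms by (auto simp: bounded_analytic_def)
  have "AE t in circ. cmod (F (cis t) + G (cis t)) \<le> C + D"
    using C D by eventually_elim (rule norm_triangle_mono)
  moreover have "fcoeff (\<lambda>z. Y z * cnj (F z + G z)) n
      = fcoeff (\<lambda>z. Y z * cnj (F z)) n + fcoeff (\<lambda>z. Y z * cnj (G z)) n" if "Y \<in> L1c" for Y n
    using fcoeff_add[OF bounded_analytic_L1c[OF assms(1) that] bounded_analytic_L1c[OF assms(2) that], of n] by (simp add: algebra_simps)
  ultimately show ?thesis
    using assms bounded_analytic_meas_circ[OF assms(1)] bounded_analytic_meas_circ[OF assms(2)] bounded_analytic_coeff[OF assms(1)] bounded_analytic_coeff[OF assms(2)]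
    unfolding bounded_analytic_def[of "\<lambda>z. F z + G z"]
    by (auto simp: meas_circ_add algebra_simps simp del: complex_cnj_add) (simp add: algebra_simps)
qed

lemma bounded_analytic_mult:
  assumes F: "bounded_analytic F a" and G: "bounded_analytic G b" shows "bounded_analytic (\<lambda>z. F z * G z) (a * b)"
proof -
  obtain C D where C: "AE t in circ. cmod (F (cis t)) \<le> C" and D: "AE t in circ. cmod (G (cis t)) \<le> D"
    using assms by (auto simp: bounded_analytic_def)
  have "AE t in circ. cmod (F (cis t) * G (cis t)) \<le> C * D"
    using C D
  proof eventually_elim
    case (elim t)
    have "0 \<le> C" using norm_ge_zero elim(1) by (rule order_trans)
    then show ?case unfolding norm_mult using elim by (intro mult_mono) auto
  qed
  moreover have "(\<forall>n>0. fcoeff (\<lambda>z. Y z * cnj (F z * G z)) n = 0) \<and>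
        fcoeff (\<lambda>z. Y z * cnj (F z * G z)) 0 = fcoeff Y 0 * cnj (a * b)"
    if Y: "Y \<in> L1c" "\<forall>n>0. fcoeff Y n = 0" for Y
  proof -
    have e: "(\<lambda>z. Y z * cnj (F z * G z)) = (\<lambda>z. (Y z * cnj (F z)) * cnj (G z))"
      by (simp add: fun_eq_iff mult.assoc)
    have Y0: "n > 0 \<Longrightarrow> fcoeff Y n = 0" for n using Y(2) by blast
    note 1 = bounded_analytic_coeff[OF F Y(1) Y0]
    note 2 = bounded_analytic_coeff[OF G bounded_analytic_L1c[OF F Y(1)] 1(1)]
    show ?thesis unfolding e using 2 1(2) by simp
  qed
  ultimately show ?thesis unfolding bounded_analytic_def[of "\<lambda>z. F z * G z"]
    using bounded_analytic_meas_circ[OF F] bounded_analytic_meas_circ[OF G] by (auto simp: meas_circ_mult)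
qed

lemma bounded_analytic_sum:
  assumes "\<And>i. i \<in> I \<Longrightarrow> bounded_analytic (F i) (a i)"
  shows "bounded_analytic (\<lambda>z. \<Sum>i\<in>I. F i z) (\<Sum>i\<in>I. a i)"
  using assms
  by (induction I rule: infinite_finite_induct) (auto intro: bounded_analytic_const bounded_analytic_add)

lemma bounded_analytic_power: "bounded_analytic F a \<Longrightarrow> bounded_analytic (\<lambda>z. F z ^ n) (a ^ n)"
  by (induction n) (auto intro: bounded_analytic_const bounded_analytic_mult)

lemma bounded_analytic_scale: "bounded_analytic F a \<Longrightarrow> bounded_analytic (\<lambda>z. c * F z) (c * a)"
  by (rule bounded_analytic_mult[OF bounded_analytic_const])

text \<open>The bound \<open>C\<close> does not depend on \<open>k\<close>, so
  \<open>C * cmod Y\<close> dominates all products with a fixed \<open>Y\<close>, and the conditions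
  on the coefficients pass to the limit.\<close>

lemma bounded_analytic_lim:
  assumes G: "\<And>k::nat. bounded_analytic (G k) (a k)" and m: "meas_circ H"
    and C: "\<And>k. AE t in circ. cmod (G k (cis t)) \<le> C"
    and lim: "AE t in circ. (\<lambda>k. G k (cis t)) \<longlonglongrightarrow> H (cis t)" and a: "a \<longlonglongrightarrow> b"
  shows "bounded_analytic H b"
proof -
  have C': "AE t in circ. \<forall>k. cmod (G k (cis t)) \<le> C" using C by (simp add: AE_all_countable)
  have "AE t in circ. cmod (H (cis t)) \<le> C"
    using C' lim
  proof eventually_elim
    case (elim t)
    show ?case by (rule LIMSEQ_le_const2[OF tendsto_norm[OF elim(2)]]) (use elim(1) in blast)
  qed
  moreover have conv: "(\<lambda>k. fcoeff (\<lambda>z. Y z * cnj (G k z)) n) \<longlonglongrightarrow> fcoeff (\<lambda>z. Y z * cnj (H z)) n"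
    if Y: "Y \<in> L1c" for Y n
    unfolding fcoeff_cint
  proof (rule cint_dominated[where w="\<lambda>z. of_real C * Y z"])
    show "meas_circ (\<lambda>z. z powi - n * (Y z * cnj (G k z)))" for k
      using L1c_meas_circ[OF Y] bounded_analytic_meas_circ[OF G] by (simp add: meas_circ_mult meas_circ_powi meas_circ_cnj)
    show "meas_circ (\<lambda>z. z powi - n * (Y z * cnj (H z)))"
      using L1c_meas_circ[OF Y] m by (simp add: meas_circ_mult meas_circ_powi meas_circ_cnj)
    show "(\<lambda>z. of_real C * Y z) \<in> L1c" by (intro L1c_scale Y)
    show "AE t in circ. cmod (cis t powi - n * (Y (cis t) * cnj (G k (cis t)))) \<le> cmod (of_real C * Y (cis t))" for k
      using C[of k]
    proof eventually_elim
      case (elim t)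
      then have "cmod (Y (cis t)) * cmod (G k (cis t)) \<le> cmod (Y (cis t)) * \<bar>C\<bar>"
        by (intro mult_left_mono) auto
      then show ?case unfolding norm_mult norm_of_real norm_cis_powi complex_mod_cnj by (simp add: mult.commute)
    qed
    show "AE t in circ. (\<lambda>k. cis t powi - n * (Y (cis t) * cnj (G k (cis t)))) \<longlonglongrightarrow> cis t powi - n * (Y (cis t) * cnj (H (cis t)))"
      using lim by eventually_elim (intro tendsto_intros)
  qed
  moreover have "fcoeff (\<lambda>z. Y z * cnj (H z)) n = 0" if Y: "Y \<in> L1c" "\<And>n. n > 0 \<Longrightarrow> fcoeff Y n = 0" "n > 0" for Y n
    using conv[OF Y(1), of n] bounded_analytic_coeff(1)[OF G Y] by (simp add: LIMSEQ_const_iff)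
  moreover have "fcoeff (\<lambda>z. Y z * cnj (H z)) 0 = fcoeff Y 0 * cnj b"
    if Y: "Y \<in> L1c" "\<And>n. n > 0 \<Longrightarrow> fcoeff Y n = 0" for Y
  proof -
    have "(\<lambda>k. fcoeff Y 0 * cnj (a k)) \<longlonglongrightarrow> fcoeff (\<lambda>z. Y z * cnj (H z)) 0"
      using conv[OF Y(1), of 0] bounded_analytic_coeff(2)[OF G Y] by simp
    moreover have "(\<lambda>k. fcoeff Y 0 * cnj (a k)) \<longlonglongrightarrow> fcoeff Y 0 * cnj b" by (intro tendsto_intros a)
    ultimately show ?thesis by (rule LIMSEQ_unique)
  qed
  ultimately show ?thesis using m by (auto simp: bounded_analytic_def)
qed

text \<open>The partial sums of the exponential series are polynomials in \<open>G\<close>, all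
  bounded by \<open>exp C\<close> on the circle.\<close>

lemma bounded_analytic_exp:
  assumes G: "bounded_analytic G a" shows "bounded_analytic (\<lambda>z. exp (G z)) (exp a)"
proof -
  obtain C where C: "AE t in circ. cmod (G (cis t)) \<le> C" using G by (auto simp: bounded_analytic_def)
  define P where "P n x = (\<Sum>i<n. (1 / of_nat (fact i)) * x ^ i)" for n and x :: complex
  have Pexp: "(\<lambda>n. P n x) \<longlonglongrightarrow> exp x" for x
    using exp_converges[of x] unfolding sums_def P_def by (simp add: scaleR_conv_of_real field_simps)
  have Pn: "cmod (P n x) \<le> exp (cmod x)" for n x
  proof -
    have "cmod (P n x) \<le> (\<Sum>i<n. cmod ((1 / of_nat (fact i)) * x ^ i))" unfolding P_def by (rule norm_sum)
    also have "\<dots> = (\<Sum>i<n. inverse (fact i) * cmod x ^ i)"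
      by (simp add: norm_mult norm_divide norm_power divide_inverse norm_inverse norm_fact)
    also have "\<dots> \<le> (\<Sum>i. inverse (fact i) * cmod x ^ i)"
      using summable_exp[of "cmod x"] by (intro sum_le_suminf) auto
    also have "\<dots> = exp (cmod x)" by (simp add: exp_def)
    finally show ?thesis .
  qed
  show ?thesis
  proof (rule bounded_analytic_lim)
    show "bounded_analytic (\<lambda>z. P k (G z)) (P k a)" for k unfolding P_def by (intro bounded_analytic_sum bounded_analytic_scale bounded_analytic_power G)
    show "meas_circ (\<lambda>z. exp (G z))" by (intro meas_circ_exp bounded_analytic_meas_circ[OF G])
    show "AE t in circ. cmod (P k (G (cis t))) \<le> exp C" for k
      using C by eventually_elim (meson Pn exp_le_cancel_iff order_trans)
    show "AE t in circ. (\<lambda>k. P k (G (cis t))) \<longlonglongrightarrow> exp (G (cis t))" by (intro AE_I2 Pexp)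
    show "(\<lambda>k. P k a) \<longlonglongrightarrow> exp a" by (rule Pexp)
  qed
qed

subsection \<open>Analytic completion and outer multipliers\<close>

text \<open>Transfers the square mean convergence of Fourier partial sums to their Fejer means in
  \<open>analytic_completion\<close>.\<close>

lemma cesaro_null:
  fixes a :: "nat \<Rightarrow> real"
  assumes a: "a \<longlonglongrightarrow> 0" and nn: "\<And>n. 0 \<le> a n"
  shows "(\<lambda>n. (\<Sum>m<n. a m) / real n) \<longlonglongrightarrow> 0"
proof (rule LIMSEQ_I)
  fix e :: real assume e: "e > 0"
  then obtain N where N: "\<And>m. m \<ge> N \<Longrightarrow> a m < e / 2"
    using LIMSEQ_D[OF a, of "e/2"] nn by fastforce
  define M where "M = (\<Sum>m<N. a m)"
  have M0: "M \<ge> 0" unfolding M_def by (intro sum_nonneg nn)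
  obtain K :: nat where K: "2 * M / e < real K" using reals_Archimedean2 by blast
  have A: "(\<Sum>m<n. a m) / real n < e" if n: "n \<ge> Suc (N + K)" for n
  proof -
    have "(\<Sum>m<n. a m) = M + (\<Sum>m\<in>{N..<n}. a m)"
      unfolding M_def using n by (subst sum.union_disjoint[symmetric]) (auto intro!: sum.cong)
    also have "(\<Sum>m\<in>{N..<n}. a m) \<le> (\<Sum>m\<in>{N..<n}. e / 2)"
      using N by (intro sum_mono less_imp_le) auto
    also have "\<dots> \<le> real n * (e / 2)" using e n by (simp add: of_nat_diff mult_right_mono)
    also have "M < real n * (e / 2)"
    proof -
      have "2 * M / e < real n" using K n by linarith
      then show ?thesis using e by (simp add: field_simps)
    qed
    finally have "(\<Sum>m<n. a m) < e * real n" by simp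
    then show ?thesis using n by (simp add: divide_less_eq)
  qed
  have B: "0 \<le> (\<Sum>m<n. a m) / real n" for n by (intro divide_nonneg_nonneg sum_nonneg nn) auto
  show "\<exists>no. \<forall>n\<ge>no. norm ((\<Sum>m<n. a m) / real n - 0) < e"
    unfolding diff_0_right real_norm_def abs_of_nonneg[OF B] using A by blast
qed

context
  fixes v :: "complex \<Rightarrow> real"
  assumes v2: "(\<lambda>z. complex_of_real (v z)) \<in> L2c" and v0: "\<And>z. 0 \<le> v z"
begin

definition "real_coeff n = fcoeff (\<lambda>z. complex_of_real (v z)) n"

text \<open>Partial sum of the analytic function with real part \<open>v\<close> that is real at the
  origin. On the circle its real part is the symmetric Fourier partial sum of
  \<open>v\<close>.\<close>

definition completion_partial :: "nat \<Rightarrow> complex \<Rightarrow> complex" where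
  "completion_partial m z = real_coeff 0 + 2 * (\<Sum>k<m. real_coeff (int k + 1) * z ^ (k + 1))"

lemma real_coeff_minus: "real_coeff (-n) = cnj (real_coeff n)"
  unfolding real_coeff_def using fcoeff_cnj[of "\<lambda>z. complex_of_real (v z)" n] by simp

text \<open>Enlarging the index square from \<open>n\<close> to \<open>Suc n\<close> adds a row, a
  column and a corner. Row and column are conjugate to each other, and together with the corner they
  make up the real part of \<open>completion_partial n\<close>.\<close>

lemma fejer_sum:
  "complex_of_real (\<Sum>m<n. Re (completion_partial m (cis t)))
     = (\<Sum>j<n. \<Sum>l<n. real_coeff (int j - int l) * cis t powi (int j - int l))"
proof (induction n)
  case 0 show ?case by simp
next
  case (Suc n)
  define f where "f k = real_coeff (int k + 1) * cis t ^ (k + 1)" for k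
  have c0: "cnj (real_coeff 0) = real_coeff 0" using real_coeff_minus[of 0] by simp
  have "real_coeff (int n - int l) * cis t powi (int n - int l) = f (n - Suc l)" if "l < n" for l
  proof -
    have e: "int (n - Suc l) + 1 = int n - int l" "int n - int l = int (n - Suc l + 1)" using that by auto
    have "cis t powi (int n - int l) = cis t ^ (n - Suc l + 1)" unfolding e(2) by (rule power_int_of_nat)
    then show ?thesis unfolding f_def e(1) by simp
  qed
  then have s1: "(\<Sum>l<n. real_coeff (int n - int l) * cis t powi (int n - int l)) = (\<Sum>k<n. f k)"
    by (simp add: sum.nat_diff_reindex)
  have "real_coeff (int j - int n) * cis t powi (int j - int n) = cnj (real_coeff (int n - int j) * cis t powi (int n - int j))" for j
    using real_coeff_minus[of "int n - int j"] cnj_cis_powi[of t "int n - int j"] by simp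
  then have s2: "(\<Sum>j<n. real_coeff (int j - int n) * cis t powi (int j - int n)) = cnj (\<Sum>k<n. f k)"
    using s1 by (simp only: cnj_sum[symmetric])
  have P: "complex_of_real (Re (completion_partial n (cis t))) = real_coeff 0 + (\<Sum>k<n. f k) + cnj (\<Sum>k<n. f k)"
  proof -
    have "completion_partial n (cis t) = real_coeff 0 + 2 * (\<Sum>k<n. f k)" by (simp add: completion_partial_def f_def)
    moreover have "complex_of_real (Re (real_coeff 0 + 2 * x)) = real_coeff 0 + x + cnj x" for x
      using c0 by (auto simp: complex_eq_iff)
    ultimately show ?thesis by (simp only:)
  qed
  have "(\<Sum>j<Suc n. \<Sum>l<Suc n. real_coeff (int j - int l) * cis t powi (int j - int l))
     = (\<Sum>j<n. \<Sum>l<n. real_coeff (int j - int l) * cis t powi (int j - int l))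
       + (\<Sum>j<n. real_coeff (int j - int n) * cis t powi (int j - int n))
       + ((\<Sum>l<n. real_coeff (int n - int l) * cis t powi (int n - int l)) + real_coeff 0)"
    by (simp add: sum.distrib)
  then show ?case using Suc.IH unfolding s1 s2 by (simp add: P)
qed

text \<open>The double sum of \<open>fejer_sum\<close> is the integral of \<open>v\<close> against the square modulus of a
  trigonometric polynomial.\<close>

lemma fejer_nonneg: "0 \<le> (\<Sum>m<n. Re (completion_partial m (cis t)))"
proof -
  \<comment> \<open>On the circle the squared modulus of \<open>K\<close> is \<open>n\<close> times
    the Fejer kernel centred at \<open>cis t\<close>.\<close>
  define K where "K z = (\<Sum>j<n. cis t powi int j * z powi (- int j))" for z :: complex
  have L: "(\<lambda>z. z powi i * complex_of_real (v z)) \<in> L1c" for i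
    by (intro L1c_powi_mult L2_L1 v2)
  have K: "K (cis x) * cnj (K (cis x)) = (\<Sum>j<n. \<Sum>l<n. cis t powi (int j - int l) * cis x powi (- (int j - int l)))" for x
  proof -
    have "K (cis x) * cnj (K (cis x))
       = (\<Sum>j<n. \<Sum>l<n. (cis t powi int j * cis x powi (- int j)) * (cis t powi (- int l) * cis x powi int l))"
      unfolding K_def cnj_sum sum_product complex_cnj_mult cnj_cis_powi minus_minus ..
    also have "\<dots> = (\<Sum>j<n. \<Sum>l<n. cis t powi (int j - int l) * cis x powi (- (int j - int l)))"
    proof (intro sum.cong refl)
      fix j l
      have "cis t powi (int j - int l) = cis t powi int j * cis t powi (- int l)"
        "cis x powi (- (int j - int l)) = cis x powi (- int j) * cis x powi int l"
        unfolding cis_powi_add by simp_all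
      then show "(cis t powi int j * cis x powi (- int j)) * (cis t powi (- int l) * cis x powi int l)
         = cis t powi (int j - int l) * cis x powi (- (int j - int l))" by (simp only: mult_ac)
    qed
    finally show ?thesis .
  qed
  have "cint (\<lambda>z. complex_of_real (v z) * (K z * cnj (K z)))
     = cint (\<lambda>z. \<Sum>j<n. \<Sum>l<n. cis t powi (int j - int l) * (z powi (- (int j - int l)) * complex_of_real (v z)))"
    by (rule cint_cong) (simp only: K sum_distrib_left mult_ac)
  also have "\<dots> = (\<Sum>j<n. \<Sum>l<n. cis t powi (int j - int l) * real_coeff (int j - int l))"
    unfolding real_coeff_def fcoeff_cint by (simp only: cint_sum L1c_sum L1c_scale L cint_scale)
  also have "\<dots> = complex_of_real (\<Sum>m<n. Re (completion_partial m (cis t)))"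
    unfolding fejer_sum by (simp only: mult.commute)
  finally have e: "complex_of_real (\<Sum>m<n. Re (completion_partial m (cis t))) = cint (\<lambda>z. complex_of_real (v z) * (K z * cnj (K z)))" ..
  have "cint (\<lambda>z. complex_of_real (v z) * (K z * cnj (K z)))
     = integral\<^sup>L circ (\<lambda>x. complex_of_real (v (cis x) * (cmod (K (cis x)))\<^sup>2)) / of_real (2*pi)"
    unfolding cint_def complex_norm_square[symmetric] by (simp only: of_real_mult)
  also have "\<dots> = complex_of_real (integral\<^sup>L circ (\<lambda>x. v (cis x) * (cmod (K (cis x)))\<^sup>2) / (2*pi))"
    unfolding integral_complex_of_real of_real_divide ..
  finally have "(\<Sum>m<n. Re (completion_partial m (cis t))) = integral\<^sup>L circ (\<lambda>x. v (cis x) * (cmod (K (cis x)))\<^sup>2) / (2*pi)"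
    unfolding e[symmetric] of_real_eq_iff .
  moreover have "0 \<le> integral\<^sup>L circ (\<lambda>x. v (cis x) * (cmod (K (cis x)))\<^sup>2)"
    by (intro integral_nonneg_AE AE_I2 mult_nonneg_nonneg v0) auto
  ultimately show ?thesis by simp
qed

text \<open>\<open>W\<close> is the limit of the Fejer means of \<open>completion_partial\<close>; these have nonnegative real part, so the
  exponentials stay bounded along the approximation.\<close>

lemma analytic_completion:
  obtains W where "W \<in> L2c" "AE t in circ. Re (W (cis t)) = v (cis t)"
    "\<And>e. e \<ge> 0 \<Longrightarrow> bounded_analytic (\<lambda>z. exp (- of_real e * W z)) (exp (- of_real e * real_coeff 0))"
proof -
  \<comment> \<open>Since \<open>v\<close> is real, doubling its positive frequencies and dropping
    the negative ones leaves the real part unchanged.\<close>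
  define w where "w k = (if k = 0 then real_coeff 0 else if k > 0 then 2 * real_coeff k else 0)" for k :: int
  have B: "(\<Sum>n\<in>I. (cmod (w n))\<^sup>2) \<le> 4 * sqnorm_circ (\<lambda>z. complex_of_real (v z))" if "finite I" for I
  proof -
    have "(\<Sum>n\<in>I. (cmod (w n))\<^sup>2) \<le> (\<Sum>n\<in>I. 4 * (cmod (real_coeff n))\<^sup>2)"
      by (intro sum_mono) (auto simp: w_def norm_mult power_mult_distrib)
    also have "\<dots> \<le> 4 * sqnorm_circ (\<lambda>z. complex_of_real (v z))"
      using bessel[OF v2 that] by (simp add: sum_distrib_left[symmetric] real_coeff_def)
    finally show ?thesis .
  qed
  obtain W where W: "W \<in> L2c" "\<And>n. fcoeff W n = w n" "l2conv (\<lambda>N. trigp w {- int N..int N}) W"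
    using riesz_fischer[OF B[OF finite_atLeastAtMost_int]] by blast
  have Pt: "completion_partial m (cis t) = trigp w {- int m..int m} (cis t)" for m t
  proof -
    have "trigp w {- int m..int m} z = (\<Sum>n\<in>{0..int m}. w n * z powi n)" for z
      unfolding trigp_def by (rule sum.mono_neutral_right) (auto simp: w_def)
    also have "(\<Sum>n\<in>{0..int m}. w n * z powi n) = (\<Sum>k\<le>m. w (int k) * z ^ k)" for z :: complex
      by (rule sum.reindex_bij_witness[of _ int nat]) (auto simp: power_int_def)
    also have "(\<Sum>k\<le>m. w (int k) * z ^ k) = w 0 + (\<Sum>k<m. w (int (Suc k)) * z ^ Suc k)" for z :: complex
      by (simp add: sum.atMost_shift)
    finally show ?thesis by (simp add: completion_partial_def w_def sum_distrib_left mult_ac add.commute)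
  qed
  \<comment> \<open>Averaging \<open>Suc n\<close> partial sums keeps the mean meaningful at
    \<open>n = 0\<close>.\<close>
  define s where "s n z = (1 / of_nat (Suc n)) * (\<Sum>m<Suc n. completion_partial m z)" for n z
  have P_bounded_analytic: "bounded_analytic (completion_partial m) (real_coeff 0)" for m
  proof -
    have "bounded_analytic (\<lambda>z. real_coeff 0 + 2 * (\<Sum>k<m. real_coeff (int k + 1) * z ^ (k + 1)))
       (real_coeff 0 + 2 * (\<Sum>k<m. real_coeff (int k + 1) * 0 ^ (k + 1)))"
      by (intro bounded_analytic_add bounded_analytic_scale bounded_analytic_sum bounded_analytic_power bounded_analytic_const bounded_analytic_id)
    then show ?thesis by (simp add: completion_partial_def[abs_def])
  qed
  have s_bounded_analytic: "bounded_analytic (s n) (real_coeff 0)" for n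
  proof -
    have "bounded_analytic (\<lambda>z. (1 / of_nat (Suc n)) * (\<Sum>m<Suc n. completion_partial m z)) ((1 / of_nat (Suc n)) * (\<Sum>m<Suc n. real_coeff 0))"
      by (intro bounded_analytic_scale bounded_analytic_sum P_bounded_analytic)
    moreover have "(1 / of_nat (Suc n)) * (\<Sum>m<Suc n. real_coeff 0) = real_coeff 0"
      by (simp del: of_nat_Suc)
    ultimately show ?thesis by (simp only: s_def[abs_def])
  qed
  have P2: "completion_partial m \<in> L2c" for m
    using L2c_bound[OF trigp_L2c[of w "{- int m..int m}"] bounded_analytic_meas_circ[OF P_bounded_analytic[of m]]] Pt by simp
  have s2: "s n \<in> L2c" for n
    unfolding s_def[abs_def] by (intro L2c_scale L2c_sum P2)
  have s_pos: "0 \<le> Re (s n (cis t))" for n t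
  proof -
    have "s n z = complex_of_real (1 / real (Suc n)) * (\<Sum>m<Suc n. completion_partial m z)" for z by (simp add: s_def)
    then have "Re (s n (cis t)) = (1 / real (Suc n)) * (\<Sum>m<Suc n. Re (completion_partial m (cis t)))"
      by (simp only: Re_sum Re_complex_of_real Im_complex_of_real times_complex.sel mult_zero_left diff_0_right)
    then show ?thesis using fejer_nonneg[where t=t and n="Suc n"] by (simp del: sum.lessThan_Suc)
  qed
  have conv: "l2conv s W"
    unfolding l2conv_def
  proof (rule tendsto_sandwich[where f="\<lambda>_. 0"])
    define a where "a m = l2norm (\<lambda>z. completion_partial m z - W z)" for m
    have "(\<lambda>m. l2norm (\<lambda>z. trigp w {- int m..int m} z - W z)) \<longlonglongrightarrow> 0" using W(3) by (simp add: l2conv_def)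
    moreover have "l2norm (\<lambda>z. trigp w {- int m..int m} z - W z) = a m" for m
      unfolding a_def by (rule l2norm_cong) (simp add: Pt)
    ultimately have "a \<longlonglongrightarrow> 0" by simp
    then have "(\<lambda>n. (\<Sum>m<n. a m) / real n) \<longlonglongrightarrow> 0" by (rule cesaro_null) (simp add: a_def l2norm_nonneg)
    then show "(\<lambda>n. (\<Sum>m<Suc n. a m) / real (Suc n)) \<longlonglongrightarrow> 0" by (rule LIMSEQ_Suc)
    have tri: "l2norm (\<lambda>z. \<Sum>m<n. completion_partial m z - W z) \<le> (\<Sum>m<n. a m)" for n
    proof (induction n)
      case 0 show ?case by (simp add: l2norm_def sqnorm_circ_def)
    next
      case (Suc n)
      have "l2norm (\<lambda>z. (\<Sum>m<n. completion_partial m z - W z) + (completion_partial n z - W z)) \<le> l2norm (\<lambda>z. \<Sum>m<n. completion_partial m z - W z) + a n"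
        unfolding a_def by (intro l2norm_triangle L2c_sum L2c_diff P2 W)
      then show ?case using Suc by simp
    qed
    have "l2norm (\<lambda>z. s n z - W z) \<le> (\<Sum>m<Suc n. a m) / real (Suc n)" for n
    proof -
      have "s n z - W z = (1 / of_nat (Suc n)) * (\<Sum>m<Suc n. completion_partial m z - W z)" for z
        unfolding s_def sum_subtractf by (simp add: right_diff_distrib del: of_nat_Suc sum.lessThan_Suc)
      then have "l2norm (\<lambda>z. s n z - W z) = cmod (1 / of_nat (Suc n)) * l2norm (\<lambda>z. \<Sum>m<Suc n. completion_partial m z - W z)"
        by (simp only: l2norm_scale)
      also have "\<dots> = l2norm (\<lambda>z. \<Sum>m<Suc n. completion_partial m z - W z) / real (Suc n)"
        by (simp add: norm_divide del: of_nat_Suc sum.lessThan_Suc)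
      also have "\<dots> \<le> (\<Sum>m<Suc n. a m) / real (Suc n)" by (intro divide_right_mono tri) simp
      finally show ?thesis .
    qed
    then show "\<forall>\<^sub>F n in sequentially. l2norm (\<lambda>z. s n z - W z) \<le> (\<Sum>m<Suc n. a m) / real (Suc n)" by simp
  qed (simp_all add: l2norm_nonneg)
  obtain r :: "nat \<Rightarrow> nat" where r: "strict_mono r" "AE t in circ. (\<lambda>k. s (r k) (cis t)) \<longlonglongrightarrow> W (cis t)"
    using l2conv_AE_subseq[OF s2 W(1) conv] .
  have "bounded_analytic (\<lambda>z. exp (- of_real e * W z)) (exp (- of_real e * real_coeff 0))" if e: "e \<ge> 0" for e :: real
  proof (rule bounded_analytic_lim)
    show "bounded_analytic (\<lambda>z. exp (- of_real e * s (r k) z)) (exp (- of_real e * real_coeff 0))" for k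
      by (intro bounded_analytic_exp bounded_analytic_scale s_bounded_analytic)
    show "meas_circ (\<lambda>z. exp (- of_real e * W z))" by (intro meas_circ_exp meas_circ_mult meas_circ_const L2c_meas_circ W)
    show "AE t in circ. cmod (exp (- of_real e * s (r k) (cis t))) \<le> 1" for k
      using s_pos e by (simp add: norm_exp_eq_Re)
    show "AE t in circ. (\<lambda>k. exp (- of_real e * s (r k) (cis t))) \<longlonglongrightarrow> exp (- of_real e * W (cis t))"
      using r(2) by eventually_elim (intro tendsto_intros)
  qed simp
  moreover have "AE t in circ. Re (W (cis t)) = v (cis t)"
  proof -
    have "ae_eq_circ (\<lambda>z. (1/2) * (W z + cnj (W z))) (\<lambda>z. complex_of_real (v z))"
    proof (rule fcoeff_unique)
      show "(\<lambda>z. (1/2) * (W z + cnj (W z))) \<in> L1c" by (intro L2_L1 L2c_scale L2c_add L2c_cnj W)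
      show "(\<lambda>z. complex_of_real (v z)) \<in> L1c" by (rule L2_L1[OF v2])
      fix n
      have "fcoeff (\<lambda>z. (1/2) * (W z + cnj (W z))) n = (1/2) * (w n + cnj (w (-n)))"
        using W by (simp only: fcoeff_scale fcoeff_add[OF L2_L1 L2_L1[OF L2c_cnj]] fcoeff_cnj)
      also have "\<dots> = real_coeff n"
        using real_coeff_minus[of 0] real_coeff_minus[of n] by (auto simp: w_def)
      finally show "fcoeff (\<lambda>z. (1/2) * (W z + cnj (W z))) n = fcoeff (\<lambda>z. complex_of_real (v z)) n"
        by (simp add: real_coeff_def)
    qed
    then show ?thesis unfolding ae_eq_circ_def
    proof eventually_elim
      case (elim t)
      then have "Re ((1/2) * (W (cis t) + cnj (W (cis t)))) = Re (complex_of_real (v (cis t)))" by simp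
      then show ?case by (simp add: complex_add_cnj)
    qed
  qed
  ultimately show ?thesis using that W(1) by blast
qed

end

section \<open>Hardy functions: cancellation by outer multipliers and zero sets\<close>

lemma H2_L2c: "f \<in> H2 \<Longrightarrow> f \<in> L2c"
  by (simp add: H2_def)

lemma H2_neg: "f \<in> H2 \<Longrightarrow> n < 0 \<Longrightarrow> fcoeff f n = 0"
  by (simp add: H2_def)

lemma H2I: "f \<in> L2c \<Longrightarrow> (\<And>n. n < 0 \<Longrightarrow> fcoeff f n = 0) \<Longrightarrow> f \<in> H2"
  by (simp add: H2_def)

text \<open>Multiplying by the outer functions \<open>exp (- W / k)\<close>, with \<open>Re W = sqrt \<bar>Y\<bar> + sqrt \<bar>Y'\<bar>\<close>, makes \<open>Y\<close> and \<open>Y'\<close>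
  bounded without creating nonnegative frequencies; the multipliers tend to 1 boundedly, and \<open>X\<close> is integrable.\<close>

lemma smirnov:
  assumes Y: "Y \<in> L1c" "\<And>n. n \<ge> 0 \<Longrightarrow> fcoeff Y n = 0"
    and Y': "Y' \<in> L1c" "\<And>n. n \<ge> 0 \<Longrightarrow> fcoeff Y' n = 0"
    and f: "f \<in> H2" and h: "h \<in> H2"
    and X: "X \<in> L1c" "ae_eq_circ X (\<lambda>z. Y z * cnj (f z) - Y' z * cnj (h z))"
    and n: "n \<ge> 0"
  shows "fcoeff X n = 0"
proof -
  define v where "v z = sqrt (cmod (Y z)) + sqrt (cmod (Y' z))" for z
  have sq: "(\<lambda>z. complex_of_real (sqrt (cmod (F z)))) \<in> L2c" if "F \<in> L1c" for F
  proof (rule L2cI)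
    have [measurable]: "(\<lambda>t. F (cis t)) \<in> borel_measurable circ" using L1c_meas_circ[OF that] by (simp add: meas_circ_def)
    show "meas_circ (\<lambda>z. complex_of_real (sqrt (cmod (F z))))" by (rule meas_circ_of_real) measurable
    show "integrable circ (\<lambda>t. (cmod (complex_of_real (sqrt (cmod (F (cis t))))))\<^sup>2)"
      using integrable_norm[OF L1cD[OF that]] by simp
  qed
  have v2: "(\<lambda>z. complex_of_real (v z)) \<in> L2c"
    using L2c_add[OF sq[OF Y(1)] sq[OF Y'(1)]] by (simp add: v_def)
  have v0: "0 \<le> v z" for z by (simp add: v_def)
  obtain W where W: "W \<in> L2c" "AE t in circ. Re (W (cis t)) = v (cis t)"
    and hbW: "\<And>e. e \<ge> 0 \<Longrightarrow> bounded_analytic (\<lambda>z. exp (- of_real e * W z)) (exp (- of_real e * real_coeff v 0))"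
    using analytic_completion[OF v2 v0] by blast
  define G where "G k z = exp (- of_real (1 / real (Suc k)) * W z)" for k z
  have G: "bounded_analytic (G k) (exp (- of_real (1 / real (Suc k)) * real_coeff v 0))" for k
    unfolding G_def by (rule hbW) simp
  have nG: "AE t in circ. cmod (G k (cis t)) = exp (- v (cis t) / real (Suc k))" for k
    using W(2) by eventually_elim (simp add: G_def norm_exp_eq_Re Re_divide_of_real del: of_nat_Suc)
  have bnd: "(\<lambda>z. F z * cnj (G k z)) \<in> L2c"
    if F: "F \<in> L1c" "\<And>z. sqrt (cmod (F z)) \<le> v z" for F k
  proof (rule L2c_bound)
    \<comment> \<open>The constant comes from \<open>x^2 \<le> 2 * exp x\<close> at
      \<open>x = v / Suc k\<close>: \<open>cmod F\<close> is at most \<open>v^2\<close>, and the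
      multiplier has modulus \<open>exp (- x)\<close>.\<close>
    show "(\<lambda>z. complex_of_real (2 * (real (Suc k))\<^sup>2)) \<in> L2c" by (rule L2c_const)
    show "meas_circ (\<lambda>z. F z * cnj (G k z))" by (intro meas_circ_mult meas_circ_cnj bounded_analytic_meas_circ[OF G] L1c_meas_circ[OF F(1)])
    show "AE t in circ. cmod (F (cis t) * cnj (G k (cis t))) \<le> cmod (complex_of_real (2 * (real (Suc k))\<^sup>2))"
      using nG[of k]
    proof eventually_elim
      case (elim t)
      define x where "x = v (cis t) / real (Suc k)"
      have x0: "x \<ge> 0" by (simp add: x_def v0)
      have "cmod (F (cis t)) = (sqrt (cmod (F (cis t))))\<^sup>2" by simp
      also have "\<dots> \<le> (v (cis t))\<^sup>2" by (intro power_mono F) simp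
      also have "\<dots> = x\<^sup>2 * (real (Suc k))\<^sup>2" by (simp add: x_def power_divide del: of_nat_Suc)
      also have "\<dots> \<le> (2 * exp x) * (real (Suc k))\<^sup>2"
        using exp_lower_Taylor_quadratic[OF x0] x0 by (intro mult_right_mono) auto
      finally have "cmod (F (cis t)) * exp (-x) \<le> (2 * exp x) * (real (Suc k))\<^sup>2 * exp (-x)"
        by (intro mult_right_mono) auto
      also have "\<dots> = 2 * (real (Suc k))\<^sup>2" by (simp add: exp_minus del: of_nat_Suc)
      finally have "cmod (F (cis t)) * exp (-x) \<le> 2 * (real (Suc k))\<^sup>2" .
      moreover have "\<bar>2 * (real (Suc k))\<^sup>2\<bar> = 2 * (real (Suc k))\<^sup>2" by simp
      ultimately show ?case
        unfolding norm_mult complex_mod_cnj elim norm_of_real x_def by (simp only: minus_divide_left)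
    qed
  qed
  have z: "fcoeff (\<lambda>z. F z * cnj (G k z) * cnj (g z)) n = 0"
    if F: "F \<in> L1c" "\<And>n. n \<ge> 0 \<Longrightarrow> fcoeff F n = 0" "\<And>z. sqrt (cmod (F z)) \<le> v z" and g: "g \<in> H2" for F g k
  proof (rule fcoeff_mult_zero[OF bnd[OF F(1,3)] L2c_cnj[OF H2_L2c[OF g]]])
    fix j
    show "fcoeff (\<lambda>z. F z * cnj (G k z)) j = 0 \<or> fcoeff (\<lambda>z. cnj (g z)) (n - j) = 0"
    proof (cases "j \<ge> 0")
      case True
      \<comment> \<open>Frequency 0 needs the second clause of \<open>bounded_analytic\<close>:
        there the coefficient is \<open>fcoeff F 0\<close> times a constant, hence zero.\<close>
      then show ?thesis using bounded_analytic_coeff[OF G F(1)] F(2) by (cases "j = 0") auto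
    next
      case False
      then show ?thesis using n g by (simp add: fcoeff_cnj H2_neg)
    qed
  qed
  have XG: "fcoeff (\<lambda>z. X z * cnj (G k z)) n = 0" for k
  proof -
    have L: "(\<lambda>z. Y z * cnj (G k z) * cnj (f z)) \<in> L1c" "(\<lambda>z. Y' z * cnj (G k z) * cnj (h z)) \<in> L1c"
      by (intro L2_mult_L1 bnd Y Y' L2c_cnj H2_L2c f h; simp add: v_def)+
    have "fcoeff (\<lambda>z. X z * cnj (G k z)) n
       = fcoeff (\<lambda>z. Y z * cnj (G k z) * cnj (f z) - Y' z * cnj (G k z) * cnj (h z)) n"
    proof (rule fcoeff_cong_AE)
      show "ae_eq_circ (\<lambda>z. X z * cnj (G k z)) (\<lambda>z. Y z * cnj (G k z) * cnj (f z) - Y' z * cnj (G k z) * cnj (h z))"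
        using X(2) unfolding ae_eq_circ_def
        by eventually_elim (simp only: left_diff_distrib mult.assoc mult.commute[of "cnj (G k _)"])
    qed (intro meas_circ_mult meas_circ_cnj bounded_analytic_meas_circ[OF G] L1c_meas_circ X L1c_diff L)+
    also have "\<dots> = 0"
      using z[OF Y _ f] z[OF Y' _ h] by (simp add: fcoeff_diff[OF L] v_def)
    finally show ?thesis .
  qed
  have "(\<lambda>k. fcoeff (\<lambda>z. X z * cnj (G k z)) n) \<longlonglongrightarrow> fcoeff X n"
    unfolding fcoeff_cint
  proof (rule cint_dominated[where w=X])
    show "meas_circ (\<lambda>z. z powi - n * (X z * cnj (G k z)))" for k
      by (intro meas_circ_mult meas_circ_powi meas_circ_cnj bounded_analytic_meas_circ[OF G] L1c_meas_circ X)
    show "meas_circ (\<lambda>z. z powi - n * X z)" by (intro meas_circ_mult meas_circ_powi L1c_meas_circ X)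
    show "AE t in circ. cmod (cis t powi - n * (X (cis t) * cnj (G k (cis t)))) \<le> cmod (X (cis t))" for k
      using nG[of k]
    proof eventually_elim
      case (elim t)
      have "cmod (G k (cis t)) \<le> 1" unfolding elim using v0 by (simp add: divide_le_0_iff)
      then show ?case unfolding norm_mult norm_cis_powi complex_mod_cnj by (simp add: mult_left_le)
    qed
    show "AE t in circ. (\<lambda>k. cis t powi - n * (X (cis t) * cnj (G k (cis t)))) \<longlonglongrightarrow> cis t powi - n * X (cis t)"
    proof (intro AE_I2)
      fix t
      have "(\<lambda>k. 1 / real (Suc k)) \<longlonglongrightarrow> 0" by (rule LIMSEQ_Suc) (rule lim_1_over_n)
      then have "(\<lambda>k. exp (- of_real (1 / real (Suc k)) * W (cis t))) \<longlonglongrightarrow> exp (- of_real 0 * W (cis t))"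
        by (intro tendsto_intros)
      then have "(\<lambda>k. G k (cis t)) \<longlonglongrightarrow> 1" unfolding G_def by simp
      then have "(\<lambda>k. cis t powi - n * (X (cis t) * cnj (G k (cis t)))) \<longlonglongrightarrow> cis t powi - n * (X (cis t) * cnj 1)"
        by (intro tendsto_intros)
      then show "(\<lambda>k. cis t powi - n * (X (cis t) * cnj (G k (cis t)))) \<longlonglongrightarrow> cis t powi - n * X (cis t)"
        by simp
    qed
  qed (rule X)
  then show ?thesis unfolding XG by (simp add: LIMSEQ_const_iff)
qed

lemma H2_powi_shift:
  assumes "f \<in> L2c" "\<And>n. n < m \<Longrightarrow> fcoeff f n = 0"
  shows "(\<lambda>z. z powi (-m) * f z) \<in> H2"
  using assms by (intro H2I L2c_powi_mult) (simp_all add: fcoeff_powi_mult)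

text \<open>If \<open>h\<close> vanished on a set of positive measure, the multipliers \<open>exp (- n W)\<close>, where \<open>Re W\<close> is the indicator of
  the set \<open>h \<noteq> 0\<close>, would shrink \<open>h\<close> by the factor \<open>exp (- n)\<close> while shrinking its leading coefficient
  strictly less.\<close>

theorem H2_zero_set:
  assumes h: "h \<in> H2" and nz: "\<not> ae_eq_circ h (\<lambda>_. 0)"
  shows "AE t in circ. h (cis t) \<noteq> 0"
proof (rule ccontr)
  assume pos: "\<not> ?thesis"
  obtain n1 where n1: "fcoeff h n1 \<noteq> 0" using fcoeff_unique_zero[OF L2_L1[OF H2_L2c[OF h]]] nz by blast
  then have n1p: "n1 \<ge> 0" using H2_neg[OF h] not_le by blast
  define N where "N = (LEAST n::nat. fcoeff h (int n) \<noteq> 0)"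
  have N: "fcoeff h (int N) \<noteq> 0" unfolding N_def by (rule LeastI[of _ "nat n1"]) (use n1 n1p in simp)
  have Nmin: "fcoeff h n = 0" if "n < int N" for n
  proof (cases "n < 0")
    case True then show ?thesis using H2_neg[OF h] by blast
  next
    case False
    then have "nat n < N" using that by auto
    then show ?thesis using not_less_Least[of "nat n" "\<lambda>n::nat. fcoeff h (int n) \<noteq> 0"] False unfolding N_def by auto
  qed
  \<comment> \<open>\<open>bounded_analytic\<close> tracks only the coefficient at 0, so the leading
    power of \<open>z\<close> is divided out first.\<close>
  define k where "k z = z powi (- int N) * h z" for z
  have k: "k \<in> H2" unfolding k_def[abs_def] using H2_powi_shift[OF H2_L2c[OF h] Nmin] .
  have k0: "fcoeff k 0 \<noteq> 0" unfolding k_def[abs_def] fcoeff_powi_mult using N by simp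
  have kL: "k \<in> L1c" by (rule L2_L1[OF H2_L2c[OF k]])
  define v :: "complex \<Rightarrow> real" where "v z = (if h z = 0 then 0 else 1)" for z
  have [measurable]: "(\<lambda>t. h (cis t)) \<in> borel_measurable circ" using L2c_meas_circ[OF H2_L2c[OF h]] by (simp add: meas_circ_def)
  have vm: "(\<lambda>t. v (cis t)) \<in> borel_measurable circ" unfolding v_def by measurable
  have v2: "(\<lambda>z. complex_of_real (v z)) \<in> L2c"
    by (rule L2c_bound[OF L2c_const[of 1] meas_circ_of_real[OF vm]]) (simp add: v_def)
  have v0: "0 \<le> v z" for z by (simp add: v_def)
  obtain W where W: "W \<in> L2c" "AE t in circ. Re (W (cis t)) = v (cis t)"
    and hbW: "\<And>e. e \<ge> 0 \<Longrightarrow> bounded_analytic (\<lambda>z. exp (- of_real e * W z)) (exp (- of_real e * real_coeff v 0))"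
    using analytic_completion[OF v2 v0] by blast
  \<comment> \<open>\<open>b\<close> is the normalised measure of the set where \<open>h\<close>
    does not vanish; it becomes the value of \<open>W\<close> at the origin.\<close>
  define b where "b = integral\<^sup>L circ (\<lambda>t. v (cis t)) / (2*pi)"
  have b: "real_coeff v 0 = of_real b"
    unfolding real_coeff_def[OF v2 v0] fcoeff_cint by (simp add: cint_def b_def)
  have vi: "integrable circ (\<lambda>t. v (cis t))"
    by (rule circ.integrable_const_bound[where B=1]) (use vm in \<open>auto simp: v_def\<close>)
  have b1: "b < 1"
  proof (rule ccontr)
    assume "\<not> b < 1"
    then have "2 * pi \<le> integral\<^sup>L circ (\<lambda>t. v (cis t))" by (simp add: b_def field_simps)
    moreover have "integral\<^sup>L circ (\<lambda>t. 1 - v (cis t)) = 2 * pi - integral\<^sup>L circ (\<lambda>t. v (cis t))"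
      using vi measure_circ by simp
    moreover have nn: "AE t in circ. 0 \<le> 1 - v (cis t)" by (simp add: v_def)
    moreover have "0 \<le> integral\<^sup>L circ (\<lambda>t. 1 - v (cis t))" using nn by (rule integral_nonneg_AE)
    ultimately have "integral\<^sup>L circ (\<lambda>t. 1 - v (cis t)) = 0" by linarith
    then have "AE t in circ. 1 - v (cis t) = 0"
      using vi nn by (subst (asm) integral_nonneg_eq_0_iff_AE) auto
    then have "AE t in circ. h (cis t) \<noteq> 0" by eventually_elim (auto simp: v_def split: if_splits)
    then show False using pos by simp
  qed
  define c where "c = integral\<^sup>L circ (\<lambda>t. cmod (k (cis t))) / (2*pi)"
  \<comment> \<open>Tested against \<open>cnj k\<close>, which has no positive frequencies, the
    multiplier scales the coefficient at 0 by \<open>exp (- n * b)\<close>. Pointwise it scales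
    \<open>cmod k\<close> by \<open>exp (- n)\<close>, trivially so where \<open>k\<close> vanishes.
    With \<open>b < 1\<close> the left side is unbounded in \<open>n\<close>.\<close>
  have key: "cmod (fcoeff k 0) * exp (real n * (1 - b)) \<le> c" for n :: nat
  proof -
    let ?G = "\<lambda>z. exp (- of_real (real n) * W z)"
    have kc: "(\<lambda>z. cnj (k z)) \<in> L1c" by (rule L1c_cnj[OF kL])
    have "fcoeff (\<lambda>z. cnj (k z) * cnj (?G z)) 0 = fcoeff (\<lambda>z. cnj (k z)) 0 * cnj (exp (- of_real (real n) * real_coeff v 0))"
      by (rule bounded_analytic_coeff(2)[OF hbW kc]) (auto simp: fcoeff_cnj H2_neg[OF k])
    then have "cmod (fcoeff (\<lambda>z. cnj (k z) * cnj (?G z)) 0) = cmod (fcoeff k 0) * exp (- real n * b)"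
      by (simp add: fcoeff_cnj norm_mult norm_exp_eq_Re b)
    moreover have "cmod (fcoeff (\<lambda>z. cnj (k z) * cnj (?G z)) 0)
        \<le> integral\<^sup>L circ (\<lambda>t. cmod (cnj (k (cis t)) * cnj (?G (cis t)))) / (2*pi)"
      using norm_cint_le[of "\<lambda>z. cnj (k z) * cnj (?G z)"] by (simp add: fcoeff_cint)
    moreover have "integral\<^sup>L circ (\<lambda>t. cmod (cnj (k (cis t)) * cnj (?G (cis t))))
        = integral\<^sup>L circ (\<lambda>t. cmod (k (cis t)) * exp (- real n))"
    proof (rule integral_cong_AE)
      show "AE t in circ. cmod (cnj (k (cis t)) * cnj (?G (cis t))) = cmod (k (cis t)) * exp (- real n)"
        using W(2) by eventually_elim (auto simp: norm_mult norm_exp_eq_Re norm_power_int v_def k_def)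
      show "(\<lambda>t. cmod (cnj (k (cis t)) * cnj (?G (cis t)))) \<in> borel_measurable circ"
        using meas_circ_mult[OF meas_circ_cnj[OF L1c_meas_circ[OF kL]] meas_circ_cnj[OF bounded_analytic_meas_circ[OF hbW[of "real n"]]]] unfolding meas_circ_def by simp
      show "(\<lambda>t. cmod (k (cis t)) * exp (- real n)) \<in> borel_measurable circ"
        using L1c_meas_circ[OF kL] unfolding meas_circ_def by simp
    qed
    ultimately have "cmod (fcoeff k 0) * exp (- real n * b) \<le> c * exp (- real n)"
      by (simp add: c_def)
    then have "cmod (fcoeff k 0) * exp (- real n * b) * exp (real n) \<le> c * exp (- real n) * exp (real n)"
      by (intro mult_right_mono) auto
    moreover have "exp (real n * (1 - b)) = exp (- real n * b) * exp (real n)"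
      unfolding exp_add[symmetric] by (simp add: algebra_simps)
    moreover have "exp (- real n) * exp (real n) = 1" unfolding exp_add[symmetric] by simp
    ultimately show ?thesis by (simp only: mult.assoc mult_1_right)
  qed
  have "filterlim (\<lambda>n. real n * (1 - b)) at_top sequentially"
    using b1 by (intro filterlim_at_top_mult_tendsto_pos[OF tendsto_const _ filterlim_real_sequentially]) simp
  then have "filterlim (\<lambda>n. exp (real n * (1 - b))) at_top sequentially"
    by (rule filterlim_compose[OF exp_at_top])
  then have "\<forall>\<^sub>F n in sequentially. c / cmod (fcoeff k 0) + 1 \<le> exp (real n * (1 - b))"
    unfolding filterlim_at_top by blast
  then obtain n where n: "c / cmod (fcoeff k 0) + 1 \<le> exp (real n * (1 - b))"
    using eventually_happens'[OF sequentially_bot] by blast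
  have "cmod (fcoeff k 0) * (c / cmod (fcoeff k 0) + 1) \<le> cmod (fcoeff k 0) * exp (real n * (1 - b))"
    by (intro mult_left_mono n) simp
  also have "\<dots> \<le> c" by (rule key)
  finally show False using k0 by (simp add: distrib_left)
qed

lemma ae_eq_circ_sym: "ae_eq_circ f g \<Longrightarrow> ae_eq_circ g f"
  by (simp add: ae_eq_circ_def eq_commute)

lemma L2c_cong_AE: "f \<in> L2c \<Longrightarrow> meas_circ g \<Longrightarrow> ae_eq_circ f g \<Longrightarrow> g \<in> L2c"
  by (rule L2c_bound) (auto simp: ae_eq_circ_def elim: eventually_mono)

lemma H2_cong_AE:
  assumes "f \<in> H2" "meas_circ g" "ae_eq_circ f g" shows "g \<in> H2"
proof (rule H2I)
  show "g \<in> L2c" using L2c_cong_AE[OF H2_L2c[OF assms(1)] assms(2,3)] .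
  show "n < 0 \<Longrightarrow> fcoeff g n = 0" for n
    using fcoeff_cong_AE[OF L2c_meas_circ[OF H2_L2c[OF assms(1)]] assms(2,3), of n] H2_neg[OF assms(1)] by simp
qed

lemma H2_add: "f \<in> H2 \<Longrightarrow> g \<in> H2 \<Longrightarrow> (\<lambda>z. f z + g z) \<in> H2"
  by (intro H2I L2c_add) (auto simp: H2_L2c H2_neg fcoeff_add L2_L1)

lemma H2_diff: "f \<in> H2 \<Longrightarrow> g \<in> H2 \<Longrightarrow> (\<lambda>z. f z - g z) \<in> H2"
  by (intro H2I L2c_diff) (auto simp: H2_L2c H2_neg fcoeff_diff L2_L1)

lemma H2_scale: "f \<in> H2 \<Longrightarrow> (\<lambda>z. c * f z) \<in> H2"
  by (intro H2I L2c_scale) (auto simp: H2_L2c H2_neg fcoeff_scale)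

subsection \<open>Schmidt pairs\<close>

text \<open>The equations \<open>H f = s g\<close> and \<open>H g = s f\<close> in terms of
  coefficients. Splitting \<open>H^2 f = s^2 f\<close> in this way makes the condition symmetric in
  \<open>f\<close> and \<open>g\<close>, so that the partner of \<open>f\<close> belongs to the same
  eigenspace.\<close>

definition schmidt_pair :: "(complex \<Rightarrow> complex) \<Rightarrow> real \<Rightarrow> (complex \<Rightarrow> complex) \<Rightarrow> (complex \<Rightarrow> complex) \<Rightarrow> bool" where
  "schmidt_pair u s f g \<longleftrightarrow> f \<in> H2 \<and> g \<in> H2 \<and>
     (\<forall>n\<ge>0. of_real s * fcoeff g n = fcoeff (\<lambda>z. u z * cnj (f z)) n) \<and>
     (\<forall>n\<ge>0. of_real s * fcoeff f n = fcoeff (\<lambda>z. u z * cnj (g z)) n)"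

lemma schmidt_pair_sym: "schmidt_pair u s f g \<Longrightarrow> schmidt_pair u s g f"
  by (auto simp: schmidt_pair_def)

lemma fcoeff_scale_cnj: "fcoeff (\<lambda>z. u z * cnj (c * f z)) n = cnj c * fcoeff (\<lambda>z. u z * cnj (f z)) n"
  unfolding fcoeff_scale[symmetric] by (rule fcoeff_cong) simp

lemma schmidt_pair_hankel:
  assumes "schmidt_pair u s f g"
  shows "hankel u f (\<lambda>z. of_real s * g z)"
  using assms unfolding schmidt_pair_def hankel_def by (simp add: fcoeff_scale H2_scale)

lemma EH_iff_schmidt_pair:
  assumes "s > 0"
  shows "f \<in> EH u s \<longleftrightarrow> (\<exists>g. schmidt_pair u s f g)"
proof
  assume "f \<in> EH u s"
  then obtain g where f: "f \<in> H2" and g: "hankel u f g" "hankel u g (\<lambda>z. of_real (s\<^sup>2) * f z)"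
    by (auto simp: EH_def)
  have "schmidt_pair u s f (\<lambda>z. of_real (1/s) * g z)"
    unfolding schmidt_pair_def
  proof (intro conjI allI impI)
    show "(\<lambda>z. of_real (1/s) * g z) \<in> H2" using g by (simp only: hankel_def H2_scale)
    fix n :: int assume n: "n \<ge> 0"
    show "of_real s * fcoeff (\<lambda>z. of_real (1/s) * g z) n = fcoeff (\<lambda>z. u z * cnj (f z)) n"
      using g(1) n assms unfolding fcoeff_scale by (simp add: hankel_def)
    have "of_real (s\<^sup>2) * fcoeff f n = fcoeff (\<lambda>z. u z * cnj (g z)) n"
      using g(2) n by (simp add: hankel_def fcoeff_scale del: of_real_power)
    then have "fcoeff (\<lambda>z. u z * cnj (of_real (1/s) * g z)) n = of_real (1/s) * (of_real (s\<^sup>2) * fcoeff f n)"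
      unfolding fcoeff_scale_cnj by simp
    also have "\<dots> = of_real s * fcoeff f n" using assms by (simp add: power2_eq_square)
    finally show "of_real s * fcoeff f n = fcoeff (\<lambda>z. u z * cnj (of_real (1/s) * g z)) n" ..
  qed (rule f)
  then show "\<exists>g. schmidt_pair u s f g" by blast
next
  assume "\<exists>g. schmidt_pair u s f g"
  then obtain g where g: "schmidt_pair u s f g" by blast
  have "hankel u (\<lambda>z. of_real s * g z) (\<lambda>z. of_real (s\<^sup>2) * f z)"
    unfolding hankel_def
  proof (intro conjI allI impI)
    show "(\<lambda>z. of_real (s\<^sup>2) * f z) \<in> H2" using g by (simp only: schmidt_pair_def H2_scale)
    fix n :: int assume "n \<ge> 0"
    then have "fcoeff (\<lambda>z. u z * cnj (g z)) n = of_real s * fcoeff f n"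
      using g by (simp add: schmidt_pair_def)
    then show "fcoeff (\<lambda>z. of_real (s\<^sup>2) * f z) n = fcoeff (\<lambda>z. u z * cnj (of_real s * g z)) n"
      unfolding fcoeff_scale_cnj fcoeff_scale by (simp add: power2_eq_square)
  qed
  then show "f \<in> EH u s" using schmidt_pair_hankel[OF g] g by (auto simp: EH_def schmidt_pair_def)
qed

text \<open>Functions are not identified almost everywhere, so exchanging a partner for the formula
  \<open>\<phi> * cnj f\<close>, which agrees with it only up to a null set, rests on this
  transfer.\<close>

lemma schmidt_pair_cong_AE:
  assumes "u \<in> L2c" "schmidt_pair u s f g" "meas_circ f'" "meas_circ g'" "ae_eq_circ f f'" "ae_eq_circ g g'"
  shows "schmidt_pair u s f' g'"
proof -
  have fg: "f \<in> H2" "g \<in> H2" using assms(2) by (auto simp: schmidt_pair_def)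
  have c: "fcoeff h n = fcoeff h' n" "fcoeff (\<lambda>z. u z * cnj (h z)) n = fcoeff (\<lambda>z. u z * cnj (h' z)) n"
    if h: "h \<in> H2" "meas_circ h'" "ae_eq_circ h h'" for h h' n
  proof -
    have m: "meas_circ h" by (rule L2c_meas_circ[OF H2_L2c[OF h(1)]])
    show "fcoeff h n = fcoeff h' n" by (rule fcoeff_cong_AE[OF m h(2,3)])
    have "ae_eq_circ (\<lambda>z. u z * cnj (h z)) (\<lambda>z. u z * cnj (h' z))"
      using h(3) unfolding ae_eq_circ_def by eventually_elim simp
    then show "fcoeff (\<lambda>z. u z * cnj (h z)) n = fcoeff (\<lambda>z. u z * cnj (h' z)) n"
      by (intro fcoeff_cong_AE meas_circ_mult meas_circ_cnj m h(2) L2c_meas_circ[OF assms(1)])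
  qed
  show ?thesis using assms(2) c[OF fg(1) assms(3,5)] c[OF fg(2) assms(4,6)]
      H2_cong_AE[OF fg(1) assms(3,5)] H2_cong_AE[OF fg(2) assms(4,6)]
    unfolding schmidt_pair_def by simp
qed

lemma schmidt_pair_remainder:
  assumes "u \<in> L2c" "schmidt_pair u s f g"
  shows "(\<lambda>z. of_real s * g z - u z * cnj (f z)) \<in> L1c"
    and "n \<ge> 0 \<Longrightarrow> fcoeff (\<lambda>z. of_real s * g z - u z * cnj (f z)) n = 0"
proof -
  have fg: "f \<in> L2c" "g \<in> L2c" using assms(2) by (auto simp: schmidt_pair_def H2_L2c)
  have L: "(\<lambda>z. of_real s * g z) \<in> L1c" "(\<lambda>z. u z * cnj (f z)) \<in> L1c"
    by (intro L1c_scale L2_L1 L2_mult_L1 L2c_cnj assms fg)+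
  show "(\<lambda>z. of_real s * g z - u z * cnj (f z)) \<in> L1c" by (rule L1c_diff[OF L])
  show "n \<ge> 0 \<Longrightarrow> fcoeff (\<lambda>z. of_real s * g z - u z * cnj (f z)) n = 0"
    using assms(2) by (simp add: fcoeff_diff[OF L] fcoeff_scale schmidt_pair_def)
qed

lemma schmidt_pair_cross_coeff:
  assumes u: "u \<in> L2c" and s: "s > 0" and 1: "schmidt_pair u s f g" and 2: "schmidt_pair u s f' g'" and n: "n \<ge> 0"
  shows "fcoeff (\<lambda>z. g z * cnj (f' z)) n = fcoeff (\<lambda>z. g' z * cnj (f z)) n"
proof -
  have H: "f \<in> H2" "g \<in> H2" "f' \<in> H2" "g' \<in> H2" using 1 2 by (auto simp: schmidt_pair_def)
  have L: "(\<lambda>z. g z * cnj (f' z)) \<in> L1c" "(\<lambda>z. g' z * cnj (f z)) \<in> L1c"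
    by (intro L2_mult_L1 L2c_cnj H2_L2c H)+
  have "fcoeff (\<lambda>z. of_real s * (g z * cnj (f' z) - g' z * cnj (f z))) n = 0"
  proof (rule smirnov[OF schmidt_pair_remainder[OF u 1] schmidt_pair_remainder[OF u 2] H(3,1)])
    show "(\<lambda>z. of_real s * (g z * cnj (f' z) - g' z * cnj (f z))) \<in> L1c" by (intro L1c_scale L1c_diff L)
    show "ae_eq_circ (\<lambda>z. of_real s * (g z * cnj (f' z) - g' z * cnj (f z)))
      (\<lambda>z. (of_real s * g z - u z * cnj (f z)) * cnj (f' z) - (of_real s * g' z - u z * cnj (f' z)) * cnj (f z))"
      unfolding ae_eq_circ_def by (intro AE_I2) (simp add: algebra_simps)
  qed (use n in auto)
  then show ?thesis using s by (simp add: fcoeff_scale fcoeff_diff[OF L])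
qed

text \<open>Swapping both pairs conjugates the two products, so the result for nonnegative
  frequencies covers the negative ones as well.\<close>

lemma schmidt_pair_cross:
  assumes u: "u \<in> L2c" and s: "s > 0" and 1: "schmidt_pair u s f g" and 2: "schmidt_pair u s f' g'"
  shows "ae_eq_circ (\<lambda>z. g z * cnj (f' z)) (\<lambda>z. g' z * cnj (f z))"
proof (rule fcoeff_unique)
  have H: "f \<in> H2" "g \<in> H2" "f' \<in> H2" "g' \<in> H2" using 1 2 by (auto simp: schmidt_pair_def)
  show L: "(\<lambda>z. g z * cnj (f' z)) \<in> L1c" "(\<lambda>z. g' z * cnj (f z)) \<in> L1c"
    by (intro L2_mult_L1 L2c_cnj H2_L2c H)+
  fix n :: int
  show "fcoeff (\<lambda>z. g z * cnj (f' z)) n = fcoeff (\<lambda>z. g' z * cnj (f z)) n"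
  proof (cases "n \<ge> 0")
    case True then show ?thesis by (rule schmidt_pair_cross_coeff[OF u s 1 2])
  next
    case False
    then have "fcoeff (\<lambda>z. f z * cnj (g' z)) (-n) = fcoeff (\<lambda>z. f' z * cnj (g z)) (-n)"
      by (intro schmidt_pair_cross_coeff[OF u s schmidt_pair_sym[OF 1] schmidt_pair_sym[OF 2]]) simp
    then have "cnj (fcoeff (\<lambda>z. f z * cnj (g' z)) (-n)) = cnj (fcoeff (\<lambda>z. f' z * cnj (g z)) (-n))" by simp
    then show ?thesis unfolding fcoeff_cnj[symmetric] by (simp add: mult.commute)
  qed
qed

text \<open>One nonzero element \<open>f0\<close>, which is nonzero almost everywhere, fixes
  \<open>\<phi>\<close> as the quotient of its partner by \<open>cnj f0\<close>. The cross relation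
  of this pair with its own swap gives \<open>cmod g0 = cmod f0\<close>; with any other pair it
  determines the partner.\<close>

lemma schmidt_unimodular:
  assumes u: "u \<in> L2c" and s: "s > 0" and f0: "f0 \<in> EH u s" "\<not> ae_eq_circ f0 (\<lambda>_. 0)"
  obtains \<phi> where "meas_circ \<phi>" "\<And>z. cmod (\<phi> z) = 1"
    "\<And>f. f \<in> EH u s \<Longrightarrow> schmidt_pair u s f (\<lambda>z. \<phi> z * cnj (f z))"
proof -
  obtain g0 where p0: "schmidt_pair u s f0 g0" using f0(1) EH_iff_schmidt_pair[OF s] by blast
  define \<psi> where "\<psi> z = g0 z / cnj (f0 z)" for z
  \<comment> \<open>The exceptional set is null; the default 1 there makes \<open>\<phi>\<close>
    unimodular at every point.\<close>
  define \<phi> where "\<phi> z = (if cmod (\<psi> z) = 1 then \<psi> z else 1)" for z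
  have H: "f0 \<in> H2" "g0 \<in> H2" using p0 by (auto simp: schmidt_pair_def)
  have [measurable]: "(\<lambda>t. g0 (cis t)) \<in> borel_measurable circ" "(\<lambda>t. cnj (f0 (cis t))) \<in> borel_measurable circ"
    using L2c_meas_circ[OF H2_L2c[OF H(2)]] meas_circ_cnj[OF L2c_meas_circ[OF H2_L2c[OF H(1)]]] by (simp_all add: meas_circ_def)
  have "meas_circ \<psi>" unfolding meas_circ_def \<psi>_def by measurable
  then have [measurable]: "(\<lambda>t. \<psi> (cis t)) \<in> borel_measurable circ" by (simp add: meas_circ_def)
  have \<phi>m: "meas_circ \<phi>" unfolding meas_circ_def \<phi>_def by measurable
  have \<phi>1: "cmod (\<phi> z) = 1" for z by (simp add: \<phi>_def)
  have "schmidt_pair u s f (\<lambda>z. \<phi> z * cnj (f z))" if f: "f \<in> EH u s" for f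
  proof -
    obtain g where g: "schmidt_pair u s f g" using f EH_iff_schmidt_pair[OF s] by blast
    have fm: "meas_circ f" using g by (auto simp: schmidt_pair_def intro!: L2c_meas_circ H2_L2c)
    have "ae_eq_circ g (\<lambda>z. \<phi> z * cnj (f z))"
      using schmidt_pair_cross[OF u s g p0] schmidt_pair_cross[OF u s p0 schmidt_pair_sym[OF p0]] H2_zero_set[OF H(1) f0(2)]
      unfolding ae_eq_circ_def
    proof eventually_elim
      case (elim t)
      have "complex_of_real ((cmod (g0 (cis t)))\<^sup>2) = complex_of_real ((cmod (f0 (cis t)))\<^sup>2)"
        unfolding complex_norm_square by (rule elim(2))
      then have "(cmod (g0 (cis t)))\<^sup>2 = (cmod (f0 (cis t)))\<^sup>2" unfolding of_real_eq_iff .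
      then have "cmod (g0 (cis t)) = cmod (f0 (cis t))" by simp
      then have "cmod (\<psi> (cis t)) = 1" using elim(3) by (simp add: \<psi>_def norm_divide)
      then have "\<phi> (cis t) = g0 (cis t) / cnj (f0 (cis t))" by (simp add: \<phi>_def \<psi>_def)
      then have "g (cis t) * cnj (f0 (cis t)) = (\<phi> (cis t) * cnj (f (cis t))) * cnj (f0 (cis t))"
        using elim(1,3) by simp
      then show ?case using elim(3) unfolding mult_cancel_right by simp
    qed
    then show ?thesis
      by (intro schmidt_pair_cong_AE[OF u g fm]) (auto simp: ae_eq_circ_def intro!: meas_circ_mult meas_circ_cnj \<phi>m fm)
  qed
  then show ?thesis using that \<phi>m \<phi>1 by blast
qed

section \<open>The Schmidt space with its involution\<close>

locale schmidt_space =
  fixes u \<phi> :: "complex \<Rightarrow> complex" and s :: real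
  assumes u: "u \<in> L2c" and s: "s > 0" and \<phi>m: "meas_circ \<phi>" and \<phi>1: "\<And>z. cmod (\<phi> z) = 1"
begin

text \<open>As \<open>\<phi>\<close> is unimodular at every point, \<open>J\<close> is an involution
  of functions and not merely of classes, and it preserves moduli pointwise.\<close>

definition J :: "(complex \<Rightarrow> complex) \<Rightarrow> complex \<Rightarrow> complex" where
  "J f z = \<phi> z * cnj (f z)"

text \<open>With the partner prescribed as \<open>J f\<close>, membership involves no existential
  quantifier. For the \<open>\<phi>\<close> of \<open>schmidt_unimodular\<close> this set is
  \<open>EH u s\<close>.\<close>

definition E :: "(complex \<Rightarrow> complex) set" where
  "E = {f. schmidt_pair u s f (J f)}"

lemma \<phi>_cnj: "\<phi> z * cnj (\<phi> z) = 1"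
  using complex_norm_square[of "\<phi> z"] \<phi>1[of z] by simp

lemma JJ: "J (J f) = f"
proof
  fix z
  have "J (J f) z = (\<phi> z * cnj (\<phi> z)) * f z" by (simp add: J_def)
  then show "J (J f) z = f z" by (simp only: \<phi>_cnj mult_1)
qed

lemma norm_J: "cmod (J f z) = cmod (f z)"
  by (simp add: J_def norm_mult \<phi>1)

lemma E_pair: "f \<in> E \<Longrightarrow> schmidt_pair u s f (J f)"
  by (simp add: E_def)

lemma E_J: "f \<in> E \<Longrightarrow> J f \<in> E"
  using schmidt_pair_sym[of u s f "J f"] by (simp add: E_def JJ)

lemma E_H2: "f \<in> E \<Longrightarrow> f \<in> H2"
  by (simp add: E_def schmidt_pair_def)

lemma E_L2c: "f \<in> E \<Longrightarrow> f \<in> L2c"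
  by (intro H2_L2c E_H2)

lemma J_meas_circ: "meas_circ f \<Longrightarrow> meas_circ (J f)"
  unfolding J_def[abs_def] by (intro meas_circ_mult meas_circ_cnj \<phi>m)

lemma J_L2c: "f \<in> L2c \<Longrightarrow> J f \<in> L2c"
  by (rule L2c_bound[of f]) (auto simp: norm_J intro: J_meas_circ L2c_meas_circ)

lemma E_cong_AE: "f \<in> E \<Longrightarrow> meas_circ g \<Longrightarrow> ae_eq_circ f g \<Longrightarrow> g \<in> E"
  unfolding E_def mem_Collect_eq
  by (rule schmidt_pair_cong_AE[OF u, of s f "J f"])
    (auto simp: ae_eq_circ_def J_def intro!: J_meas_circ elim: eventually_mono)

lemma fcoeff_u_cnj_add:
  "f \<in> L2c \<Longrightarrow> g \<in> L2c \<Longrightarrow>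
    fcoeff (\<lambda>z. u z * cnj (f z + g z)) n = fcoeff (\<lambda>z. u z * cnj (f z)) n + fcoeff (\<lambda>z. u z * cnj (g z)) n"
  using fcoeff_add[OF L2_mult_L1[OF u L2c_cnj] L2_mult_L1[OF u L2c_cnj], of f g n]
  by (simp add: algebra_simps)

lemma E_add:
  assumes "f \<in> E" "g \<in> E" shows "(\<lambda>z. f z + g z) \<in> E"
proof -
  have e: "J (\<lambda>z. f z + g z) = (\<lambda>z. J f z + J g z)" by (simp add: J_def fun_eq_iff algebra_simps)
  have L: "f \<in> L2c" "g \<in> L2c" "J f \<in> L2c" "J g \<in> L2c" using assms by (auto intro: E_L2c E_J)
  show ?thesis
    using E_pair[OF assms(1)] E_pair[OF assms(2)] L
    unfolding E_def schmidt_pair_def mem_Collect_eq e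
    by (simp add: H2_add fcoeff_add L2_L1 fcoeff_u_cnj_add distrib_left del: complex_cnj_add)
qed

lemma E_scale:
  assumes "f \<in> E" shows "(\<lambda>z. c * f z) \<in> E"
proof -
  have e: "J (\<lambda>z. c * f z) = (\<lambda>z. cnj c * J f z)" by (simp add: J_def fun_eq_iff algebra_simps)
  show ?thesis
    using E_pair[OF assms]
    unfolding E_def schmidt_pair_def mem_Collect_eq e fcoeff_scale_cnj fcoeff_scale
    by (simp add: H2_scale mult.left_commute)
qed

lemma E_diff: "f \<in> E \<Longrightarrow> g \<in> E \<Longrightarrow> (\<lambda>z. f z - g z) \<in> E"
  using E_add[of f "\<lambda>z. (-1) * g z"] E_scale[of g "-1"] by simp

lemma l2conv_cnj: "l2conv F f \<Longrightarrow> l2conv (\<lambda>k z. cnj (F k z)) (\<lambda>z. cnj (f z))"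
proof -
  have "l2norm (\<lambda>z. cnj (F k z) - cnj (f z)) = l2norm (\<lambda>z. F k z - f z)" for k
    by (rule l2norm_cong) (metis complex_cnj_diff complex_mod_cnj)
  then show "l2conv F f \<Longrightarrow> ?thesis" by (simp add: l2conv_def)
qed

text \<open>\<open>J\<close> preserves distances, so the partners converge along with the functions.
  At a fixed frequency each side of the defining equations is continuous in square mean, the
  products with \<open>u\<close> because \<open>u\<close> is square integrable.\<close>

lemma E_closed:
  assumes F: "\<And>k. F k \<in> E" and f: "f \<in> L2c" and conv: "l2conv F f"
  shows "f \<in> E"
proof -
  have F2: "F k \<in> L2c" for k by (rule E_L2c[OF F])
  have JF: "J (F k) \<in> L2c" for k by (rule J_L2c[OF F2])
  have Jconv: "l2conv (\<lambda>k. J (F k)) (J f)"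
  proof -
    have "cmod (J (F k) z - J f z) = cmod (F k z - f z)" for k z
    proof -
      have "J (F k) z - J f z = \<phi> z * cnj (F k z - f z)" by (simp add: J_def algebra_simps)
      then show ?thesis by (simp only: norm_mult \<phi>1 complex_mod_cnj mult_1)
    qed
    then have "l2norm (\<lambda>z. J (F k) z - J f z) = l2norm (\<lambda>z. F k z - f z)" for k by (intro l2norm_cong) blast
    then show ?thesis using conv by (simp add: l2conv_def)
  qed
  have ucnj: "(\<lambda>k. fcoeff (\<lambda>z. u z * cnj (G k z)) n) \<longlonglongrightarrow> fcoeff (\<lambda>z. u z * cnj (g z)) n"
    if "\<And>k. G k \<in> L2c" "g \<in> L2c" "l2conv G g" for G g n
    using l2conv_cint[OF L2c_cnj L2c_cnj L2c_powi_mult[OF u] l2conv_cnj[OF that(3)], of "-n"] that(1,2)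
    unfolding fcoeff_cint by (simp add: mult_ac)
  have z: "fcoeff g n = 0" if G: "\<And>k. G k \<in> H2" "g \<in> L2c" "l2conv G g" "n < 0" for G g n
    using l2conv_fcoeff[OF H2_L2c[OF G(1)] G(2,3), of n] H2_neg[OF G(1) G(4)] by (simp add: LIMSEQ_const_iff)
  have eq: "of_real s * fcoeff (J g) n = fcoeff (\<lambda>z. u z * cnj (g z)) n"
    if G: "\<And>k. G k \<in> E" "g \<in> L2c" "l2conv G g" "l2conv (\<lambda>k. J (G k)) (J g)" "n \<ge> 0" for G g n
  proof -
    have "of_real s * fcoeff (J (G k)) n = fcoeff (\<lambda>z. u z * cnj (G k z)) n" for k
      using E_pair[OF G(1)] G(5) by (simp add: schmidt_pair_def)
    then have "(\<lambda>k. of_real s * fcoeff (J (G k)) n) \<longlonglongrightarrow> fcoeff (\<lambda>z. u z * cnj (g z)) n"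
      using ucnj[OF E_L2c[OF G(1)] G(2,3)] by simp
    moreover have "(\<lambda>k. of_real s * fcoeff (J (G k)) n) \<longlonglongrightarrow> of_real s * fcoeff (J g) n"
      by (intro tendsto_mult tendsto_const l2conv_fcoeff J_L2c E_L2c G)
    ultimately show ?thesis using LIMSEQ_unique by blast
  qed
  have "f \<in> H2" by (rule H2I[OF f z[OF E_H2[OF F] f conv]])
  moreover have "J f \<in> H2" by (rule H2I[OF J_L2c[OF f] z[OF E_H2[OF E_J[OF F]] J_L2c[OF f] Jconv]])
  moreover have "\<forall>n\<ge>0. of_real s * fcoeff (J f) n = fcoeff (\<lambda>z. u z * cnj (f z)) n"
    using eq[OF F f conv Jconv] by blast
  moreover have "\<forall>n\<ge>0. of_real s * fcoeff f n = fcoeff (\<lambda>z. u z * cnj (J f z)) n"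
    using eq[OF E_J[OF F] J_L2c[OF f] Jconv] conv by (simp add: JJ)
  ultimately show ?thesis by (simp add: E_def schmidt_pair_def)
qed

text \<open>The only frequency that could fail is \<open>c\<close>, the coefficient of \<open>u * cnj f\<close> at \<open>-1\<close>. Dividing the cross relation
  between \<open>e\<close> and \<open>f\<close> by the powers of \<open>z\<close> that \<open>e\<close> and \<open>f\<close> contain shows \<open>c * cnj (e1 0) = 0\<close>, where
  \<open>e1 0 \<noteq> 0\<close> by the choice of \<open>N\<close>.\<close>

lemma near_invariance:
  assumes van: "\<And>f n. f \<in> E \<Longrightarrow> n < N \<Longrightarrow> fcoeff f n = 0"
    and e: "e \<in> E" "fcoeff e N \<noteq> 0" and f: "f \<in> E" "fcoeff f N = 0"
  shows "(\<lambda>z. cnj z * f z) \<in> E"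
proof -
  define Y where "Y g = (\<lambda>z. of_real s * J g z - u z * cnj (g z))" for g
  have Y: "Y g \<in> L1c" "n \<ge> 0 \<Longrightarrow> fcoeff (Y g) n = 0" if "g \<in> E" for g n
    unfolding Y_def using schmidt_pair_remainder[OF u E_pair[OF that]] by blast+
  define e1 where "e1 z = z powi (-N) * e z" for z
  define k where "k z = z powi (-(N+1)) * f z" for z
  define c where "c = fcoeff (Y f) (-1)"
  have e1: "e1 \<in> H2" unfolding e1_def[abs_def] by (rule H2_powi_shift[OF E_L2c[OF e(1)] van[OF e(1)]])
  have "fcoeff f n = 0" if "n < N + 1" for n
    using van[OF f(1), of n] f(2) that by (cases "n = N") auto
  then have k: "k \<in> H2" unfolding k_def[abs_def] by (rule H2_powi_shift[OF E_L2c[OF f(1)]])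
  have N0: "N \<ge> 0" using H2_neg[OF E_H2[OF e(1)], of N] e(2) by force
  have zY: "(\<lambda>z. z * Y f z) \<in> L1c" by (rule L1c_mult_id[OF Y(1)[OF f(1)]])
  have X0: "fcoeff (\<lambda>z. (- c) * cnj (e1 z)) 0 = 0"
  \<comment> \<open>Multiplication by \<open>z\<close> lifts frequency -1 of \<open>Y f\<close> to
    0; subtracting the constant \<open>c\<close> leaves only negative frequencies.\<close>
  proof (rule smirnov[where Y="\<lambda>z. z * Y f z - c" and Y'="Y e" and f=e1 and h=k])
    show "(\<lambda>z. z * Y f z - c) \<in> L1c" by (intro L1c_diff zY L1c_const)
    show "fcoeff (\<lambda>z. z * Y f z - c) n = 0" if "n \<ge> 0" for n
      using that Y(2)[OF f(1), of "n - 1"]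
      by (cases "n = 0") (simp_all add: fcoeff_diff[OF zY L1c_const] fcoeff_mult_id fcoeff_const c_def)
    show "(\<lambda>z. (- c) * cnj (e1 z)) \<in> L1c" by (intro L1c_scale L1c_cnj L2_L1 H2_L2c e1)
    show "ae_eq_circ (\<lambda>z. (- c) * cnj (e1 z)) (\<lambda>z. (z * Y f z - c) * cnj (e1 z) - Y e z * cnj (k z))"
      unfolding ae_eq_circ_def
    proof (intro AE_I2)
      fix t
      let ?z = "cis t"
      \<comment> \<open>Both sides are \<open>(s * \<phi> - u) * cnj e * cnj f\<close>, so the cross
        relation holds at every point.\<close>
      have cr: "Y f ?z * cnj (e ?z) = Y e ?z * cnj (f ?z)"
        by (simp add: Y_def J_def algebra_simps)
      have "?z * Y f ?z * cnj (e1 ?z) = ?z powi (1 + N) * (Y f ?z * cnj (e ?z))"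
        unfolding e1_def complex_cnj_mult cnj_cis_powi minus_minus
        using cis_powi_add[of t 1 N] by (simp add: mult_ac)
      also have "\<dots> = Y e ?z * cnj (k ?z)"
        unfolding k_def complex_cnj_mult cnj_cis_powi minus_minus cr by (simp add: mult_ac add.commute)
      finally show "(- c) * cnj (e1 ?z) = (?z * Y f ?z - c) * cnj (e1 ?z) - Y e ?z * cnj (k ?z)"
        by (simp add: algebra_simps)
    qed
  qed (use Y[OF e(1)] e1 k in auto)
  have "fcoeff e1 0 = fcoeff e N" unfolding e1_def[abs_def] fcoeff_powi_mult by simp
  then have c0: "c = 0" using X0 e(2) by (simp only: fcoeff_scale fcoeff_cnj) simp
  have L: "(\<lambda>z. of_real s * J f z) \<in> L1c" "(\<lambda>z. u z * cnj (f z)) \<in> L1c"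
    by (intro L1c_scale L2_L1 L2_mult_L1 L2c_cnj u E_L2c E_J f)+
  have "of_real s * fcoeff (J f) (-1) - fcoeff (\<lambda>z. u z * cnj (f z)) (-1) = 0"
    using c0 unfolding c_def Y_def by (simp add: fcoeff_diff[OF L] fcoeff_scale)
  \<comment> \<open>The equation at frequency -1 is what the shifted pair \<open>cnj z * f\<close>,
    \<open>z * J f\<close> requires at frequency 0.\<close>
  then have um1: "fcoeff (\<lambda>z. u z * cnj (f z)) (-1) = of_real s * fcoeff (J f) (-1)" by simp
  have f0: "fcoeff f 0 = 0" using van[OF f(1), of 0] f(2) N0 by (cases "N = 0") auto
  let ?g = "\<lambda>z. cnj z * f z"
  have pf: "of_real s * fcoeff (J f) n = fcoeff (\<lambda>z. u z * cnj (f z)) n"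
       "of_real s * fcoeff f n = fcoeff (\<lambda>z. u z * cnj (J f z)) n" if "n \<ge> 0" for n
    using E_pair[OF f(1)] that by (auto simp: schmidt_pair_def)
  have Jg: "J ?g = (\<lambda>z. z * J f z)" by (simp add: J_def fun_eq_iff mult_ac)
  have "?g \<in> H2"
  proof (rule H2I)
    show "?g \<in> L2c" using L2c_mult_bounded[OF E_L2c[OF f(1)] meas_circ_cnj_id, of 1] by (simp add: mult.commute)
    show "fcoeff ?g n = 0" if "n < 0" for n
      using that f0 H2_neg[OF E_H2[OF f(1)], of "n+1"] by (cases "n = -1") (auto simp: fcoeff_mult_cnj_id)
  qed
  moreover have "(\<lambda>z. z * J f z) \<in> H2"
  proof (rule H2I)
    show "(\<lambda>z. z * J f z) \<in> L2c" using L2c_powi_mult[OF E_L2c[OF E_J[OF f(1)]], of 1] by simp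
    show "fcoeff (\<lambda>z. z * J f z) n = 0" if "n < 0" for n
      using that H2_neg[OF E_H2[OF E_J[OF f(1)]], of "n-1"] by (auto simp: fcoeff_mult_id)
  qed
  moreover have "of_real s * fcoeff (\<lambda>z. z * J f z) n = fcoeff (\<lambda>z. u z * cnj (cnj z * f z)) n" if "n \<ge> 0" for n
  proof -
    have "(\<lambda>z. u z * cnj (cnj z * f z)) = (\<lambda>z. z * (u z * cnj (f z)))" by (simp add: fun_eq_iff mult_ac)
    then show ?thesis using pf(1)[of "n - 1"] um1 that
      by (cases "n = 0") (simp_all add: fcoeff_mult_id)
  qed
  moreover have "of_real s * fcoeff ?g n = fcoeff (\<lambda>z. u z * cnj (z * J f z)) n" if "n \<ge> 0" for n
  proof -
    have "(\<lambda>z. u z * cnj (z * J f z)) = (\<lambda>z. cnj z * (u z * cnj (J f z)))" by (simp add: fun_eq_iff mult_ac)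
    then show ?thesis using pf(2)[of "n + 1"] that by (simp add: fcoeff_mult_cnj_id)
  qed
  ultimately show ?thesis unfolding E_def schmidt_pair_def mem_Collect_eq Jg by blast
qed

text \<open>Up to a scalar, pairing with \<open>p\<close> is the coefficient functional of order
  \<open>N\<close> on \<open>E\<close>. The representing element is found as the function of least
  norm among those with coefficient 1; minimality makes it orthogonal to the kernel of the
  functional, and it is normalised at the end.\<close>

lemma extremal_function:
  assumes e: "e \<in> E" "\<not> ae_eq_circ e (\<lambda>_. 0)"
  obtains N p where "\<And>f n. f \<in> E \<Longrightarrow> n < N \<Longrightarrow> fcoeff f n = 0" "p \<in> E" "fcoeff p N \<noteq> 0" "sqnorm_circ p = 1"
    "\<And>h. h \<in> E \<Longrightarrow> fcoeff h N = 0 \<Longrightarrow> cint (\<lambda>z. h z * cnj (p z)) = 0"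
proof -
  obtain n1 where n1: "fcoeff e n1 \<noteq> 0" using fcoeff_unique_zero[OF L2_L1[OF E_L2c[OF e(1)]]] e(2) by blast
  then have n1p: "n1 \<ge> 0" using H2_neg[OF E_H2[OF e(1)]] not_le by blast
  \<comment> \<open>Negative coefficients vanish on \<open>E\<close>, so the least order can be
    sought among natural numbers.\<close>
  define M where "M = (LEAST n::nat. \<exists>f\<in>E. fcoeff f (int n) \<noteq> 0)"
  define N where "N = int M"
  have "\<exists>f\<in>E. fcoeff f N \<noteq> 0" unfolding N_def M_def
    by (rule LeastI[of _ "nat n1"]) (use n1 n1p e(1) in auto)
  then obtain f1 where f1: "f1 \<in> E" "fcoeff f1 N \<noteq> 0" by blast
  have van: "fcoeff f n = 0" if "f \<in> E" "n < N" for f n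
  proof (cases "n < 0")
    case True then show ?thesis using H2_neg[OF E_H2[OF that(1)]] by blast
  next
    case False
    then have "nat n < M" using that by (auto simp: N_def)
    then show ?thesis
      using not_less_Least[of "nat n" "\<lambda>n::nat. \<exists>f\<in>E. fcoeff f (int n) \<noteq> 0"] False that(1) unfolding M_def by auto
  qed
  define S where "S = {h \<in> E. fcoeff h N = 1}"
  have S2: "S \<subseteq> L2c" by (auto simp: S_def E_L2c)
  have "(\<lambda>z. (1 / fcoeff f1 N) * f1 z) \<in> S" using f1 by (simp only: S_def mem_Collect_eq E_scale fcoeff_scale) simp
  then have Sn: "S \<noteq> {}" by blast
  obtain q where q: "q \<in> S" "\<And>h. h \<in> S \<Longrightarrow> sqnorm_circ q \<le> sqnorm_circ h"
  proof (rule min_norm_exists[OF S2 Sn])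
    show "(\<lambda>z. 1/2 * (f z + g z)) \<in> S" if "f \<in> S" "g \<in> S" for f g
      using that unfolding S_def mem_Collect_eq fcoeff_scale
      by (auto intro!: E_scale[of "\<lambda>z. f z + g z" "1/2", simplified] E_add simp: fcoeff_add L2_L1 E_L2c)
    show "f \<in> S" if "\<And>k. F k \<in> S" "f \<in> L2c" "l2conv F f" for F f
    proof -
      have FE: "F k \<in> E" "fcoeff (F k) N = 1" for k using that(1)[of k] by (auto simp: S_def)
      have "fcoeff f N = 1"
        using l2conv_fcoeff[OF E_L2c[OF FE(1)] that(2,3), of N] FE(2) by (simp add: LIMSEQ_const_iff)
      then show ?thesis using E_closed[OF FE(1) that(2,3)] by (simp add: S_def)
    qed
  qed blast
  have qE: "q \<in> E" and qN: "fcoeff q N = 1" using q(1) by (auto simp: S_def)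
  have orth: "cint (\<lambda>z. q z * cnj (v z)) = 0" if v: "v \<in> E" "fcoeff v N = 0" for v
  proof (rule minimal_orthogonal[OF E_L2c[OF qE] E_L2c[OF v(1)]])
    fix c
    have "(\<lambda>z. q z - c * v z) \<in> S"
      using E_diff[OF qE E_scale[OF v(1)]] qN v
      by (simp add: S_def fcoeff_diff[OF L2_L1[OF E_L2c[OF qE]] L1c_scale[OF L2_L1[OF E_L2c[OF v(1)]]]] fcoeff_scale)
    then show "sqnorm_circ q \<le> sqnorm_circ (\<lambda>z. q z - c * v z)" by (rule q(2))
  qed
  have q0: "sqnorm_circ q > 0"
  proof (rule ccontr)
    assume "\<not> ?thesis"
    then have "sqnorm_circ q = 0" using sqnorm_nonneg[of q] by simp
    then have "ae_eq_circ q (\<lambda>_. 0)" using sqnorm_zero_iff[OF E_L2c[OF qE]] by blast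
    then have "fcoeff q N = fcoeff (\<lambda>_. 0) N" by (intro fcoeff_cong_AE L2c_meas_circ[OF E_L2c[OF qE]] meas_circ_const)
    then show False using qN by (simp add: fcoeff_const)
  qed
  define r where "r = complex_of_real (1 / l2norm q)"
  have nq: "l2norm q > 0" using q0 by (simp add: l2norm_def)
  show ?thesis
  proof (rule that[OF van])
    show "(\<lambda>z. r * q z) \<in> E" by (rule E_scale[OF qE])
    show "fcoeff (\<lambda>z. r * q z) N \<noteq> 0" using nq unfolding fcoeff_scale qN by (simp add: r_def)
    show "sqnorm_circ (\<lambda>z. r * q z) = 1" using nq
      unfolding sqnorm_scale r_def l2norm_sq[symmetric] by (simp add: norm_divide power_divide)
    show "cint (\<lambda>z. h z * cnj (r * q z)) = 0" if h: "h \<in> E" "fcoeff h N = 0" for h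
    proof -
      have "cint (\<lambda>z. h z * cnj (r * q z)) = cint (\<lambda>z. cnj r * cnj (q z * cnj (h z)))"
        by (rule cint_cong) simp
      also have "\<dots> = 0" unfolding cint_scale cint_cnj orth[OF h] by simp
      finally show ?thesis .
    qed
  qed
qed

end

subsection \<open>Factorization through the extremal function\<close>

locale schmidt_extremal = schmidt_space +
  fixes N :: int and p :: "complex \<Rightarrow> complex"
  assumes van: "\<And>f n. f \<in> E \<Longrightarrow> n < N \<Longrightarrow> fcoeff f n = 0"
    and pE: "p \<in> E" and pN: "fcoeff p N \<noteq> 0" and p1: "sqnorm_circ p = 1"
    and orth: "\<And>h. h \<in> E \<Longrightarrow> fcoeff h N = 0 \<Longrightarrow> cint (\<lambda>z. h z * cnj (p z)) = 0"
begin

text \<open>By \<open>orth\<close> and \<open>p1\<close> this is, on \<open>E\<close>, also the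
  inner product of \<open>h\<close> with \<open>p\<close>. Removing \<open>hitt_coeff h * p\<close>
  therefore raises the order of vanishing and splits the norm orthogonally at the same time.\<close>

definition hitt_coeff :: "(complex \<Rightarrow> complex) \<Rightarrow> complex" where
  "hitt_coeff h = fcoeff h N / fcoeff p N"

definition hitt_step :: "(complex \<Rightarrow> complex) \<Rightarrow> complex \<Rightarrow> complex" where
  "hitt_step h z = cnj z * (h z - hitt_coeff h * p z)"

lemma p_meas_circ: "meas_circ p"
  by (rule L2c_meas_circ[OF E_L2c[OF pE]])

lemma fcoeff_reduced:
  assumes "h \<in> E" shows "fcoeff (\<lambda>z. h z - hitt_coeff h * p z) N = 0"
proof -
  have "fcoeff (\<lambda>z. h z - hitt_coeff h * p z) N = fcoeff h N - hitt_coeff h * fcoeff p N"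
    unfolding fcoeff_scale[symmetric]
    by (intro fcoeff_diff L1c_scale L2_L1 E_L2c assms pE)
  then show ?thesis using pN by (simp add: hitt_coeff_def)
qed

lemma reduced_E: "h \<in> E \<Longrightarrow> (\<lambda>z. h z - hitt_coeff h * p z) \<in> E"
  by (intro E_diff E_scale pE)

lemma hitt_step_E: "h \<in> E \<Longrightarrow> hitt_step h \<in> E"
  unfolding hitt_step_def[abs_def]
  by (rule near_invariance[OF van pE pN reduced_E fcoeff_reduced])

lemma hitt_step_norm:
  assumes h: "h \<in> E" shows "sqnorm_circ h = (cmod (hitt_coeff h))\<^sup>2 + sqnorm_circ (hitt_step h)"
proof -
  let ?r = "\<lambda>z. h z - hitt_coeff h * p z"
  have "cint (\<lambda>z. ?r z * cnj (hitt_coeff h * p z)) = cint (\<lambda>z. cnj (hitt_coeff h) * (?r z * cnj (p z)))"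
    by (rule cint_cong) simp
  also have "\<dots> = 0" unfolding cint_scale orth[OF reduced_E[OF h] fcoeff_reduced[OF h]] by simp
  finally have "sqnorm_circ (\<lambda>z. ?r z + hitt_coeff h * p z) = sqnorm_circ ?r + sqnorm_circ (\<lambda>z. hitt_coeff h * p z)"
    using sqnorm_add[OF E_L2c[OF reduced_E[OF h]] L2c_scale[OF E_L2c[OF pE]], of "hitt_coeff h"] by simp
  moreover have "sqnorm_circ (hitt_step h) = sqnorm_circ ?r"
    by (rule sqnorm_cong) (simp add: hitt_step_def norm_mult)
  ultimately show ?thesis by (simp add: sqnorm_scale p1)
qed

lemma hitt_step_pow_E: "h \<in> E \<Longrightarrow> (hitt_step ^^ n) h \<in> E"
  by (induction n) (auto intro: hitt_step_E)

lemma hitt_step_pow_norm: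
  "h \<in> E \<Longrightarrow> sqnorm_circ h = (\<Sum>k<n. (cmod (hitt_coeff ((hitt_step ^^ k) h)))\<^sup>2) + sqnorm_circ ((hitt_step ^^ n) h)"
proof (induction n)
  case (Suc n)
  then show ?case using hitt_step_norm[OF hitt_step_pow_E[OF Suc.prems, of n]] by simp
qed simp

lemma hitt_step_pow_expand:
  "h (cis t) = p (cis t) * (\<Sum>k<n. hitt_coeff ((hitt_step ^^ k) h) * cis t ^ k) + cis t ^ n * (hitt_step ^^ n) h (cis t)"
proof (induction n)
  case (Suc n)
  have "cis t ^ Suc n * (hitt_step ^^ Suc n) h (cis t)
     = cis t ^ n * ((cis t * cnj (cis t)) * ((hitt_step ^^ n) h (cis t) - hitt_coeff ((hitt_step ^^ n) h) * p (cis t)))"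
    by (simp add: hitt_step_def mult_ac del: cis_cnj_mult)
  also have "\<dots> = cis t ^ n * (hitt_step ^^ n) h (cis t) - p (cis t) * (hitt_coeff ((hitt_step ^^ n) h) * cis t ^ n)"
    by (simp add: algebra_simps)
  finally show ?case using Suc.IH by (simp add: distrib_left)
qed simp

text \<open>The norm identity bounds the squares of the successive Hitt coefficients, so they are
  the coefficients of a Hardy function \<open>a\<close>. At a fixed frequency \<open>m\<close>
  neither the remainder, which carries the factor \<open>z ^ n\<close>, nor \<open>p\<close> times
  the tail of \<open>a\<close> contributes once \<open>n > m\<close>; hence the remainders need not
  tend to zero, and the norm bound is only an inequality.\<close>

lemma factorization:
  assumes h: "h \<in> E"
  obtains a where "a \<in> H2" "fcoeff a 0 = hitt_coeff h" "sqnorm_circ a \<le> sqnorm_circ h" "ae_eq_circ h (\<lambda>z. p z * a z)"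
proof -
  define c where "c n = (if n < 0 then 0 else hitt_coeff ((hitt_step ^^ nat n) h))" for n :: int
  have sum_c: "(\<Sum>n\<in>{- int M..int M}. (cmod (c n))\<^sup>2) \<le> sqnorm_circ h" for M
  proof -
    have "(\<Sum>n\<in>{- int M..int M}. (cmod (c n))\<^sup>2) = (\<Sum>n\<in>{0..int M}. (cmod (c n))\<^sup>2)"
      by (rule sum.mono_neutral_right) (auto simp: c_def)
    also have "\<dots> = (\<Sum>k<Suc M. (cmod (hitt_coeff ((hitt_step ^^ k) h)))\<^sup>2)"
      by (rule sum.reindex_bij_witness[of _ int nat]) (auto simp: c_def)
    also have "\<dots> \<le> sqnorm_circ h" using hitt_step_pow_norm[OF h, of "Suc M"] sqnorm_nonneg by simp
    finally show ?thesis .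
  qed
  obtain a where a: "a \<in> L2c" "\<And>n. fcoeff a n = c n" "sqnorm_circ a \<le> sqnorm_circ h"
    using riesz_fischer[OF sum_c] by blast
  have aH: "a \<in> H2" by (rule H2I[OF a(1)]) (simp add: a(2) c_def)
  have "ae_eq_circ h (\<lambda>z. p z * a z)"
  proof (rule fcoeff_unique)
    show "h \<in> L1c" by (rule L2_L1[OF E_L2c[OF h]])
    show pa: "(\<lambda>z. p z * a z) \<in> L1c" by (rule L2_mult_L1[OF E_L2c[OF pE] a(1)])
    fix m :: int
    \<comment> \<open>Exceeds \<open>m\<close> for negative \<open>m\<close> as well.\<close>
    define n where "n = Suc (nat m)"
    have mn: "m < int n" by (simp add: n_def)
    define S where "S z = (\<Sum>k<n. hitt_coeff ((hitt_step ^^ k) h) * z ^ k)" for z :: complex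
    have Strig: "S z = trigp c {0..<int n} z" for z
      unfolding S_def trigp_def
      by (rule sum.reindex_bij_witness[of _ nat int]) (auto simp: c_def power_int_def)
    then have S: "S = trigp c {0..<int n}" by (rule ext)
    have S2: "S \<in> L2c" unfolding S by (rule trigp_L2c)
    have Sc: "fcoeff S j = (if j \<in> {0..<int n} then c j else 0)" for j
      unfolding S by (rule fcoeff_trigp) simp
    have R2: "(hitt_step ^^ n) h \<in> L2c" by (rule E_L2c[OF hitt_step_pow_E[OF h]])
    have L: "(\<lambda>z. p z * S z) \<in> L1c" "(\<lambda>z. z powi int n * (hitt_step ^^ n) h z) \<in> L1c"
      by (rule L2_mult_L1[OF E_L2c[OF pE] S2], rule L1c_powi_mult[OF L2_L1[OF R2]])
    have "fcoeff h m = fcoeff (\<lambda>z. p z * S z + z powi int n * (hitt_step ^^ n) h z) m"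
    proof (rule fcoeff_cong)
      show "h (cis t) = p (cis t) * S (cis t) + cis t powi int n * (hitt_step ^^ n) h (cis t)" for t
        using hitt_step_pow_expand[of h t n] unfolding S_def by simp
    qed
    also have "\<dots> = fcoeff (\<lambda>z. p z * S z) m"
      using mn H2_neg[OF E_H2[OF hitt_step_pow_E[OF h, of n]], of "m - int n"] by (simp add: fcoeff_add[OF L] fcoeff_powi_mult del: power_int_of_nat)
    also have "\<dots> = fcoeff (\<lambda>z. p z * a z) m"
    proof -
      have "fcoeff (\<lambda>z. p z * (a z - S z)) m = 0"
      proof (rule fcoeff_mult_zero[OF E_L2c[OF pE] L2c_diff[OF a(1) S2]])
        fix k
        show "fcoeff p k = 0 \<or> fcoeff (\<lambda>z. a z - S z) (m - k) = 0"
        proof (cases "k < 0")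
          case True then show ?thesis using H2_neg[OF E_H2[OF pE]] by simp
        next
          case False
          then have "m - k < int n" using mn by simp
          then show ?thesis by (simp add: fcoeff_diff[OF L2_L1[OF a(1)] L2_L1[OF S2]] a(2) Sc c_def)
        qed
      qed
      then show ?thesis using fcoeff_diff[OF pa L(1), of m] by (simp add: right_diff_distrib)
    qed
    finally show "fcoeff h m = fcoeff (\<lambda>z. p z * a z) m" .
  qed
  moreover have "fcoeff a 0 = hitt_coeff h" by (simp add: a(2) c_def)
  ultimately show ?thesis using that aH a(3) by blast
qed

lemma p_nonzero: "AE t in circ. p (cis t) \<noteq> 0"
proof (rule H2_zero_set[OF E_H2[OF pE]])
  show "\<not> ae_eq_circ p (\<lambda>_. 0)" using sqnorm_zero_iff[OF E_L2c[OF pE]] p1 by simp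
qed

lemma p_cancel:
  assumes "ae_eq_circ (\<lambda>z. p z * a z) (\<lambda>z. p z * b z)" shows "ae_eq_circ a b"
  using assms p_nonzero unfolding ae_eq_circ_def by eventually_elim simp

end

section \<open>The inner function and the isometry on its model space\<close>

locale schmidt_inner = schmidt_extremal +
  fixes \<theta> :: "complex \<Rightarrow> complex"
  assumes \<theta>: "\<theta> \<in> H2" and J_p: "ae_eq_circ (J p) (\<lambda>z. p z * \<theta> z)"
begin

lemma \<theta>_norm: "AE t in circ. cmod (\<theta> (cis t)) = 1"
  using J_p[unfolded ae_eq_circ_def] p_nonzero
proof eventually_elim
  case (elim t)
  then have "cmod (p (cis t)) = cmod (p (cis t)) * cmod (\<theta> (cis t))"
    using norm_J[of p "cis t"] by (simp add: norm_mult)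
  then show ?case using elim(2) by simp
qed

lemma \<theta>_meas_circ: "meas_circ \<theta>"
  by (rule L2c_meas_circ[OF H2_L2c[OF \<theta>]])

text \<open>\<open>factorization\<close> yields some quotient \<open>b\<close> of
  \<open>p a\<close>; as \<open>p\<close> is nonzero almost everywhere, \<open>b\<close> agrees with
  \<open>a\<close>. The same argument for \<open>J (p a) = p \<theta> cnj a\<close> gives the last
  claim, which places \<open>a\<close> in the model space of \<open>z \<theta>\<close>.\<close>

lemma multiplier_E:
  assumes a: "a \<in> L2c" and pa: "(\<lambda>z. p z * a z) \<in> E"
  shows "a \<in> H2" "fcoeff a 0 = hitt_coeff (\<lambda>z. p z * a z)" "sqnorm_circ a \<le> sqnorm_circ (\<lambda>z. p z * a z)"
    "(\<lambda>z. \<theta> z * cnj (a z)) \<in> H2"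
proof -
  obtain b where b: "b \<in> H2" "fcoeff b 0 = hitt_coeff (\<lambda>z. p z * a z)" "sqnorm_circ b \<le> sqnorm_circ (\<lambda>z. p z * a z)"
      "ae_eq_circ (\<lambda>z. p z * a z) (\<lambda>z. p z * b z)"
    using factorization[OF pa] .
  have ab: "ae_eq_circ b a" by (rule ae_eq_circ_sym[OF p_cancel[OF b(4)]])
  have bm: "meas_circ b" by (rule L2c_meas_circ[OF H2_L2c[OF b(1)]])
  show "a \<in> H2" by (rule H2_cong_AE[OF b(1) L2c_meas_circ[OF a] ab])
  show "fcoeff a 0 = hitt_coeff (\<lambda>z. p z * a z)" using fcoeff_cong_AE[OF bm L2c_meas_circ[OF a] ab] b(2) by simp
  have "sqnorm_circ b = sqnorm_circ a"
    by (rule sqnorm_cong_AE[OF bm L2c_meas_circ[OF a]]) (use ab in \<open>auto simp: ae_eq_circ_def elim: eventually_mono\<close>)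
  then show "sqnorm_circ a \<le> sqnorm_circ (\<lambda>z. p z * a z)" using b(3) by simp
  obtain d where d: "d \<in> H2" "ae_eq_circ (J (\<lambda>z. p z * a z)) (\<lambda>z. p z * d z)"
    using factorization[OF E_J[OF pa]] by blast
  have "ae_eq_circ (\<lambda>z. p z * d z) (\<lambda>z. p z * (\<theta> z * cnj (a z)))"
    using d(2) J_p unfolding ae_eq_circ_def
  proof eventually_elim
    case (elim t)
    have "J (\<lambda>z. p z * a z) (cis t) = J p (cis t) * cnj (a (cis t))" by (simp add: J_def)
    also have "\<dots> = p (cis t) * (\<theta> (cis t) * cnj (a (cis t)))" unfolding elim(2) by (rule mult.assoc)
    finally show ?case unfolding elim(1) .
  qed
  then show "(\<lambda>z. \<theta> z * cnj (a z)) \<in> H2"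
    by (rule H2_cong_AE[OF d(1) meas_circ_mult[OF \<theta>_meas_circ meas_circ_cnj[OF L2c_meas_circ[OF a]]] p_cancel])
qed

definition isometric_space :: "(complex \<Rightarrow> complex) set" where
  "isometric_space = {a \<in> L2c. (\<lambda>z. p z * a z) \<in> E \<and> sqnorm_circ (\<lambda>z. p z * a z) = sqnorm_circ a}"

lemma isometric_space_D: "a \<in> isometric_space \<Longrightarrow> a \<in> L2c" "a \<in> isometric_space \<Longrightarrow> (\<lambda>z. p z * a z) \<in> E"
  "a \<in> isometric_space \<Longrightarrow> sqnorm_circ (\<lambda>z. p z * a z) = sqnorm_circ a"
  by (auto simp: isometric_space_def)

lemma isometric_space_scale:
  assumes "a \<in> isometric_space" shows "(\<lambda>z. c * a z) \<in> isometric_space"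
proof -
  have e: "(\<lambda>z. p z * (c * a z)) = (\<lambda>z. c * (p z * a z))" by (simp add: fun_eq_iff)
  show ?thesis using isometric_space_D[OF assms] unfolding isometric_space_def mem_Collect_eq e
    by (simp only: L2c_scale E_scale sqnorm_scale)
qed

text \<open>By \<open>multiplier_E\<close>, \<open>sqnorm (p a) - sqnorm a\<close> is a nonnegative quadratic form, so its zero set is a
  subspace.\<close>

lemma isometric_space_add:
  assumes a: "a \<in> isometric_space" and b: "b \<in> isometric_space" shows "(\<lambda>z. a z + b z) \<in> isometric_space"
proof -
  note A = isometric_space_D[OF a] and B = isometric_space_D[OF b]
  have e: "(\<lambda>z. p z * (a z + b z)) = (\<lambda>z. p z * a z + p z * b z)" "(\<lambda>z. p z * (a z - b z)) = (\<lambda>z. p z * a z - p z * b z)"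
    by (simp_all add: fun_eq_iff algebra_simps)
  have E: "(\<lambda>z. p z * (a z + b z)) \<in> E" "(\<lambda>z. p z * (a z - b z)) \<in> E"
    unfolding e by (intro E_add E_diff A B)+
  have "sqnorm_circ (\<lambda>z. p z * (a z + b z)) + sqnorm_circ (\<lambda>z. p z * (a z - b z))
     = sqnorm_circ (\<lambda>z. a z + b z) + sqnorm_circ (\<lambda>z. a z - b z)"
    unfolding e sqnorm_add[OF E_L2c[OF A(2)] E_L2c[OF B(2)]] sqnorm_diff[OF E_L2c[OF A(2)] E_L2c[OF B(2)]]
      sqnorm_add[OF A(1) B(1)] sqnorm_diff[OF A(1) B(1)] A(3) B(3) by simp
  then have "sqnorm_circ (\<lambda>z. p z * (a z + b z)) = sqnorm_circ (\<lambda>z. a z + b z)"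
    using multiplier_E(3)[OF L2c_add[OF A(1) B(1)] E(1)] multiplier_E(3)[OF L2c_diff[OF A(1) B(1)] E(2)] by linarith
  then show ?thesis using E(1) L2c_add[OF A(1) B(1)] by (simp add: isometric_space_def)
qed

lemma isometric_space_cong_AE:
  assumes a: "a \<in> isometric_space" and b: "meas_circ b" "ae_eq_circ a b" shows "b \<in> isometric_space"
proof -
  note A = isometric_space_D[OF a]
  have am: "meas_circ a" by (rule L2c_meas_circ[OF A(1)])
  have pb: "ae_eq_circ (\<lambda>z. p z * a z) (\<lambda>z. p z * b z)"
    using b(2) unfolding ae_eq_circ_def by eventually_elim simp
  have "(\<lambda>z. p z * b z) \<in> E" by (rule E_cong_AE[OF A(2) meas_circ_mult[OF p_meas_circ b(1)] pb])
  moreover have "sqnorm_circ (\<lambda>z. p z * a z) = sqnorm_circ (\<lambda>z. p z * b z)"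
    by (rule sqnorm_cong_AE[OF meas_circ_mult[OF p_meas_circ am] meas_circ_mult[OF p_meas_circ b(1)]])
      (use pb in \<open>auto simp: ae_eq_circ_def elim: eventually_mono\<close>)
  moreover have "sqnorm_circ a = sqnorm_circ b"
    by (rule sqnorm_cong_AE[OF am b(1)]) (use b(2) in \<open>auto simp: ae_eq_circ_def elim: eventually_mono\<close>)
  ultimately show ?thesis using A(3) L2c_cong_AE[OF A(1) b] by (simp add: isometric_space_def)
qed

text \<open>Since \<open>p\<close> may be unbounded, convergence of \<open>p F k\<close> to
  \<open>p f\<close> is not automatic. The isometry makes \<open>p F k\<close> a Cauchy sequence;
  its limit \<open>g\<close> lies in \<open>E\<close> and is identified with \<open>p f\<close>
  through almost everywhere convergence.\<close>

lemma isometric_space_closed: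
  assumes F: "\<And>k. F k \<in> isometric_space" and f: "f \<in> L2c" and conv: "l2conv F f"
  shows "f \<in> isometric_space"
proof -
  have F2: "F k \<in> L2c" for k by (rule isometric_space_D[OF F])
  have pF: "(\<lambda>z. p z * F k z) \<in> E" for k by (rule isometric_space_D[OF F])
  have pF2: "(\<lambda>z. p z * F k z) \<in> L2c" for k by (rule E_L2c[OF pF])
  have iso: "l2norm (\<lambda>z. p z * F m z - p z * F n z) = l2norm (\<lambda>z. F m z - F n z)" for m n
  proof -
    have "(\<lambda>z. F m z + (-1) * F n z) \<in> isometric_space" by (intro isometric_space_add isometric_space_scale F)
    then have "sqnorm_circ (\<lambda>z. p z * (F m z + (-1) * F n z)) = sqnorm_circ (\<lambda>z. F m z + (-1) * F n z)"
      by (rule isometric_space_D)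
    then show ?thesis by (simp add: l2norm_def right_diff_distrib)
  qed
  obtain g where g: "g \<in> L2c" "l2conv (\<lambda>k z. p z * F k z) g"
  proof (rule L2_complete[of "\<lambda>k z. p z * F k z"])
    fix e :: real assume "e > 0"
    then obtain K where K: "\<And>k. k \<ge> K \<Longrightarrow> l2norm (\<lambda>z. F k z - f z) < e / 2"
      using LIMSEQ_D[OF conv[unfolded l2conv_def], of "e/2"] by (auto simp: l2norm_nonneg)
    have "l2norm (\<lambda>z. p z * F m z - p z * F n z) < e" if "m \<ge> K" "n \<ge> K" for m n
    proof -
      have "l2norm (\<lambda>z. F m z - F n z) \<le> l2norm (\<lambda>z. F m z - f z) + l2norm (\<lambda>z. f z - F n z)"
        by (rule l2norm_triangle_diff[OF F2 f F2])
      also have "\<dots> < e" using K[OF that(1)] K[OF that(2)] l2norm_minus_commute[of f "F n"] by simp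
      finally show ?thesis unfolding iso .
    qed
    then show "\<exists>K. \<forall>m\<ge>K. \<forall>n\<ge>K. l2norm (\<lambda>z. p z * F m z - p z * F n z) < e" by blast
  qed (use pF2 in auto)
  have gE: "g \<in> E" by (rule E_closed[OF pF g])
  obtain r :: "nat \<Rightarrow> nat" where r: "strict_mono r" "AE t in circ. (\<lambda>k. p (cis t) * F (r k) (cis t)) \<longlonglongrightarrow> g (cis t)"
    using l2conv_AE_subseq[OF pF2 g] .
  \<comment> \<open>Refining the first subsequence provides a single one along which both almost
    everywhere limits exist.\<close>
  have "l2conv (\<lambda>k. F (r k)) f"
    using LIMSEQ_subseq_LIMSEQ[OF conv[unfolded l2conv_def] r(1)] by (simp add: l2conv_def o_def)
  then obtain r' :: "nat \<Rightarrow> nat" where r': "strict_mono r'" "AE t in circ. (\<lambda>k. F (r (r' k)) (cis t)) \<longlonglongrightarrow> f (cis t)"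
    using l2conv_AE_subseq[OF F2 f, of "\<lambda>k. r k"] by blast
  have gpf: "ae_eq_circ g (\<lambda>z. p z * f z)"
    using r(2) r'(2) unfolding ae_eq_circ_def
  proof eventually_elim
    case (elim t)
    have "(\<lambda>k. p (cis t) * F (r (r' k)) (cis t)) \<longlonglongrightarrow> g (cis t)"
      using LIMSEQ_subseq_LIMSEQ[OF elim(1) r'(1)] by (simp add: o_def)
    moreover have "(\<lambda>k. p (cis t) * F (r (r' k)) (cis t)) \<longlonglongrightarrow> p (cis t) * f (cis t)"
      by (intro tendsto_intros elim)
    ultimately show ?case by (rule LIMSEQ_unique)
  qed
  have pfm: "meas_circ (\<lambda>z. p z * f z)" by (rule meas_circ_mult[OF p_meas_circ L2c_meas_circ[OF f]])
  have "(\<lambda>z. p z * f z) \<in> E" by (rule E_cong_AE[OF gE pfm gpf])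
  moreover have "sqnorm_circ g = sqnorm_circ (\<lambda>z. p z * f z)"
    by (rule sqnorm_cong_AE[OF L2c_meas_circ[OF g(1)] pfm]) (use gpf in \<open>auto simp: ae_eq_circ_def elim: eventually_mono\<close>)
  moreover have "sqnorm_circ g = sqnorm_circ f"
    using l2conv_sqnorm[OF pF2 g] l2conv_sqnorm[OF F2 f conv] unfolding isometric_space_D(3)[OF F] by (rule LIMSEQ_unique)
  ultimately show ?thesis using f by (simp add: isometric_space_def)
qed

lemma isometric_space_\<theta>: "\<theta> \<in> isometric_space"
proof -
  have pm: "meas_circ (\<lambda>z. p z * \<theta> z)" by (rule meas_circ_mult[OF p_meas_circ \<theta>_meas_circ])
  have "(\<lambda>z. p z * \<theta> z) \<in> E" by (rule E_cong_AE[OF E_J[OF pE] pm J_p])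
  moreover have "sqnorm_circ (\<lambda>z. p z * \<theta> z) = sqnorm_circ p"
    by (rule sqnorm_cong_AE[OF pm p_meas_circ]) (use \<theta>_norm in \<open>auto simp: norm_mult elim: eventually_mono\<close>)
  moreover have "sqnorm_circ \<theta> = sqnorm_circ (\<lambda>_. 1)"
    by (rule sqnorm_cong_AE[OF \<theta>_meas_circ meas_circ_const]) (use \<theta>_norm in \<open>auto elim: eventually_mono\<close>)
  moreover have "sqnorm_circ (\<lambda>_. 1) = 1" by (simp add: sqnorm_circ_def measure_circ)
  ultimately show ?thesis using p1 H2_L2c[OF \<theta>] by (simp add: isometric_space_def)
qed

definition backward_shift :: "(complex \<Rightarrow> complex) \<Rightarrow> complex \<Rightarrow> complex" where
  "backward_shift a z = cnj z * (a z - fcoeff a 0)"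

text \<open>By \<open>multiplier_E\<close> the Hitt step at \<open>p a\<close> subtracts
  \<open>fcoeff a 0 * p\<close>, hence equals \<open>p\<close> times the backward shift. On the side
  of \<open>a\<close> the equal loss of norm comes from the orthogonality of constants to functions
  of mean zero.\<close>

lemma isometric_space_backward_shift:
  assumes a: "a \<in> isometric_space" shows "backward_shift a \<in> isometric_space"
proof -
  note A = isometric_space_D[OF a]
  note M = multiplier_E[OF A(1,2)]
  have Sh2: "backward_shift a \<in> L2c"
    using L2c_mult_bounded[OF L2c_diff[OF A(1) L2c_const[of "fcoeff a 0"]] meas_circ_cnj_id, of 1]
    by (simp add: backward_shift_def[abs_def] mult.commute)
  have e: "(\<lambda>z. p z * backward_shift a z) = hitt_step (\<lambda>z. p z * a z)"
    unfolding hitt_step_def[abs_def] M(2)[symmetric] backward_shift_def by (simp add: fun_eq_iff algebra_simps)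
  have "cint (\<lambda>z. (a z - fcoeff a 0) * cnj (fcoeff a 0)) = 0"
  proof -
    have "cint (\<lambda>z. a z - fcoeff a 0) = 0"
      using cint_diff[OF L2_L1[OF A(1)] L1c_const[of "fcoeff a 0"]] by (simp add: cint_const fcoeff_cint)
    then show ?thesis using cint_scale[of "cnj (fcoeff a 0)" "\<lambda>z. a z - fcoeff a 0"] by (simp add: mult.commute)
  qed
  then have "sqnorm_circ (\<lambda>z. (a z - fcoeff a 0) + fcoeff a 0)
      = sqnorm_circ (\<lambda>z. a z - fcoeff a 0) + sqnorm_circ (\<lambda>_. fcoeff a 0)"
    using sqnorm_add[OF L2c_diff[OF A(1) L2c_const[of "fcoeff a 0"]] L2c_const[of "fcoeff a 0"]] by simp
  moreover have "sqnorm_circ (\<lambda>_. fcoeff a 0) = (cmod (fcoeff a 0))\<^sup>2"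
    by (simp add: sqnorm_circ_def measure_circ)
  moreover have "sqnorm_circ (backward_shift a) = sqnorm_circ (\<lambda>z. a z - fcoeff a 0)"
    by (rule sqnorm_cong) (simp add: backward_shift_def norm_mult)
  ultimately have "sqnorm_circ (backward_shift a) = sqnorm_circ (hitt_step (\<lambda>z. p z * a z))"
    using hitt_step_norm[OF A(2)] A(3) M(2) by simp
  then show ?thesis using Sh2 hitt_step_E[OF A(2)] unfolding isometric_space_def mem_Collect_eq e by simp
qed

lemma isometric_space_backward_shift_pow: "(backward_shift ^^ n) \<theta> \<in> isometric_space"
  by (induction n) (auto intro: isometric_space_\<theta> isometric_space_backward_shift)

text \<open>On the Hardy space the adjoint of the backward shift is multiplication by
  \<open>z\<close>: the subtracted constant is paired with \<open>z * d\<close>, whose mean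
  vanishes. The induction replaces \<open>d\<close> by \<open>z * d\<close>.\<close>

lemma cint_backward_shift_pow:
  "d \<in> H2 \<Longrightarrow> cint (\<lambda>z. d z * cnj ((backward_shift ^^ n) \<theta> z)) = cint (\<lambda>z. z powi int n * d z * cnj (\<theta> z))"
proof (induction n arbitrary: d)
  case 0 show ?case by simp
next
  case (Suc n)
  let ?S = "(backward_shift ^^ n) \<theta>" and ?d = "\<lambda>z. z powi 1 * d z"
  have d2: "?d \<in> H2"
    using H2_powi_shift[OF H2_L2c[OF Suc.prems], of "-1"] H2_neg[OF Suc.prems] by simp
  have S2: "?S \<in> L2c" by (rule isometric_space_D[OF isometric_space_backward_shift_pow])
  have L: "(\<lambda>z. ?d z * cnj (?S z)) \<in> L1c" "(\<lambda>z. cnj (fcoeff ?S 0) * ?d z) \<in> L1c"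
    by (intro L2_mult_L1 L1c_scale L2_L1 L2c_cnj S2 H2_L2c d2)+
  have "cint (\<lambda>z. d z * cnj ((backward_shift ^^ Suc n) \<theta> z))
    = cint (\<lambda>z. ?d z * cnj (?S z) - cnj (fcoeff ?S 0) * ?d z)"
    by (rule cint_cong) (simp add: backward_shift_def algebra_simps)
  also have "\<dots> = cint (\<lambda>z. ?d z * cnj (?S z)) - cnj (fcoeff ?S 0) * cint ?d"
    unfolding cint_diff[OF L] cint_scale ..
  also have "cint ?d = 0"
    using H2_neg[OF Suc.prems, of "-1"] by (simp add: fcoeff_cint)
  also have "cint (\<lambda>z. ?d z * cnj (?S z)) = cint (\<lambda>z. z powi int n * ?d z * cnj (\<theta> z))"
    by (rule Suc.IH[OF d2])
  also have "\<dots> = cint (\<lambda>z. z powi int (Suc n) * d z * cnj (\<theta> z))"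
  proof (rule cint_cong)
    fix t
    have "cis t powi int (Suc n) = cis t powi int n * cis t powi 1" unfolding cis_powi_add by (simp add: add.commute)
    then show "cis t powi int n * ?d (cis t) * cnj (\<theta> (cis t)) = cis t powi int (Suc n) * d (cis t) * cnj (\<theta> (cis t))"
      by (simp only: mult.assoc)
  qed
  finally show ?case by simp
qed

text \<open>The backward shifts of \<open>\<theta>\<close> span the model space: if \<open>d\<close> is orthogonal to all of them, then \<open>\<theta> * cnj d\<close> has
  no nonnegative frequencies.\<close>

lemma model_space_isometric_space:
  assumes a: "a \<in> H2" and \<theta>a: "(\<lambda>z. \<theta> z * cnj (a z)) \<in> H2"
  shows "a \<in> isometric_space"
proof -
  \<comment> \<open>Its element of least norm is the component of \<open>a\<close> orthogonal to
    \<open>isometric_space\<close>.\<close>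
  define S where "S = {d. \<exists>m\<in>isometric_space. d = (\<lambda>z. a z - m z)}"
  have SI: "(\<lambda>z. a z - m z) \<in> S" if "m \<in> isometric_space" for m unfolding S_def using that by blast
  have a2: "a \<in> L2c" by (rule H2_L2c[OF a])
  have S2: "S \<subseteq> L2c" unfolding S_def using a2 isometric_space_D(1) by (auto intro: L2c_diff)
  have Sn: "S \<noteq> {}" unfolding S_def using isometric_space_\<theta> by blast
  obtain d where d: "d \<in> S" "\<And>h. h \<in> S \<Longrightarrow> sqnorm_circ d \<le> sqnorm_circ h"
  proof (rule min_norm_exists[OF S2 Sn])
    fix f g assume "f \<in> S" "g \<in> S"
    then obtain m m' where m: "m \<in> isometric_space" "f = (\<lambda>z. a z - m z)" "m' \<in> isometric_space" "g = (\<lambda>z. a z - m' z)"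
      unfolding S_def by blast
    have "(\<lambda>z. (1/2) * (m z + m' z)) \<in> isometric_space" by (intro isometric_space_scale isometric_space_add m)
    from SI[OF this] show "(\<lambda>z. (1/2) * (f z + g z)) \<in> S"
      unfolding m by (rule back_subst[of "\<lambda>x. x \<in> S"]) (simp add: fun_eq_iff field_simps)
  next
    fix F f assume F: "\<And>k. F k \<in> S" and f: "f \<in> L2c" "l2conv F f"
    have aF: "(\<lambda>z. a z - F k z) \<in> isometric_space" for k using F[of k] unfolding S_def by auto
    have "l2conv (\<lambda>k z. a z - F k z) (\<lambda>z. a z - f z)"
    proof -
      have "l2norm (\<lambda>z. (a z - F k z) - (a z - f z)) = l2norm (\<lambda>z. F k z - f z)" for k
        by (rule l2norm_cong) (simp add: norm_minus_commute)
      then show ?thesis using f(2) by (simp add: l2conv_def)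
    qed
    then have "(\<lambda>z. a z - f z) \<in> isometric_space" by (rule isometric_space_closed[OF aF L2c_diff[OF a2 f(1)]])
    from SI[OF this] show "f \<in> S" by simp
  qed blast
  then obtain m where m: "m \<in> isometric_space" "d = (\<lambda>z. a z - m z)" unfolding S_def by blast
  note M = isometric_space_D[OF m(1)]
  have mH: "m \<in> H2" and \<theta>m: "(\<lambda>z. \<theta> z * cnj (m z)) \<in> H2" using multiplier_E[OF M(1,2)] by blast+
  have dH: "d \<in> H2" unfolding m(2) by (rule H2_diff[OF a mH])
  have orthN: "cint (\<lambda>z. d z * cnj (v z)) = 0" if v: "v \<in> isometric_space" for v
  proof (rule minimal_orthogonal[OF H2_L2c[OF dH] isometric_space_D(1)[OF v]])
    fix c
    have "(\<lambda>z. m z + c * v z) \<in> isometric_space" by (intro isometric_space_add isometric_space_scale m v)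
    from SI[OF this] have "(\<lambda>z. d z - c * v z) \<in> S" by (simp add: m(2) diff_diff_eq)
    then show "sqnorm_circ d \<le> sqnorm_circ (\<lambda>z. d z - c * v z)" by (rule d(2))
  qed
  \<comment> \<open>This settles the negative frequencies of \<open>\<theta> * cnj d\<close>;
    orthogonality to the shifts speaks only of the nonnegative ones.\<close>
  have \<theta>d: "(\<lambda>z. \<theta> z * cnj (d z)) \<in> H2"
    using H2_diff[OF \<theta>a \<theta>m] by (simp add: m(2) algebra_simps)
  have "ae_eq_circ (\<lambda>z. \<theta> z * cnj (d z)) (\<lambda>_. 0)"
  proof (rule fcoeff_unique_zero[OF L2_L1[OF H2_L2c[OF \<theta>d]]])
    fix n :: int
    show "fcoeff (\<lambda>z. \<theta> z * cnj (d z)) n = 0"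
    proof (cases "n < 0")
      case True then show ?thesis by (rule H2_neg[OF \<theta>d])
    next
      case False
      then have n: "n = int (nat n)" by simp
      have "fcoeff (\<lambda>z. \<theta> z * cnj (d z)) n = cint (\<lambda>z. cnj (z powi n * d z * cnj (\<theta> z)))"
        unfolding fcoeff_cint complex_cnj_mult complex_cnj_cnj
        by (rule cint_cong) (simp only: cnj_cis_powi mult_ac)
      also have "\<dots> = cnj (cint (\<lambda>z. z powi int (nat n) * d z * cnj (\<theta> z)))"
        unfolding cint_cnj n[symmetric] ..
      also have "\<dots> = 0"
        unfolding cint_backward_shift_pow[OF dH, symmetric] orthN[OF isometric_space_backward_shift_pow] by simp
      finally show ?thesis .
    qed
  qed
  then have "ae_eq_circ m a"
    using \<theta>_norm unfolding ae_eq_circ_def m(2)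
  proof eventually_elim
    case (elim t)
    then have "\<theta> (cis t) \<noteq> 0" by auto
    then have "cnj (a (cis t) - m (cis t)) = 0" using elim(1) by (simp only: mult_eq_0_iff) simp
    then have "a (cis t) - m (cis t) = 0" by (simp only: complex_cnj_zero_iff)
    then show ?case by simp
  qed
  then show ?thesis by (rule isometric_space_cong_AE[OF m(1) L2c_meas_circ[OF a2]])
qed

end

text \<open>If \<open>f\<close> is the image of \<open>h\<close>, then
  \<open>y = \<theta> * cnj h - f\<close> has only negative frequencies, so
  \<open>\<theta> * cnj y\<close> is in the Hardy space, and \<open>\<theta> * cnj f\<close> equals
  \<open>h - \<theta> * cnj y\<close> almost everywhere. Conversely, \<open>f\<close> is the image
  of \<open>\<theta> * cnj f\<close>.\<close>

lemma ran_hankel_inner: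
  assumes "inner_fun \<theta>"
  shows "f \<in> ran_hankel \<theta> \<longleftrightarrow> f \<in> H2 \<and> (\<lambda>z. \<theta> z * cnj (f z)) \<in> H2"
proof -
  have \<theta>: "\<theta> \<in> H2" and \<theta>1: "AE t in circ. cmod (\<theta> (cis t)) = 1" using assms by (auto simp: inner_fun_def)
  have \<theta>m: "meas_circ \<theta>" by (rule L2c_meas_circ[OF H2_L2c[OF \<theta>]])
  have \<theta>b: "AE t in circ. cmod (\<theta> (cis t)) \<le> 1" using \<theta>1 by eventually_elim simp
  have \<theta>2: "(\<lambda>z. \<theta> z * cnj (h z)) \<in> L2c" if "h \<in> L2c" for h
    using L2c_mult_bounded[OF L2c_cnj[OF that] \<theta>m \<theta>b] by (simp add: mult.commute)
  have inv: "ae_eq_circ (\<lambda>z. \<theta> z * cnj (\<theta> z * cnj (h z))) h" for h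
    using \<theta>1 unfolding ae_eq_circ_def
  proof eventually_elim
    case (elim t)
    have "\<theta> (cis t) * cnj (\<theta> (cis t)) = 1" using complex_norm_square[of "\<theta> (cis t)"] elim by simp
    then have "(\<theta> (cis t) * cnj (\<theta> (cis t))) * h (cis t) = h (cis t)" by simp
    then show ?case by (simp add: mult.assoc)
  qed
  show ?thesis
  proof
    assume "f \<in> ran_hankel \<theta>"
    then obtain h where h: "h \<in> H2" "hankel \<theta> h f" by (auto simp: ran_hankel_def)
    have f: "f \<in> H2" using h(2) by (simp add: hankel_def)
    define y where "y z = \<theta> z * cnj (h z) - f z" for z
    have y2: "y \<in> L2c" unfolding y_def[abs_def] by (intro L2c_diff \<theta>2 H2_L2c h f)
    have yc: "fcoeff y n = 0" if "n \<ge> 0" for n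
      using h(2) that unfolding y_def[abs_def]
      by (simp add: fcoeff_diff[OF L2_L1[OF \<theta>2[OF H2_L2c[OF h(1)]]] L2_L1[OF H2_L2c[OF f]]] hankel_def)
    have "(\<lambda>z. \<theta> z * cnj (y z)) \<in> H2"
    proof (rule H2I[OF \<theta>2[OF y2]])
      fix n :: int assume n: "n < 0"
      show "fcoeff (\<lambda>z. \<theta> z * cnj (y z)) n = 0"
      proof (rule fcoeff_mult_zero[OF H2_L2c[OF \<theta>] L2c_cnj[OF y2]])
        show "fcoeff \<theta> k = 0 \<or> fcoeff (\<lambda>z. cnj (y z)) (n - k) = 0" for k
          using n yc[of "k - n"] H2_neg[OF \<theta>, of k] by (cases "k < 0") (simp_all add: fcoeff_cnj)
      qed
    qed
    then have D: "(\<lambda>z. h z - \<theta> z * cnj (y z)) \<in> H2" by (rule H2_diff[OF h(1)])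
    have "ae_eq_circ (\<lambda>z. h z - \<theta> z * cnj (y z)) (\<lambda>z. \<theta> z * cnj (f z))"
      using inv[of h] unfolding ae_eq_circ_def
    proof eventually_elim
      case (elim t)
      have "\<theta> (cis t) * cnj (y (cis t)) = \<theta> (cis t) * cnj (\<theta> (cis t) * cnj (h (cis t))) - \<theta> (cis t) * cnj (f (cis t))"
        unfolding y_def by (simp only: complex_cnj_diff right_diff_distrib)
      then show ?case unfolding elim by simp
    qed
    then show "f \<in> H2 \<and> (\<lambda>z. \<theta> z * cnj (f z)) \<in> H2"
      using f H2_cong_AE[OF D L2c_meas_circ[OF \<theta>2[OF H2_L2c[OF f]]]] by blast
  next
    assume f: "f \<in> H2 \<and> (\<lambda>z. \<theta> z * cnj (f z)) \<in> H2"
    have "hankel \<theta> (\<lambda>z. \<theta> z * cnj (f z)) f"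
      unfolding hankel_def
    proof (intro conjI allI impI)
      show "fcoeff f n = fcoeff (\<lambda>z. \<theta> z * cnj (\<theta> z * cnj (f z))) n" for n
        using f by (intro fcoeff_cong_AE ae_eq_circ_sym[OF inv] meas_circ_mult meas_circ_cnj \<theta>m L2c_meas_circ H2_L2c) auto
    qed (use f in blast)
    then show "f \<in> ran_hankel \<theta>" using f by (auto simp: ran_hankel_def)
  qed
qed

context schmidt_space
begin

text \<open>\<open>\<theta>\<close> is the factor of \<open>J p\<close>. The inclusions between
  \<open>E\<close> and \<open>p\<close> times the range come from \<open>multiplier_E\<close> and
  \<open>model_space_isometric_space\<close>, the latter together with the isometry.\<close>

lemma schmidt_representation:
  assumes e: "e \<in> E" "\<not> ae_eq_circ e (\<lambda>_. 0)"
  obtains \<theta> p where "inner_fun \<theta>" "p \<in> E" "isometric_multiplier p (ran_hankel \<theta>)"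
    "eq_mult_space E p (ran_hankel \<theta>)" "ae_eq_circ (J p) (\<lambda>z. p z * \<theta> z)"
proof -
  obtain N p where Np: "\<And>f n. f \<in> E \<Longrightarrow> n < N \<Longrightarrow> fcoeff f n = 0" "p \<in> E" "fcoeff p N \<noteq> 0" "sqnorm_circ p = 1"
    "\<And>h. h \<in> E \<Longrightarrow> fcoeff h N = 0 \<Longrightarrow> cint (\<lambda>z. h z * cnj (p z)) = 0"
    by (rule extremal_function[OF e], rule that)
  interpret schmidt_extremal u \<phi> s N p by unfold_locales (use Np in blast)+
  obtain \<theta> where \<theta>: "\<theta> \<in> H2" "ae_eq_circ (J p) (\<lambda>z. p z * \<theta> z)"
    using factorization[OF E_J[OF pE]] by blast
  interpret schmidt_inner u \<phi> s N p \<theta> by unfold_locales (use \<theta> in blast)+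
  have inner: "inner_fun \<theta>" using \<theta> \<theta>_norm by (simp add: inner_fun_def)
  have ran: "f \<in> isometric_space" if "f \<in> ran_hankel \<theta>" for f
    using that model_space_isometric_space unfolding ran_hankel_inner[OF inner] by blast
  have "isometric_multiplier p (ran_hankel \<theta>)"
    unfolding isometric_multiplier_def using E_H2 isometric_space_D(2,3)[OF ran] by blast
  moreover have "eq_mult_space E p (ran_hankel \<theta>)"
    unfolding eq_mult_space_def
  proof (intro conjI ballI)
    fix h assume h: "h \<in> E"
    obtain a where a: "a \<in> H2" "ae_eq_circ h (\<lambda>z. p z * a z)" using factorization[OF h] by blast
    have a2: "a \<in> L2c" by (rule H2_L2c[OF a(1)])
    have "(\<lambda>z. p z * a z) \<in> E" by (rule E_cong_AE[OF h meas_circ_mult[OF p_meas_circ L2c_meas_circ[OF a2]] a(2)])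
    then have "a \<in> ran_hankel \<theta>" using multiplier_E[OF a2] unfolding ran_hankel_inner[OF inner] by blast
    then show "\<exists>g\<in>ran_hankel \<theta>. ae_eq_circ h (\<lambda>z. p z * g z)" using a(2) by blast
  next
    fix g assume "g \<in> ran_hankel \<theta>"
    then show "(\<lambda>z. p z * g z) \<in> E" using isometric_space_D(2)[OF ran] by blast
  qed
  ultimately show ?thesis using that inner pE J_p by blast
qed

end

section \<open>From the Schmidt space back to Hankel operators\<close>

lemma hankel_cong_AE:
  assumes "hankel u f g" "meas_circ g'" "ae_eq_circ g g'" shows "hankel u f g'"
proof -
  have g: "g \<in> H2" using assms(1) by (simp add: hankel_def)
  show ?thesis using assms(1) H2_cong_AE[OF g assms(2,3)] fcoeff_cong_AE[OF L2c_meas_circ[OF H2_L2c[OF g]] assms(2,3)]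
    by (simp add: hankel_def)
qed

theorem mainTheorem1:
  fixes u :: "complex \<Rightarrow> complex" and s :: real
  assumes "u \<in> BMOA" and "s > 0"
    and "\<exists>f\<in>EH u s. \<not> ae_eq_circ f (\<lambda>_. 0)"
  shows "(\<exists>\<theta> p. inner_fun \<theta> \<and> p \<in> H2 \<and> isometric_multiplier p (ran_hankel \<theta>) \<and>
            eq_mult_space (EH u s) p (ran_hankel \<theta>) \<and>
            hankel u p (\<lambda>z. of_real s * \<theta> z * p z))
       \<and> (\<forall>\<theta> p. inner_fun \<theta> \<and> p \<in> H2 \<and> isometric_multiplier p (ran_hankel \<theta>) \<and>
            eq_mult_space (EH u s) p (ran_hankel \<theta>) \<and>
            hankel u p (\<lambda>z. of_real s * \<theta> z * p z) \<longrightarrow>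
            (\<forall>f\<in>ran_hankel \<theta>.
               hankel u (\<lambda>z. p z * f z) (\<lambda>z. of_real s * p z * \<theta> z * cnj (f z))))"
proof -
  have u: "u \<in> L2c" using assms(1) by (simp add: BMOA_def H2_def)
  obtain f0 where f0: "f0 \<in> EH u s" "\<not> ae_eq_circ f0 (\<lambda>_. 0)" using assms(3) by blast
  obtain \<phi> where \<phi>: "meas_circ \<phi>" "\<And>z. cmod (\<phi> z) = 1"
      "\<And>f. f \<in> EH u s \<Longrightarrow> schmidt_pair u s f (\<lambda>z. \<phi> z * cnj (f z))"
    by (rule schmidt_unimodular[OF u assms(2) f0], rule that)
  interpret schmidt_space u \<phi> s by unfold_locales (use u assms(2) \<phi> in auto)
  have EH_E: "EH u s = E"
  proof (intro set_eqI iffI)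
    fix f
    show "f \<in> E" if "f \<in> EH u s"
      using \<phi>(3)[OF that] by (simp add: E_def J_def[abs_def])
    show "f \<in> EH u s" if "f \<in> E"
      using E_pair[OF that] EH_iff_schmidt_pair[OF assms(2)] by blast
  qed
  have hJ: "hankel u f (\<lambda>z. of_real s * J f z)" if "f \<in> E" for f
    by (rule schmidt_pair_hankel[OF E_pair[OF that]])
  obtain \<theta> p where 1: "inner_fun \<theta>" "p \<in> E" "isometric_multiplier p (ran_hankel \<theta>)"
      "eq_mult_space E p (ran_hankel \<theta>)" "ae_eq_circ (J p) (\<lambda>z. p z * \<theta> z)"
    using schmidt_representation[of f0] f0 EH_E by metis
  have "hankel u p (\<lambda>z. of_real s * \<theta> z * p z)"
  proof (rule hankel_cong_AE[OF hJ[OF 1(2)]])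
    show "meas_circ (\<lambda>z. of_real s * \<theta> z * p z)"
      using 1(1,2) by (intro meas_circ_mult meas_circ_const L2c_meas_circ) (auto simp: inner_fun_def H2_L2c E_L2c)
    show "ae_eq_circ (\<lambda>z. of_real s * J p z) (\<lambda>z. of_real s * \<theta> z * p z)"
      using 1(5) unfolding ae_eq_circ_def by eventually_elim simp
  qed
  \<comment> \<open>\<open>\<eta>\<close> and \<open>q\<close> form an arbitrary admissible pair,
    possibly different from the one constructed. Since \<open>J (q f) = J q * cnj f\<close>, the
    claim reduces to \<open>J q = \<eta> * q\<close>.\<close>
  moreover have "hankel u (\<lambda>z. q z * f z) (\<lambda>z. of_real s * q z * \<eta> z * cnj (f z))"
    if 2: "inner_fun \<eta>" "q \<in> H2" "eq_mult_space E q (ran_hankel \<eta>)" "hankel u q (\<lambda>z. of_real s * \<eta> z * q z)"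
      and f: "f \<in> ran_hankel \<eta>" for \<eta> q f
  proof -
    have \<eta>: "\<eta> \<in> H2" using 2(1) by (simp add: inner_fun_def)
    have qE: "(\<lambda>z. q z * g z) \<in> E" if "g \<in> ran_hankel \<eta>" for g
      using 2(3) that unfolding eq_mult_space_def by simp
    \<comment> \<open>Constants lie in the range because \<open>\<eta>\<close> is in the Hardy
      space; multiplying the constant 1 by \<open>q\<close> puts \<open>q\<close> itself into
      \<open>E\<close>.\<close>
    have "(\<lambda>_. 1) \<in> ran_hankel \<eta>"
      unfolding ran_hankel_inner[OF 2(1)] using \<eta> by (auto intro!: H2I L2c_const simp: fcoeff_const)
    from qE[OF this] have q: "q \<in> E" by simp
    \<comment> \<open>Both functions are Hankel images of \<open>q\<close>, so their negative
      coefficients vanish and the others are prescribed.\<close>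
    have "ae_eq_circ (\<lambda>z. of_real s * J q z) (\<lambda>z. of_real s * \<eta> z * q z)"
    proof (rule fcoeff_unique)
      have H: "(\<lambda>z. of_real s * J q z) \<in> H2" "(\<lambda>z. of_real s * \<eta> z * q z) \<in> H2"
        using hJ[OF q] 2(4) by (auto simp: hankel_def)
      show "(\<lambda>z. of_real s * J q z) \<in> L1c" "(\<lambda>z. of_real s * \<eta> z * q z) \<in> L1c"
        by (intro L2_L1 H2_L2c H)+
      show "fcoeff (\<lambda>z. of_real s * J q z) n = fcoeff (\<lambda>z. of_real s * \<eta> z * q z) n" for n
        using H2_neg[OF H(1), of n] H2_neg[OF H(2), of n] hJ[OF q] 2(4)
        by (cases "n < 0") (simp_all add: hankel_def)
    qed
    then have ae: "ae_eq_circ (\<lambda>z. of_real s * J (\<lambda>z. q z * f z) z) (\<lambda>z. of_real s * q z * \<eta> z * cnj (f z))"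
      unfolding ae_eq_circ_def
    proof eventually_elim
      case (elim t)
      have "of_real s * J (\<lambda>z. q z * f z) (cis t) = (of_real s * J q (cis t)) * cnj (f (cis t))"
        by (simp add: J_def mult_ac)
      then show ?case unfolding elim by (simp add: mult_ac)
    qed
    have fm: "meas_circ f" using f unfolding ran_hankel_inner[OF 2(1)] by (auto intro: L2c_meas_circ H2_L2c)
    show ?thesis
      by (rule hankel_cong_AE[OF hJ[OF qE[OF f]] _ ae])
        (intro meas_circ_mult meas_circ_const meas_circ_cnj fm L2c_meas_circ[OF H2_L2c[OF \<eta>]] L2c_meas_circ[OF E_L2c[OF q]])
  qed
  ultimately show ?thesis unfolding EH_E using 1 E_H2 by blast
qed

end
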